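(* Let $q\geqslant 3$ be a prime power. Assume that $q+1$ has at most two distinct prime divisors, and either $q$ is even or $q\equiv -1\pmod 4$. Then there exist a connected graph $\Gamma$ of valency $q^2$ and a group $G\leqslant\mathrm{Aut}(\Gamma)$ such that $\Gamma$ is $(G,2)$-arc-transitive and of non-diagonal PA type.
   Context: All graphs are finite, simple and undirected. For a graph $\Gamma=(V,E)$ and $G\leqslant\mathrm{Aut}(\Gamma)$, $G_\alpha$ is the stabilizer of the vertex $\alpha$. A $2$-arc is a triple $(\alpha,\beta,\gamma)$ of distinct vertices with $\{\alpha,\beta\},\{\beta,\gamma\}\in E$; $\Gamma$ is $(G,2)$-arc-transitive if $G$ is transitive on $2$-arcs. For an edge $\{\alpha,\beta\}$ put $G^*=\langle G_\alpha,G_\beta\rangle$. A permutation group is quasiprimitive if each of its minimal normal subgroups is transitive. A connected $(G,2)$-arc-transitive graph is of PA type if $G^*$ acts quasiprimitively on each of its orbits on $V$, $G^*$ has a unique minimal normal subgroup $M=T_1\times\cdots\times T_n$ with $n\geqslant2$ and the $T_i$ pairwise isomorphic nonabelian simple groups, and for a vertex $\alpha$ there are pairwise isomorphic subgroups $1\ne R_i<T_i$ with $M_\alpha\leqslant R_1\times\cdots\times R_n$ projecting surjectively onto each $R_i$. The PA type is diagonal if every projection $M_\alpha\to R_i$ is injective, and non-diagonal otherwise. *)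

theory Defs
  imports "HOL-Algebra.Algebra" "HOL-Computational_Algebra.Primes"
begin

text \<open>Simple undirected graphs: finite vertex set V, adjacency given as a
symmetric irreflexive relation E on V (each edge {a,b} appears as (a,b) and (b,a)).\<close>

definition simple_graph :: "'v set \<Rightarrow> ('v \<times> 'v) set \<Rightarrow> bool" where
  "simple_graph V E \<longleftrightarrow> finite V \<and> E \<subseteq> V \<times> V \<and> sym E \<and> (\<forall>x. (x, x) \<notin> E)"

definition connected_graph :: "'v set \<Rightarrow> ('v \<times> 'v) set \<Rightarrow> bool" where
  "connected_graph V E \<longleftrightarrow> V \<noteq> {} \<and> (\<forall>x\<in>V. \<forall>y\<in>V. (x, y) \<in> E\<^sup>*)"

definition has_valency :: "'v set \<Rightarrow> ('v \<times> 'v) set \<Rightarrow> nat \<Rightarrow> bool" where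
  "has_valency V E k \<longleftrightarrow> (\<forall>x\<in>V. card {y. (x, y) \<in> E} = k)"

text \<open>Automorphism group of a graph, as a subset of the symmetric group BijGroup V.\<close>

definition graph_aut :: "'v set \<Rightarrow> ('v \<times> 'v) set \<Rightarrow> ('v \<Rightarrow> 'v) set" where
  "graph_aut V E = {g \<in> carrier (BijGroup V). \<forall>x\<in>V. \<forall>y\<in>V. (x, y) \<in> E \<longleftrightarrow> (g x, g y) \<in> E}"

text \<open>G \<le> Aut(Gamma)\<close>
definition aut_subgroup :: "'v set \<Rightarrow> ('v \<times> 'v) set \<Rightarrow> ('v \<Rightarrow> 'v) set \<Rightarrow> bool" where
  "aut_subgroup V E G \<longleftrightarrow> subgroup G (BijGroup V) \<and> G \<subseteq> graph_aut V E"

definition two_arcs :: "('v \<times> 'v) set \<Rightarrow> ('v \<times> 'v \<times> 'v) set" where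
  "two_arcs E = {(a, b, c). (a, b) \<in> E \<and> (b, c) \<in> E \<and> a \<noteq> b \<and> b \<noteq> c \<and> a \<noteq> c}"

definition two_arc_transitive :: "('v \<times> 'v) set \<Rightarrow> ('v \<Rightarrow> 'v) set \<Rightarrow> bool" where
  "two_arc_transitive E G \<longleftrightarrow>
     (\<forall>(a, b, c)\<in>two_arcs E. \<forall>y\<in>two_arcs E. \<exists>g\<in>G. (g a, g b, g c) = y)"

definition stab :: "('v \<Rightarrow> 'v) set \<Rightarrow> 'v \<Rightarrow> ('v \<Rightarrow> 'v) set" where
  "stab H a = {h \<in> H. h a = a}"

definition orbit :: "('v \<Rightarrow> 'v) set \<Rightarrow> 'v \<Rightarrow> 'v set" where
  "orbit H a = (\<lambda>h. h a) ` H"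

definition transitive_on :: "('v \<Rightarrow> 'v) set \<Rightarrow> 'v set \<Rightarrow> bool" where
  "transitive_on H D \<longleftrightarrow> (\<forall>x\<in>D. \<forall>y\<in>D. \<exists>h\<in>H. h x = y)"

text \<open>Minimal normal subgroups of a group (HOL-Algebra structure).\<close>

definition minimal_normal :: "'a set \<Rightarrow> ('a, 'b) monoid_scheme \<Rightarrow> bool" where
  "minimal_normal N H \<longleftrightarrow> N \<lhd> H \<and> N \<noteq> {\<one>\<^bsub>H\<^esub>} \<and>
     (\<forall>K. K \<lhd> H \<and> K \<subseteq> N \<longrightarrow> K = {\<one>\<^bsub>H\<^esub>} \<or> K = N)"

text \<open>A permutation group H (subgroup of BijGroup D) is quasiprimitive if each of
its minimal normal subgroups is transitive on D.\<close>

definition quasiprimitive :: "'v set \<Rightarrow> ('v \<Rightarrow> 'v) set \<Rightarrow> bool" where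
  "quasiprimitive D H \<longleftrightarrow> subgroup H (BijGroup D) \<and>
     (\<forall>N. minimal_normal N ((BijGroup D)\<lparr>carrier := H\<rparr>) \<longrightarrow> transitive_on N D)"

text \<open>The permutation group induced by H on an invariant subset D.\<close>

definition induced_perm_group :: "'v set \<Rightarrow> ('v \<Rightarrow> 'v) set \<Rightarrow> ('v \<Rightarrow> 'v) set" where
  "induced_perm_group D H = (\<lambda>h. restrict h D) ` H"

text \<open>G^* = < G_alpha, G_beta > for an edge {alpha, beta}.\<close>

definition Gstar :: "'v set \<Rightarrow> ('v \<Rightarrow> 'v) set \<Rightarrow> 'v \<Rightarrow> 'v \<Rightarrow> ('v \<Rightarrow> 'v) set" where
  "Gstar V G a b = generate (BijGroup V) (stab G a \<union> stab G b)"

definition nonabelian_simple :: "('a, 'b) monoid_scheme \<Rightarrow> bool" where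
  "nonabelian_simple T \<longleftrightarrow> simple_group T \<and> \<not> comm_group T"

text \<open>PA type (for the edge {a,b} and the vertex a), diagonal or non-diagonal.
The internal direct decomposition M = T_0 x ... x T_(n-1) is expressed by
coordinate projections pr i : M -> T_i such that x |-> (pr i x)_i is an isomorphism
of M onto the external direct product, and pr i is the identity on T_i and trivial
on T_j for j different from i.\<close>

definition PA_type :: "bool \<Rightarrow> 'v set \<Rightarrow> ('v \<times> 'v) set \<Rightarrow> ('v \<Rightarrow> 'v) set \<Rightarrow> 'v \<Rightarrow> 'v \<Rightarrow> bool" where
  "PA_type diag V E G a b \<longleftrightarrow>
   (let S = Gstar V G a b; SG = (BijGroup V)\<lparr>carrier := S\<rparr> in
    (\<forall>x\<in>V. quasiprimitive (orbit S x) (induced_perm_group (orbit S x) S)) \<and>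
    (\<exists>M. minimal_normal M SG \<and> (\<forall>N. minimal_normal N SG \<longrightarrow> N = M) \<and>
      (let MG = (BijGroup V)\<lparr>carrier := M\<rparr> in
       \<exists>n::nat. \<exists>T pr. n \<ge> 2 \<and>
         (\<forall>i<n. subgroup (T i) MG \<and> nonabelian_simple (MG\<lparr>carrier := T i\<rparr>)) \<and>
         (\<forall>i<n. \<forall>j<n. MG\<lparr>carrier := T i\<rparr> \<cong> MG\<lparr>carrier := T j\<rparr>) \<and>
         (\<forall>i<n. pr i \<in> hom MG (MG\<lparr>carrier := T i\<rparr>)) \<and>
         (\<lambda>x. \<lambda>i\<in>{..<n}. pr i x) \<in> iso MG (product_group {..<n} (\<lambda>i. MG\<lparr>carrier := T i\<rparr>)) \<and>
         (\<forall>i<n. \<forall>j<n. \<forall>x\<in>T j. pr i x = (if i = j then x else \<one>\<^bsub>MG\<^esub>)) \<and>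
         (\<exists>R. (\<forall>i<n. subgroup (R i) (MG\<lparr>carrier := T i\<rparr>) \<and> R i \<noteq> {\<one>\<^bsub>MG\<^esub>} \<and> R i \<noteq> T i) \<and>
              (\<forall>i<n. \<forall>j<n. MG\<lparr>carrier := R i\<rparr> \<cong> MG\<lparr>carrier := R j\<rparr>) \<and>
              (\<forall>x\<in>stab M a. \<forall>i<n. pr i x \<in> R i) \<and>
              (\<forall>i<n. pr i ` stab M a = R i) \<and>
              (diag \<longleftrightarrow> (\<forall>i<n. inj_on (pr i) (stab M a)))))))"

text \<open>Connected (G,2)-arc-transitive graph of PA type (non-diagonal if diag = False).
The definition refers to an edge {alpha,beta}; we require it for every edge.\<close>

definition two_arc_PA_type :: "bool \<Rightarrow> 'v set \<Rightarrow> ('v \<times> 'v) set \<Rightarrow> ('v \<Rightarrow> 'v) set \<Rightarrow> bool" where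
  "two_arc_PA_type diag V E G \<longleftrightarrow> connected_graph V E \<and> two_arc_transitive E G \<and>
     (\<forall>(a, b)\<in>E. PA_type diag V E G a b)"

definition prime_power :: "nat \<Rightarrow> bool" where
  "prime_power q \<longleftrightarrow> (\<exists>p k. Factorial_Ring.prime (p::nat) \<and> k \<ge> 1 \<and> q = p ^ k)"

end

theory Submission
  imports Defs "HOL-Combinatorics.Permutations"
begin

text \<open>
  Write \<open>q\<^sup>2 = p\<^sup>m\<close> and let \<open>F = (\<int>/p)\<^sup>m\<close>. For every line (subgroup of order \<open>p\<close>) \<open>l\<close> of \<open>F\<close> take a
  block consisting of the cosets of \<open>l\<close> and of a second copy of each coset other than \<open>l\<close> itself.
  The affine group \<open>L = F \<rtimes> Aut F\<close> acts on the union of the blocks: \<open>Aut F\<close> acts naturally, and \<open>F\<close>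
  translates the cosets and fixes the copies. The involution \<open>t\<close> swapping every coset with its copy
  commutes with \<open>Aut F\<close>.

  On a block the supports of \<open>F\<close> and \<open>t F t\<close> meet in the single point \<open>l\<close>, so commutators are 3-cycles
  and \<open>F\<close>, \<open>t F t\<close> generate the alternating group of the block. As \<open>l\<close> acts trivially on its own block
  and on no other one, simplicity of these groups shows that \<open>F\<close> and \<open>t F t\<close> generate the full product
  \<open>M\<close> of the alternating groups. Hence \<open>H = M L\<close> is generated by \<open>L\<close> and \<open>t L t\<close>, and the coset graph
  of \<open>G = \<langle>L, t\<rangle>\<close> modulo \<open>L\<close> with arcs \<open>(x L, x t L)\<close> has local action \<open>L\<close> on \<open>L / Aut F\<close>, which is the
  2-transitive affine action on \<open>q\<^sup>2\<close> points. The stabilizer of a vertex in \<open>M\<close> contains \<open>F\<close>, and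
  its projection to the block of \<open>l\<close> kills \<open>l\<close>, so the type is non-diagonal.
\<close>

section \<open>Alternating groups\<close>

text \<open>The copy of \<open>l\<close> itself is left out on purpose: with a full second copy the
  supports of \<open>F\<close> and \<open>t F t\<close> would be disjoint and the two groups would
  commute. The flag that tells copies from cosets serves a second end. It is preserved by
  \<open>L\<close> but by no alternating group of a block, and this one invariant shows that
  \<open>M\<close> is not inside \<open>L\<close>, that \<open>G\<close> acts faithfully on the
  cosets of \<open>L\<close>, and that vertex stabilizers project to proper subgroups of the
  factors.

  All of \<open>Aut F\<close> is taken because its transitivity on nonidentity elements is used
  three times: it permutes the blocks transitively, it makes \<open>Aut F\<close> maximal in
  \<open>L\<close>, so that \<open>L \<inter> t L t\<close> is no larger than \<open>Aut F\<close>,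
  and it handles pairs of distinct neighbours.

  To lie in \<open>M\<close>, translations must be even on every block. For odd \<open>p\<close>
  they are squares; for \<open>p = 2\<close> their parity, and for all \<open>p\<close> the
  simplicity of the factors, rests on a line having at least 3 cosets, which follows from
  \<open>q \<ge> 3\<close>. \<open>Aut F\<close> and \<open>t\<close> normalize \<open>M\<close>
  whatever their parity, so \<open>t\<close> may or may not belong to \<open>H\<close>.\<close>

text \<open>The plain notation for inverse functions is taken by the inverse in a group structure.\<close>

abbreviation pinv :: "('a \<Rightarrow> 'a) \<Rightarrow> 'a \<Rightarrow> 'a" where
  "pinv p \<equiv> inv_into UNIV p"

definition alt :: "'a set \<Rightarrow> ('a \<Rightarrow> 'a) set" where
  "alt S = {p. p permutes S \<and> evenperm p}"

text \<open>For distinct arguments the cycle runs from \<open>a\<close> to \<open>b\<close> to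
  \<open>c\<close>. As a product of two transpositions it is visibly even.\<close>

definition cyc3 :: "'a \<Rightarrow> 'a \<Rightarrow> 'a \<Rightarrow> 'a \<Rightarrow> 'a" where
  "cyc3 a b c = transpose a b \<circ> transpose b c"

lemma cyc3_simps:
  assumes "a \<noteq> b" "b \<noteq> c" "a \<noteq> c"
  shows "cyc3 a b c a = b" "cyc3 a b c b = c" "cyc3 a b c c = a"
    and "\<And>x. \<lbrakk>x \<noteq> a; x \<noteq> b; x \<noteq> c\<rbrakk> \<Longrightarrow> cyc3 a b c x = x"
  using assms by (auto simp: cyc3_def transpose_def)

lemma cyc3_in_alt:
  assumes "a \<in> S" "b \<in> S" "c \<in> S" "a \<noteq> b" "b \<noteq> c"
  shows "cyc3 a b c \<in> alt S"
  using assms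
  by (auto simp: alt_def cyc3_def evenperm_comp evenperm_swap permutation_swap_id
      intro!: permutes_compose permutes_swap_id)

lemma inv_cyc3: "pinv (cyc3 a b c) = cyc3 c b a"
  unfolding cyc3_def
  by (rule inv_unique_comp) (auto simp: fun_eq_iff transpose_commute)

lemma conj_transpose:
  assumes "bij s"
  shows "s \<circ> transpose a b \<circ> pinv s = transpose (s a) (s b)"
proof
  fix x
  have "pinv s x = a \<longleftrightarrow> x = s a" "pinv s x = b \<longleftrightarrow> x = s b"
    by (metis assms bij_inv_eq_iff)+
  then show "(s \<circ> transpose a b \<circ> pinv s) x = transpose (s a) (s b) x"
    using assms by (auto simp: transpose_def bij_is_surj surj_f_inv_f bij_is_inj inv_f_f)
qed

lemma conj_comp:
  assumes "bij s"
  shows "s \<circ> (p \<circ> q) \<circ> pinv s = (s \<circ> p \<circ> pinv s) \<circ> (s \<circ> q \<circ> pinv s)"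
  using assms by (auto simp: fun_eq_iff bij_is_inj)

lemma conj_cyc3:
  assumes "bij s"
  shows "s \<circ> cyc3 a b c \<circ> pinv s = cyc3 (s a) (s b) (s c)"
  unfolding cyc3_def conj_comp[OF assms] conj_transpose[OF assms] ..

text \<open>Here \<open>x\<close>, \<open>y\<close>, \<open>u\<close>, \<open>v\<close> stand for
  successive points of an orbit of some \<open>p\<close>. The left side is then the commutator of
  \<open>p\<close> with \<open>cyc3 x y u\<close>.\<close>

lemma cyc3_comp:
  assumes "distinct [x, y, u, v]"
  shows "cyc3 y u v \<circ> cyc3 u y x = cyc3 x v y"
  using assms by (auto simp: cyc3_def fun_eq_iff transpose_def)

text \<open>The commutator with \<open>cyc3 x y w\<close> of a permutation that has the three-cycle
  from \<open>x\<close> to \<open>y\<close> to \<open>u\<close> and also moves \<open>w\<close> to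
  \<open>v\<close>. The listed images exhibit an orbit with more than three points.\<close>

lemma cyc3_comp_orbit:
  assumes "distinct [x, y, u, w, v]"
  shows "(cyc3 y u v \<circ> cyc3 w y x) x = w" "(cyc3 y u v \<circ> cyc3 w y x) w = u"
    "(cyc3 y u v \<circ> cyc3 w y x) u = v"
  using assms by (auto simp: cyc3_def transpose_def)

text \<open>The case of an involution exchanging \<open>x\<close> with \<open>y\<close> and
  \<open>w\<close> with \<open>v\<close>, and of a fifth point \<open>e\<close> that is either fixed
  or exchanged with \<open>f\<close>. In both variants \<open>x\<close> has not returned after two
  steps.\<close>

lemma cyc3_comp_orbit':
  assumes "distinct [x, y, w, v, e]"
  shows "(cyc3 y v e \<circ> cyc3 e w x) x = y" "(cyc3 y v e \<circ> cyc3 e w x) y = v"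
    and "f \<notin> set [x, y, w, v, e] \<Longrightarrow> (cyc3 y v f \<circ> cyc3 e w x) x = e"
    and "f \<notin> set [x, y, w, v, e] \<Longrightarrow> (cyc3 y v f \<circ> cyc3 e w x) e = w"
  using assms by (auto simp: cyc3_def transpose_def)

lemma alt_D:
  assumes "p \<in> alt S" "finite S"
  shows "p permutes S" "evenperm p" "permutation p" "bij p"
  using assms permutes_imp_permutation permutes_bij by (auto simp: alt_def)

lemma alt_closed:
  assumes "finite S"
  shows "id \<in> alt S"
    and "\<And>p q. p \<in> alt S \<Longrightarrow> q \<in> alt S \<Longrightarrow> p \<circ> q \<in> alt S"
    and "\<And>p. p \<in> alt S \<Longrightarrow> pinv p \<in> alt S"
  using permutes_imp_permutation[OF assms]
  by (auto simp: alt_def evenperm_comp evenperm_inv permutes_compose permutes_inv)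

text \<open>Every transposition is a product of transpositions through \<open>z\<close>, so an even
  permutation is a product of pairs of these. The induction adds single transpositions and passes
  through odd permutations; hence the invariant \<open>P\<close> also says that one more
  transposition at \<open>z\<close> brings an odd permutation into \<open>Y\<close>.\<close>

lemma alt_star_induct:
  assumes fin: "finite S" and z: "z \<in> S"
    and Y: "id \<in> Y" "\<And>p q. p \<in> Y \<Longrightarrow> q \<in> Y \<Longrightarrow> p \<circ> q \<in> Y"
    and star: "\<And>x y. \<lbrakk>x \<in> S - {z}; y \<in> S - {z}; x \<noteq> y\<rbrakk> \<Longrightarrow> transpose z x \<circ> transpose z y \<in> Y"
  shows "alt S \<subseteq> Y"
proof -
  define P where "P p \<longleftrightarrow> (evenperm p \<longrightarrow> p \<in> Y) \<and>
    (\<not> evenperm p \<longrightarrow> (\<forall>x\<in>S - {z}. transpose z x \<circ> p \<in> Y))" for p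
  have step: "P (transpose z s \<circ> p)" if "P p" "s \<in> S" "p permutes S" for p s
  proof (cases "s = z")
    case False
    have ev: "evenperm (transpose z s \<circ> p) \<longleftrightarrow> \<not> evenperm p"
      using False permutes_imp_permutation[OF fin \<open>p permutes S\<close>]
      by (auto simp: evenperm_comp evenperm_swap permutation_swap_id)
    have "transpose z x \<circ> (transpose z s \<circ> p) \<in> Y" if "evenperm p" "x \<in> S - {z}" for x
    proof (cases "x = s")
      case True
      then have "transpose z x \<circ> (transpose z s \<circ> p) = p"
        by (auto simp: fun_eq_iff)
      then show ?thesis using that \<open>P p\<close> by (auto simp: P_def)
    next
      case ne: False
      have "(transpose z x \<circ> transpose z s) \<circ> p \<in> Y"
        using that \<open>P p\<close> False ne \<open>s \<in> S\<close> by (intro Y(2) star) (auto simp: P_def)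
      then show ?thesis by (simp add: o_assoc)
    qed
    then show ?thesis using \<open>P p\<close> ev False \<open>s \<in> S\<close> by (auto simp: P_def)
  qed (use that in auto)
  have "P p" if "p permutes S" for p
    using that fin
  proof (induction rule: permutes_induct)
    case id
    then show ?case using Y(1) unfolding P_def id_def by simp
  next
    case (swap a b p)
    have zs: "transpose z x permutes S" if "x \<in> S" for x
      using permutes_swap_id z that by metis
    have "P (transpose z a \<circ> (transpose z b \<circ> (transpose z a \<circ> p)))"
      using swap by (intro step permutes_compose zs) auto
    moreover have "transpose z a \<circ> (transpose z b \<circ> (transpose z a \<circ> p)) = transpose a b \<circ> p"
      if "a \<noteq> z" "b \<noteq> z"
      using that \<open>a \<noteq> b\<close> by (auto simp: fun_eq_iff transpose_def)
    moreover have "P (transpose z a \<circ> p)" "P (transpose z b \<circ> p)"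
      using swap step by auto
    ultimately show ?case
      by (metis transpose_commute)
  qed
  then show ?thesis
    by (auto simp: P_def alt_def)
qed

lemma exists_outside:
  assumes "finite A" "card A < card S"
  obtains x where "x \<in> S" "x \<notin> A"
  using assms by (metis card_mono not_le subsetI)

text \<open>Degree at least 5 leaves two points outside the image triple, and swapping them corrects
  the parity.\<close>

lemma alt_triple_transitive:
  assumes fin: "finite S" and card: "card S \<ge> 5"
    and "{a, b, c} \<subseteq> S" "a \<noteq> b" "b \<noteq> c" "a \<noteq> c"
    and "{a', b', c'} \<subseteq> S" "a' \<noteq> b'" "b' \<noteq> c'" "a' \<noteq> c'"
  obtains s where "s \<in> alt S" "s a = a'" "s b = b'" "s c = c'"
proof -
  define s1 where "s1 = transpose a a'"
  define s2 where "s2 = transpose (s1 b) b' \<circ> s1"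
  define s3 where "s3 = transpose (s2 c) c' \<circ> s2"
  have p1: "s1 permutes S" unfolding s1_def using assms by (intro permutes_swap_id) auto
  have p2: "s2 permutes S" unfolding s2_def using assms permutes_in_image[OF p1]
    by (intro permutes_compose[OF p1] permutes_swap_id) auto
  have p3: "s3 permutes S" unfolding s3_def using assms permutes_in_image[OF p2]
    by (intro permutes_compose[OF p2] permutes_swap_id) auto
  have inj: "inj s1" "inj s2" using p1 p2 permutes_inj by auto
  have "s1 a = a'" by (simp add: s1_def)
  moreover have "s1 b \<noteq> s1 a" using inj assms by (metis injD)
  ultimately have 2: "s2 a = a'" "s2 b = b'" using assms by (auto simp: s2_def transpose_def)
  moreover have "s2 c \<noteq> s2 a" "s2 c \<noteq> s2 b" using inj assms by (metis injD)+
  ultimately have 3: "s3 a = a'" "s3 b = b'" "s3 c = c'"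
    using assms by (auto simp: s3_def transpose_def)
  show ?thesis
  proof (cases "evenperm s3")
    case True
    then show ?thesis using that[of s3] 3 p3 by (auto simp: alt_def)
  next
    case False
    obtain u where u: "u \<in> S" "u \<notin> {a', b', c'}"
      using exists_outside[of "{a', b', c'}" S] card card_length[of "[a', b', c']"] by auto
    obtain v where v: "v \<in> S" "v \<notin> {u, a', b', c'}"
      using exists_outside[of "{u, a', b', c'}" S] card card_length[of "[u, a', b', c']"] by auto
    have "transpose u v \<circ> s3 \<in> alt S"
      using False u v p3 permutes_imp_permutation[OF fin p3]
      by (auto simp: alt_def evenperm_comp evenperm_swap permutation_swap_id
          intro!: permutes_compose permutes_swap_id)
    then show ?thesis
      using that[of "transpose u v \<circ> s3"] 3 u v by (auto simp: transpose_def)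
  qed
qed

text \<open>A three-cycle through \<open>x\<close> that avoids \<open>p x\<close> fixes
  \<open>p x\<close>, while its conjugate moves it. The permutation \<open>p\<close> is neither
  assumed even nor assumed to preserve \<open>S\<close>: later it may carry a block to another
  block.\<close>

lemma alt_noncommuting:
  assumes "finite S" "card S \<ge> 5" "bij p" and "x \<in> S" and x: "p x \<noteq> x"
  obtains s where "s \<in> alt S" "p \<circ> s \<circ> pinv p \<noteq> s"
proof -
  obtain b where b: "b \<in> S" "b \<notin> {x, p x}"
    using exists_outside[of "{x, p x}" S] assms card_length[of "[x, p x]"] by auto
  obtain c where c: "c \<in> S" "c \<notin> {x, p x, b}"
    using exists_outside[of "{x, p x, b}" S] assms card_length[of "[x, p x, b]"] by auto
  have "p \<circ> cyc3 x b c \<circ> pinv p = cyc3 (p x) (p b) (p c)" by (rule conj_cyc3[OF assms(3)])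
  moreover have "inj p" using assms bij_is_inj by auto
  then have "p b \<noteq> p x" "p c \<noteq> p b" "p c \<noteq> p x" using b c by (auto dest: injD)
  then have "cyc3 (p x) (p b) (p c) (p x) = p b" by (intro cyc3_simps) auto
  moreover have "cyc3 x b c (p x) = p x" using x b c by (intro cyc3_simps) auto
  ultimately have "p \<circ> cyc3 x b c \<circ> pinv p \<noteq> cyc3 x b c"
    using \<open>p b \<noteq> p x\<close> by metis
  moreover have "cyc3 x b c \<in> alt S" using b c \<open>x \<in> S\<close> by (intro cyc3_in_alt) auto
  ultimately show ?thesis using that by blast
qed

section \<open>Simplicity of alternating groups of degree at least 5\<close>

locale normal_in_alt =
  fixes S :: "'a set" and N :: "('a \<Rightarrow> 'a) set"
  assumes fin: "finite S" and card: "card S \<ge> 5"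
    and N_sub: "N \<subseteq> alt S" and N_id: "id \<in> N"
    and N_comp: "\<And>p q. p \<in> N \<Longrightarrow> q \<in> N \<Longrightarrow> p \<circ> q \<in> N"
    and N_inv: "\<And>p. p \<in> N \<Longrightarrow> pinv p \<in> N"
    and N_conj: "\<And>p s. p \<in> N \<Longrightarrow> s \<in> alt S \<Longrightarrow> s \<circ> p \<circ> pinv s \<in> N"
begin

lemma N_commutator:
  assumes "p \<in> N" "s \<in> alt S"
  shows "p \<circ> s \<circ> pinv p \<circ> pinv s \<in> N"
proof -
  have "p \<circ> (s \<circ> pinv p \<circ> pinv s) \<in> N"
    using assms by (intro N_comp N_conj N_inv)
  then show ?thesis by (simp add: o_assoc)
qed

text \<open>By triple transitivity all three-cycles are conjugate, and those with middle point
  \<open>z\<close> are the generators of \<open>alt_star_induct\<close>.\<close>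

lemma all_of_cyc3:
  assumes "cyc3 a b c \<in> N" "{a, b, c} \<subseteq> S" "a \<noteq> b" "b \<noteq> c" "a \<noteq> c"
  shows "N = alt S"
proof
  obtain z where z: "z \<in> S" using assms by auto
  show "alt S \<subseteq> N"
  proof (rule alt_star_induct[OF fin z N_id N_comp])
    fix x y assume xy: "x \<in> S - {z}" "y \<in> S - {z}" "x \<noteq> y"
    obtain s where s: "s \<in> alt S" "s a = x" "s b = z" "s c = y"
      using alt_triple_transitive[OF fin card assms(2-5), of x z y] xy z by auto
    have "s \<circ> cyc3 a b c \<circ> pinv s \<in> N" using assms s N_conj by auto
    then have "cyc3 x z y \<in> N" using s fin conj_cyc3 alt_D(4) by metis
    then show "transpose z x \<circ> transpose z y \<in> N" by (simp add: cyc3_def transpose_commute)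
  qed
qed (rule N_sub)

lemma N_D: "p \<in> N \<Longrightarrow> p permutes S" "p \<in> N \<Longrightarrow> bij p" "p \<in> N \<Longrightarrow> inj p"
  using alt_D[OF _ fin] N_sub bij_is_inj by blast+

lemma commutator_cyc3:
  assumes "p \<in> N" "{a, b, c} \<subseteq> S" "a \<noteq> b" "b \<noteq> c"
  shows "cyc3 (p a) (p b) (p c) \<circ> cyc3 c b a \<in> N"
  using N_commutator[OF assms(1), of "cyc3 a b c"] assms cyc3_in_alt[of a S b c]
    conj_cyc3[OF N_D(2)[OF assms(1)]] by (simp add: inv_cyc3)

lemma all_of_long_orbit:
  assumes p: "p \<in> N" and "p x \<noteq> x" "p (p x) \<noteq> x" "p (p (p x)) \<noteq> x"
  shows "N = alt S"
proof -
  let ?y = "p x" and ?u = "p (p x)" and ?v = "p (p (p x))"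
  have inj: "inj p" using N_D p by auto
  then have d: "?y \<noteq> ?u" "?u \<noteq> ?v" "?y \<noteq> ?v"
    using assms(2,3) by (metis injD)+
  have x: "x \<in> S" using assms N_D(1)[OF p] permutes_not_in by metis
  then have S: "{x, ?y, ?u, ?v} \<subseteq> S" using permutes_in_image[OF N_D(1)[OF p]] by auto
  have "cyc3 ?y ?u ?v \<circ> cyc3 ?u ?y x \<in> N"
    using commutator_cyc3[OF p, of x ?y ?u] S assms d by auto
  moreover have "cyc3 ?y ?u ?v \<circ> cyc3 ?u ?y x = cyc3 x ?v ?y"
    using assms d by (intro cyc3_comp) auto
  ultimately show ?thesis
    using all_of_cyc3[of x ?v ?y] S assms d by auto
qed

text \<open>Only a point on a three-cycle of \<open>p\<close> is new. Either \<open>p\<close> is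
  this three-cycle, or it moves a further point \<open>w\<close>, and then a commutator has an orbit
  with more than three points.\<close>

lemma all_of_not_involution:
  assumes p: "p \<in> N" and x: "p x \<noteq> x" "p (p x) \<noteq> x"
  shows "N = alt S"
proof (cases "p (p (p x)) = x")
  case True
  let ?y = "p x" and ?u = "p (p x)"
  have inj: "inj p" using N_D p by auto
  then have d: "?y \<noteq> ?u" using assms(2) by (metis injD)
  have xS: "x \<in> S" using assms N_D(1)[OF p] permutes_not_in by metis
  then have S: "{x, ?y, ?u} \<subseteq> S" using permutes_in_image[OF N_D(1)[OF p]] by auto
  show ?thesis
  proof (cases "\<exists>w. w \<notin> {x, ?y, ?u} \<and> p w \<noteq> w")
    case False
    have "p w = cyc3 x ?y ?u w" for w
      using cyc3_simps[of x ?y ?u] d x True False by (cases "w \<in> {x, ?y, ?u}") auto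
    then have "cyc3 x ?y ?u = p" by (intro ext) (rule sym)
    then have "cyc3 x ?y ?u \<in> N" by (rule ssubst) (rule p)
    then show ?thesis by (rule all_of_cyc3) (use S d x in auto)
  next
    case w: True
    then obtain w where w: "w \<notin> {x, ?y, ?u}" "p w \<noteq> w" by blast
    let ?w = "p w"
    have w': "?w \<notin> {x, ?y, ?u}"
      using w True injD[OF inj, of w x] injD[OF inj, of w ?y] injD[OF inj, of w ?u] by auto
    have wS: "w \<in> S" using w N_D(1)[OF p] permutes_not_in by metis
    define r where "r = cyc3 ?y ?u ?w \<circ> cyc3 w ?y x"
    have "r \<in> N" unfolding r_def
      using commutator_cyc3[OF p, of x ?y w] S wS x w by auto
    moreover have "r x = w" "r w = ?u" "r ?u = ?w"
      unfolding r_def using x d w w' by (intro cyc3_comp_orbit; auto)+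
    ultimately show ?thesis
      using all_of_long_orbit[of r x] x w w' by auto
  qed
qed (use all_of_long_orbit assms in auto)

text \<open>What remains is an involution. Being even it exchanges at least two pairs, and degree at
  least 5 leaves a point \<open>e\<close> outside them. The commutator with a three-cycle through
  \<open>e\<close> and one point of each pair is no involution.\<close>

lemma all_of_nontrivial:
  assumes p: "p \<in> N" and "p \<noteq> id"
  shows "N = alt S"
proof (cases "\<exists>x. p x \<noteq> x \<and> p (p x) \<noteq> x")
  case False
  then have inv2: "p (p x) = x" for x by metis
  obtain x where x: "p x \<noteq> x" using assms by (auto simp: fun_eq_iff)
  have inj: "inj p" using N_D p by auto
  have mem: "z \<in> S" if "p z \<noteq> z" for z using that N_D(1)[OF p] permutes_not_in by metis
  have "\<exists>w. w \<notin> {x, p x} \<and> p w \<noteq> w"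
  proof (rule ccontr)
    assume "\<nexists>w. w \<notin> {x, p x} \<and> p w \<noteq> w"
    then have "p = transpose x (p x)" using inv2 by (auto simp: fun_eq_iff transpose_def)
    moreover have "evenperm p" using p N_sub by (auto simp: alt_def)
    ultimately show False using x evenperm_swap by metis
  qed
  then obtain w where w: "w \<notin> {x, p x}" "p w \<noteq> w" by blast
  have w': "p w \<notin> {x, p x}" using w inv2[of w] inv2[of x] injD[OF inj, of w x] by auto
  obtain e where e: "e \<in> S" "e \<notin> {x, p x, w, p w}"
    using exists_outside[of "{x, p x, w, p w}" S] card card_length[of "[x, p x, w, p w]"] by auto
  define r where "r = cyc3 (p x) (p w) (p e) \<circ> cyc3 e w x"
  have e': "p e \<notin> {x, p x, w, p w}"
    using e inv2[of e] injD[OF inj, of e x] injD[OF inj, of e w] by auto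
  have r: "r \<in> N" unfolding r_def
    using commutator_cyc3[OF p, of x w e] mem x w e by auto
  have "r x \<noteq> x \<and> r (r x) \<noteq> x"
  proof (cases "p e = e")
    case True
    then have "r x = p x" "r (p x) = p w"
      unfolding r_def using cyc3_comp_orbit'(1,2)[of x "p x" w "p w" e] x w w' e by auto
    then show ?thesis using x w w' by auto
  next
    case False
    then have "r x = e" "r e = w"
      unfolding r_def using cyc3_comp_orbit'(3,4)[of x "p x" w "p w" e "p e"] x w w' e e' by auto
    then show ?thesis using e w by auto
  qed
  then show ?thesis using all_of_not_involution[OF r] by blast
qed (use all_of_not_involution[OF p] in blast)

end

text \<open>Two permutations whose supports share a single point have a three-cycle as commutator,
  whatever their orders. It is written as the product of transpositions through \<open>z\<close>
  that \<open>alt_star_induct\<close> asks for.\<close>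

lemma commutator_eq_cyc3:
  assumes "bij u" "bij w" and supp: "\<And>x. x \<noteq> z \<Longrightarrow> u x = x \<or> w x = x"
    and "u z \<noteq> z" "w z \<noteq> z"
  shows "u \<circ> w \<circ> pinv u \<circ> pinv w = transpose z (w z) \<circ> transpose z (u z)"
proof -
  have iu: "inj u" and iw: "inj w" using assms bij_is_inj by auto
  have fu: "w (u z) = u z" using supp[of "u z"] assms(4) injD[OF iu, of "u z" z] by auto
  have fw: "u (w z) = w z" using supp[of "w z"] assms(5) injD[OF iw, of "w z" z] by auto
  have uw: "u z \<noteq> w z" using fu assms(5) injD[OF iw, of "w z" z] by auto
  \<comment> \<open>Comparing \<open>u \<circ> w\<close> with \<open>w \<circ> u\<close> keeps
    inverses out of the case distinction.\<close>
  have *: "u (w x) = transpose z (w z) (transpose z (u z) (w (u x)))" for x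
  proof (cases "x = z")
    case True
    then show ?thesis using fu fw assms by (auto simp: transpose_def)
  next
    case x: False
    show ?thesis
    proof (cases "u x = x")
      case True
      have "w x \<noteq> w z" using x iw by (auto dest: injD)
      moreover have "w x = z \<or> u (w x) = w x"
        using supp[of "w x"] injD[OF iw, of "w x" x] True by metis
      moreover have "w x \<noteq> u z"
      proof
        assume "w x = u z"
        then have "w x = w (u z)" using fu by simp
        then have "x = u z" using iw injD by metis
        then show False using True x injD[OF iu, of "u z" z] by auto
      qed
      ultimately show ?thesis using True uw assms(4,5) by (auto simp: transpose_def)
    next
      case False
      then have wx: "w x = x" using supp x by auto
      have "u x \<noteq> u z" using x iu by (auto dest: injD)
      have "u x \<noteq> w z"
        using fw injD[OF iu, of x "w z"] wx injD[OF iw, of x z] x False by metis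
      have "w (u x) = u x \<or> u x = z"
        using supp[of "u x"] injD[OF iu, of "u x" x] False by auto
      then show ?thesis
        using wx \<open>u x \<noteq> u z\<close> \<open>u x \<noteq> w z\<close> uw assms(4,5) fu fw by (auto simp: transpose_def)
    qed
  qed
  show ?thesis
  proof
    fix x
    have "u (pinv u (pinv w x)) = pinv w x" "w (pinv w x) = x"
      using assms by (auto simp: bij_is_surj surj_f_inv_f)
    then show "(u \<circ> w \<circ> pinv u \<circ> pinv w) x = (transpose z (w z) \<circ> transpose z (u z)) x"
      using *[of "pinv u (pinv w x)"] by simp
  qed
qed

section \<open>Permutation groups preserving a block system\<close>

text \<open>Total functions that are the identity outside \<open>S\<close> are used in place of
  elements of \<open>BijGroup S\<close>: they compose by plain \<open>\<circ>\<close>, and the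
  restriction to a block is again a permutation of the whole type.\<close>

definition perm_group :: "'a set \<Rightarrow> ('a \<Rightarrow> 'a) set \<Rightarrow> bool" where
  "perm_group S K \<longleftrightarrow> (\<forall>p\<in>K. p permutes S) \<and> id \<in> K \<and>
     (\<forall>p\<in>K. \<forall>q\<in>K. p \<circ> q \<in> K) \<and> (\<forall>p\<in>K. pinv p \<in> K)"

lemma perm_groupI:
  assumes "\<And>p. p \<in> K \<Longrightarrow> p permutes S" "id \<in> K"
    "\<And>p q. p \<in> K \<Longrightarrow> q \<in> K \<Longrightarrow> p \<circ> q \<in> K" "\<And>p. p \<in> K \<Longrightarrow> pinv p \<in> K"
  shows "perm_group S K"
  using assms by (auto simp: perm_group_def)

lemma perm_groupD:
  assumes "perm_group S K"
  shows "p \<in> K \<Longrightarrow> p permutes S" "id \<in> K"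
    "p \<in> K \<Longrightarrow> q \<in> K \<Longrightarrow> p \<circ> q \<in> K" "p \<in> K \<Longrightarrow> pinv p \<in> K" "p \<in> K \<Longrightarrow> bij p"
  using assms permutes_bij by (auto simp: perm_group_def)

lemma perm_group_alt: "finite S \<Longrightarrow> perm_group S (alt S)"
  using alt_closed alt_D(1) by (intro perm_groupI)

lemma pinv_comp: "bij p \<Longrightarrow> bij q \<Longrightarrow> pinv (p \<circ> q) = pinv q \<circ> pinv p"
  by (rule o_inv_distrib)

lemma pinv_cancel:
  assumes "bij p"
  shows "p \<circ> pinv p = id" "pinv p \<circ> p = id" "p (pinv p x) = x" "pinv p (p x) = x"
    "p \<circ> (pinv p \<circ> f) = f" "pinv p \<circ> (p \<circ> f) = f" "pinv (pinv p) = p" "bij (pinv p)"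
  using assms
  by (auto simp: fun_eq_iff bij_is_inj bij_is_surj surj_f_inv_f inv_inv_eq bij_imp_bij_inv)

lemma perm_group_prod:
  assumes A: "perm_group S A" and B: "perm_group S B"
    and norm: "\<And>a b. a \<in> A \<Longrightarrow> b \<in> B \<Longrightarrow> b \<circ> a \<circ> pinv b \<in> A"
  shows "perm_group S {a \<circ> b |a b. a \<in> A \<and> b \<in> B}"
proof (rule perm_groupI)
  note A' = perm_groupD[OF A] and B' = perm_groupD[OF B]
  show "id \<in> {a \<circ> b |a b. a \<in> A \<and> b \<in> B}"
    using A'(2) B'(2) by (intro CollectI exI[of _ id] conjI) auto
  fix p assume "p \<in> {a \<circ> b |a b. a \<in> A \<and> b \<in> B}"
  then obtain a b where p: "p = a \<circ> b" "a \<in> A" "b \<in> B" by blast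
  show "p permutes S" using p permutes_compose[OF B'(1) A'(1)] by auto
  have "pinv p = (pinv b \<circ> pinv a \<circ> pinv (pinv b)) \<circ> pinv b"
    using p A'(5) B'(5) by (simp add: pinv_comp pinv_cancel comp_assoc)
  moreover have "pinv b \<circ> pinv a \<circ> pinv (pinv b) \<in> A" using p by (intro norm A'(4) B'(4))
  ultimately show "pinv p \<in> {a \<circ> b |a b. a \<in> A \<and> b \<in> B}"
    using B'(4)[OF p(3)] by auto
  fix q assume "q \<in> {a \<circ> b |a b. a \<in> A \<and> b \<in> B}"
  then obtain c d where q: "q = c \<circ> d" "c \<in> A" "d \<in> B" by blast
  have "p \<circ> q = (a \<circ> (b \<circ> c \<circ> pinv b)) \<circ> (b \<circ> d)"
    using p q B'(5) by (simp add: comp_assoc pinv_cancel)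
  moreover have "a \<circ> (b \<circ> c \<circ> pinv b) \<in> A" using p q by (intro norm A'(3))
  ultimately show "p \<circ> q \<in> {a \<circ> b |a b. a \<in> A \<and> b \<in> B}"
    using B'(3)[OF p(3) q(3)] by auto
qed

lemma restrict_id_conj:
  assumes "bij x"
  shows "restrict_id (x \<circ> p \<circ> pinv x) (x ` A) = x \<circ> restrict_id p A \<circ> pinv x"
proof
  fix a
  have "a \<in> x ` A \<longleftrightarrow> pinv x a \<in> A"
    using assms by (metis bij_inv_eq_iff image_iff)
  then show "restrict_id (x \<circ> p \<circ> pinv x) (x ` A) a = (x \<circ> restrict_id p A \<circ> pinv x) a"
    using assms by (auto simp: restrict_id_def pinv_cancel)
qed

lemma restrict_id_comp:
  assumes "q ` A \<subseteq> A"
  shows "restrict_id (p \<circ> q) A = restrict_id p A \<circ> restrict_id q A"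
  using assms by (auto simp: fun_eq_iff restrict_id_def)

lemma restrict_id_pinv:
  assumes "bij q" "q ` A = A"
  shows "restrict_id (pinv q) A = pinv (restrict_id q A)"
proof -
  have "pinv q ` A = A" using assms by (metis bij_is_inj image_inv_f_f)
  then have "restrict_id q A \<circ> restrict_id (pinv q) A = restrict_id id A"
    "restrict_id (pinv q) A \<circ> restrict_id q A = restrict_id id A"
    using assms by (auto simp: restrict_id_comp[symmetric] pinv_cancel)
  then show ?thesis
    by (intro inv_unique_comp[symmetric]) (auto simp: restrict_id_def fun_eq_iff)
qed

lemma evenperm_conj:
  assumes "permutation p" "permutation x"
  shows "evenperm (x \<circ> p \<circ> pinv x) = evenperm p"
  using assms
  by (auto simp: evenperm_comp evenperm_inv permutation_compose permutation_inverse)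

lemma conj_alt:
  assumes "p \<in> alt A" "finite S" "A \<subseteq> S" "x permutes S"
  shows "x \<circ> p \<circ> pinv x \<in> alt (x ` A)"
proof -
  have fin: "finite A" using assms finite_subset by blast
  note p = alt_D[OF assms(1) fin]
  have b: "bij x" using assms permutes_bij by auto
  have "x \<circ> p \<circ> pinv x permutes x ` A"
  proof (rule bij_imp_permutes)
    have "(x \<circ> p \<circ> pinv x) ` x ` A = x ` A"
      using b by (simp only: image_comp[symmetric] image_inv_f_f bij_is_inj permutes_image[OF p(1)])
    moreover have "inj (x \<circ> p \<circ> pinv x)"
      using b p(4) by (intro bij_is_inj bij_comp) (auto simp: pinv_cancel)
    ultimately show "bij_betw (x \<circ> p \<circ> pinv x) (x ` A) (x ` A)"
      by (auto simp: bij_betw_def intro: inj_on_subset)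
    fix a assume "a \<notin> x ` A"
    then have "pinv x a \<notin> A" using b by (metis imageI pinv_cancel(3))
    then show "(x \<circ> p \<circ> pinv x) a = a"
      using p(1) b by (simp add: permutes_not_in pinv_cancel)
  qed
  moreover have "evenperm (x \<circ> p \<circ> pinv x)"
    using p evenperm_conj permutes_imp_permutation[OF assms(2,4)] by blast
  ultimately show ?thesis by (auto simp: alt_def)
qed

text \<open>
  \<open>E\<close> and \<open>C\<close> are the translation group and its complement in the vertex stabilizer; \<open>\<Delta>\<close> is a set
  preserved by both of them that separates the vertex stabilizer from \<open>M\<close>.
\<close>

locale block_data =
  fixes \<Omega> :: "'a set" and blk :: "'a \<Rightarrow> 'i" and E C :: "('a \<Rightarrow> 'a) set"
    and t :: "'a \<Rightarrow> 'a" and \<Delta> :: "'a set"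
  assumes fin: "finite \<Omega>"
    and card_block: "\<And>i. i \<in> blk ` \<Omega> \<Longrightarrow> 5 \<le> card {x \<in> \<Omega>. blk x = i}"
    and two_blocks: "2 \<le> card (blk ` \<Omega>)"
    and E_group: "perm_group \<Omega> E" and C_group: "perm_group \<Omega> C"
    and C_norm: "\<And>c e. c \<in> C \<Longrightarrow> e \<in> E \<Longrightarrow> c \<circ> e \<circ> pinv c \<in> E"
    and E_blk: "\<And>e x. e \<in> E \<Longrightarrow> x \<in> \<Omega> \<Longrightarrow> blk (e x) = blk x"
    and E_even: "\<And>e i. e \<in> E \<Longrightarrow> i \<in> blk ` \<Omega> \<Longrightarrow> evenperm (restrict_id e {x \<in> \<Omega>. blk x = i})"
    and C_blk: "\<And>c x y. c \<in> C \<Longrightarrow> x \<in> \<Omega> \<Longrightarrow> y \<in> \<Omega> \<Longrightarrow> blk (c x) = blk (c y) \<longleftrightarrow> blk x = blk y"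
    and C_trans: "\<And>x y. x \<in> \<Omega> \<Longrightarrow> y \<in> \<Omega> \<Longrightarrow> \<exists>c\<in>C. blk (c x) = blk y"
    and t_perm: "t permutes \<Omega>" and t_inv: "t \<circ> t = id"
    and t_blk: "\<And>x. x \<in> \<Omega> \<Longrightarrow> blk (t x) = blk x"
    and t_C: "\<And>c. c \<in> C \<Longrightarrow> t \<circ> c = c \<circ> t"
    and C_conj_trans: "\<And>e e'. \<lbrakk>e \<in> E; e \<noteq> id; e' \<in> E; e' \<noteq> id\<rbrakk> \<Longrightarrow> \<exists>c\<in>C. c \<circ> e \<circ> pinv c = e'"
    and \<Delta>_inv: "\<And>p x. p \<in> E \<union> C \<Longrightarrow> x \<in> \<Omega> \<Longrightarrow> p x \<in> \<Delta> \<longleftrightarrow> x \<in> \<Delta>"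
    and \<Delta>_ex: "\<And>i. i \<in> blk ` \<Omega> \<Longrightarrow> \<exists>x\<in>\<Omega>. \<exists>y\<in>\<Omega>. blk x = i \<and> blk y = i \<and> x \<in> \<Delta> \<and> y \<notin> \<Delta>"
    and E_sep: "\<And>i j. i \<in> blk ` \<Omega> \<Longrightarrow> j \<in> blk ` \<Omega> \<Longrightarrow> i \<noteq> j \<Longrightarrow>
       \<exists>e\<in>E. restrict_id e {x \<in> \<Omega>. blk x = j} = id \<and> restrict_id e {x \<in> \<Omega>. blk x = i} \<noteq> id"
    and block_gen: "\<And>i Y. \<lbrakk>i \<in> blk ` \<Omega>; perm_group {x \<in> \<Omega>. blk x = i} Y;
       \<And>e. e \<in> E \<Longrightarrow> restrict_id e {x \<in> \<Omega>. blk x = i} \<in> Y;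
       \<And>e. e \<in> E \<Longrightarrow> restrict_id (t \<circ> e \<circ> t) {x \<in> \<Omega>. blk x = i} \<in> Y\<rbrakk>
       \<Longrightarrow> alt {x \<in> \<Omega>. blk x = i} \<subseteq> Y"
begin

section \<open>Permutations respecting the blocks and the product of the alternating groups\<close>

definition I where "I = blk ` \<Omega>"
definition B where "B i = {x \<in> \<Omega>. blk x = i}"

text \<open>The ambient group of all permutations that permute the blocks. It normalizes
  \<open>M\<close> and contains \<open>L\<close>, \<open>t\<close> and hence
  \<open>G\<close>.\<close>

definition BP where
  "BP = {x. x permutes \<Omega> \<and> (\<forall>a\<in>\<Omega>. \<forall>b\<in>\<Omega>. blk (x a) = blk (x b) \<longleftrightarrow> blk a = blk b)}"

text \<open>The direct product of the alternating groups of the blocks, realized inside the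
  symmetric group of \<open>\<Omega>\<close>; the factors are recovered by
  \<open>restrict_id\<close>.\<close>

definition M where
  "M = {p. p permutes \<Omega> \<and> (\<forall>a\<in>\<Omega>. blk (p a) = blk a) \<and> (\<forall>i\<in>I. evenperm (restrict_id p (B i)))}"

definition L where "L = {e \<circ> c |e c. e \<in> E \<and> c \<in> C}"
definition H where "H = {m \<circ> l |m l. m \<in> M \<and> l \<in> L}"
text \<open>Two cosets of \<open>H\<close> suffice because \<open>t\<close> normalizes
  \<open>H\<close> and has square \<open>id\<close>; they coincide if \<open>t\<close> lies in
  \<open>H\<close>.\<close>

definition G where "G = {x \<circ> s |x s. x \<in> H \<and> s \<in> {id, t}}"

lemmas card_B = card_block[folded I_def B_def] and card_I = two_blocks[folded I_def]
  and E_even_B = E_even[folded I_def B_def] and \<Delta>_ex_I = \<Delta>_ex[folded I_def]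
  and E_sep_B = E_sep[folded I_def B_def] and B_gen = block_gen[folded I_def B_def]

lemma finB: "finite (B i)" and B_sub: "B i \<subseteq> \<Omega>" and finI: "finite I"
  using fin by (auto simp: B_def I_def)

lemma perm_in: "p permutes \<Omega> \<Longrightarrow> p x \<in> \<Omega> \<longleftrightarrow> x \<in> \<Omega>"
  by (rule permutes_in_image)

lemma BP_group: "perm_group \<Omega> BP"
proof (rule perm_groupI)
  fix p assume p: "p \<in> BP"
  then show pp: "p permutes \<Omega>" by (auto simp: BP_def)
  have "blk (pinv p a) = blk (pinv p b) \<longleftrightarrow> blk a = blk b" if "a \<in> \<Omega>" "b \<in> \<Omega>" for a b
  proof -
    have "pinv p a \<in> \<Omega>" "pinv p b \<in> \<Omega>" using that perm_in[OF permutes_inv[OF pp]] by auto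
    then have "blk (p (pinv p a)) = blk (p (pinv p b)) \<longleftrightarrow> blk (pinv p a) = blk (pinv p b)"
      using p by (auto simp: BP_def)
    then show ?thesis using permutes_inverses[OF pp] by auto
  qed
  then show "pinv p \<in> BP" using permutes_inv[OF pp] by (auto simp: BP_def)
  fix q assume q: "q \<in> BP"
  then show "p \<circ> q \<in> BP" using p perm_in[of q] by (auto simp: BP_def permutes_compose)
qed (auto simp: BP_def)

lemma BP_image:
  assumes x: "x \<in> BP" and "a \<in> \<Omega>"
  shows "x ` B (blk a) = B (blk (x a))"
proof
  have xp: "x permutes \<Omega>" using x by (auto simp: BP_def)
  show "x ` B (blk a) \<subseteq> B (blk (x a))" using assms perm_in[OF xp] by (auto simp: BP_def B_def)
  show "B (blk (x a)) \<subseteq> x ` B (blk a)"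
  proof
    fix b assume b: "b \<in> B (blk (x a))"
    then have 1: "pinv x b \<in> \<Omega>" using perm_in[OF permutes_inv[OF xp]] by (auto simp: B_def)
    have 2: "x (pinv x b) = b" using permutes_inverses[OF xp] by auto
    have "blk (x (pinv x b)) = blk (x a) \<longleftrightarrow> blk (pinv x b) = blk a"
      using x 1 assms(2) unfolding BP_def by blast
    then show "b \<in> x ` B (blk a)"
      using 1 2 b by (intro image_eqI[of _ _ "pinv x b"]) (auto simp: B_def)
  qed
qed

lemma BP_img:
  assumes "x \<in> BP" "i \<in> I"
  obtains j where "j \<in> I" "x ` B i = B j"
proof -
  obtain a where a: "a \<in> \<Omega>" "i = blk a" using assms by (auto simp: I_def)
  then have "x a \<in> \<Omega>" using perm_in assms by (auto simp: BP_def)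
  then show ?thesis using that[of "blk (x a)"] BP_image[OF assms(1) a(1)] a by (auto simp: I_def)
qed

lemma BP_img':
  assumes "x \<in> BP" "i \<in> I"
  obtains j where "j \<in> I" "x ` B j = B i"
proof -
  have "pinv x \<in> BP" using BP_group assms perm_groupD by blast
  then obtain j where j: "j \<in> I" "pinv x ` B i = B j" using BP_img assms by metis
  have "bij x" using assms BP_group perm_groupD by blast
  then have "x ` B j = B i" unfolding j(2)[symmetric]
    by (simp add: image_comp pinv_cancel)
  then show ?thesis using that j by blast
qed

lemma M_D:
  assumes "m \<in> M"
  shows "m permutes \<Omega>" "bij m" "a \<in> \<Omega> \<Longrightarrow> blk (m a) = blk a" "m ` B i = B i" "m \<in> BP"
proof -
  show p: "m permutes \<Omega>" and b: "a \<in> \<Omega> \<Longrightarrow> blk (m a) = blk a" using assms by (auto simp: M_def)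
  show "bij m" using p permutes_bij by auto
  show BP: "m \<in> BP" using assms by (auto simp: M_def BP_def)
  show "m ` B i = B i"
  proof (cases "B i = {}")
    case False
    then obtain a where "a \<in> \<Omega>" "blk a = i" by (auto simp: B_def)
    then show ?thesis using BP_image[OF BP, of a] assms by (auto simp: M_def)
  qed auto
qed

lemma restrict_perm:
  assumes "m permutes \<Omega>" "m ` B i = B i"
  shows "restrict_id m (B i) permutes B i"
  using assms permutes_inj_on by (intro permutes_restrict_id) (auto simp: bij_betw_def)

lemma M_restrict:
  assumes "m \<in> M" "i \<in> I"
  shows "restrict_id m (B i) \<in> alt (B i)"
  using assms M_D[OF assms(1)] restrict_perm by (auto simp: alt_def M_def)

lemma M_I:
  assumes "m permutes \<Omega>" "\<And>a. a \<in> \<Omega> \<Longrightarrow> blk (m a) = blk a"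
    "\<And>i. i \<in> I \<Longrightarrow> restrict_id m (B i) \<in> alt (B i)"
  shows "m \<in> M"
  using assms by (auto simp: M_def alt_def)

lemma M_group: "perm_group \<Omega> M"
proof (rule perm_groupI)
  have "restrict_id id A = id" for A :: "'a set" by (auto simp: restrict_id_def fun_eq_iff)
  then show "id \<in> M" using alt_closed(1)[OF finB] permutes_id by (intro M_I) (simp_all only: id_apply)
  fix p assume p: "p \<in> M"
  then show pp: "p permutes \<Omega>" by (rule M_D)
  show "pinv p \<in> M"
  proof (rule M_I)
    show "pinv p permutes \<Omega>" using pp permutes_inv by auto
    fix a assume "a \<in> \<Omega>"
    then have "pinv p a \<in> \<Omega>" using perm_in[OF permutes_inv[OF pp]] by auto
    then have "blk (p (pinv p a)) = blk (pinv p a)" using p by (auto simp: M_def)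
    then show "blk (pinv p a) = blk a" using permutes_inverses[OF pp] by auto
  next
    fix i assume "i \<in> I"
    then show "restrict_id (pinv p) (B i) \<in> alt (B i)"
      using restrict_id_pinv M_D[OF p] alt_closed(3)[OF finB M_restrict[OF p]] by metis
  qed
  fix q assume q: "q \<in> M"
  show "p \<circ> q \<in> M"
  proof (rule M_I)
    show "p \<circ> q permutes \<Omega>" using permutes_compose M_D(1) p q by blast
    show "blk ((p \<circ> q) a) = blk a" if "a \<in> \<Omega>" for a
      using that M_D(3) p q perm_in[OF M_D(1)[OF q]] by auto
    fix i assume "i \<in> I"
    then show "restrict_id (p \<circ> q) (B i) \<in> alt (B i)"
      using restrict_id_comp[of q] M_D(4)[OF q] alt_closed(2)[OF finB] M_restrict p q
      by (metis order_refl)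
  qed
qed

lemma M_conj:
  assumes x: "x \<in> BP" and m: "m \<in> M"
  shows "x \<circ> m \<circ> pinv x \<in> M"
proof (rule M_I)
  have xp: "x permutes \<Omega>" "bij x" using x permutes_bij by (auto simp: BP_def)
  show "x \<circ> m \<circ> pinv x permutes \<Omega>"
    using xp M_D(1)[OF m] by (intro permutes_compose permutes_inv)
  show "blk ((x \<circ> m \<circ> pinv x) a) = blk a" if "a \<in> \<Omega>" for a
  proof -
    have a: "pinv x a \<in> \<Omega>" using that perm_in[OF permutes_inv[OF xp(1)]] by auto
    then have "blk (m (pinv x a)) = blk (pinv x a)" "m (pinv x a) \<in> \<Omega>"
      using M_D(3)[OF m] perm_in[OF M_D(1)[OF m]] by auto
    then have "blk (x (m (pinv x a))) = blk (x (pinv x a))" using x a by (auto simp: BP_def)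
    then show ?thesis using xp by (simp add: pinv_cancel)
  qed
  fix i assume "i \<in> I"
  then obtain j where j: "j \<in> I" "x ` B j = B i" using BP_img' x by metis
  then show "restrict_id (x \<circ> m \<circ> pinv x) (B i) \<in> alt (B i)"
    using restrict_id_conj[OF xp(2), of m "B j"] conj_alt[OF M_restrict[OF m] fin B_sub xp(1)] by metis
qed

lemma alt_M:
  assumes "i \<in> I" shows "alt (B i) \<subseteq> M"
proof
  fix p assume p: "p \<in> alt (B i)"
  then have pp: "p permutes B i" by (auto simp: alt_def)
  show "p \<in> M"
  proof (rule M_I)
    show "p permutes \<Omega>" using pp B_sub permutes_subset by blast
    show "blk (p a) = blk a" for a
      using permutes_in_image[OF pp, of a] permutes_not_in[OF pp, of a]
      by (cases "a \<in> B i") (auto simp: B_def)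
    fix j assume "j \<in> I"
    show "restrict_id p (B j) \<in> alt (B j)"
    proof (cases "i = j")
      case True
      then have "restrict_id p (B j) = p" using permutes_not_in[OF pp] by (auto simp: restrict_id_def fun_eq_iff)
      then show ?thesis using p True by auto
    next
      case False
      then have "a \<in> B j \<Longrightarrow> p a = a" for a using permutes_not_in[OF pp] by (auto simp: B_def)
      then have "restrict_id p (B j) = id" by (auto simp: restrict_id_def fun_eq_iff)
      then show ?thesis using alt_closed(1)[OF finB] by metis
    qed
  qed
qed

text \<open>An element of \<open>M\<close> is the composition of its restrictions to the blocks,
  assembled here one block at a time.\<close>

lemma M_subset:
  assumes Y: "id \<in> Y" "\<And>p q. p \<in> Y \<Longrightarrow> q \<in> Y \<Longrightarrow> p \<circ> q \<in> Y"
    and alt: "\<And>i. i \<in> I \<Longrightarrow> alt (B i) \<subseteq> Y"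
  shows "M \<subseteq> Y"
proof
  fix m assume m: "m \<in> M"
  have "restrict_id m {x \<in> \<Omega>. blk x \<in> J} \<in> Y" if "finite J" "J \<subseteq> I" for J
    using that
  proof (induction J)
    case empty
    have "restrict_id m {x \<in> \<Omega>. blk x \<in> {}} = id" by (auto simp: restrict_id_def fun_eq_iff)
    then show ?case using Y(1) by metis
  next
    case (insert j J)
    have "restrict_id m {x \<in> \<Omega>. blk x \<in> insert j J}
       = restrict_id m (B j) \<circ> restrict_id m {x \<in> \<Omega>. blk x \<in> J}"
      using insert M_D(3)[OF m] perm_in[OF M_D(1)[OF m]] by (auto simp: restrict_id_def fun_eq_iff B_def)
    moreover have "restrict_id m (B j) \<in> Y" using insert alt M_restrict[OF m] by blast
    moreover have "restrict_id m {x \<in> \<Omega>. blk x \<in> J} \<in> Y" using insert by blast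
    ultimately show ?case using Y(2) by metis
  qed
  from this[OF finI order_refl] have "restrict_id m {x \<in> \<Omega>. blk x \<in> I} \<in> Y" .
  moreover have "restrict_id m {x \<in> \<Omega>. blk x \<in> I} = m"
    using permutes_not_in[OF M_D(1)[OF m]] by (auto simp: restrict_id_def fun_eq_iff I_def)
  ultimately show "m \<in> Y" by metis
qed

lemma M_hom:
  assumes "p \<in> M" "q \<in> M"
  shows "restrict_id (p \<circ> q) (B i) = restrict_id p (B i) \<circ> restrict_id q (B i)"
    and "restrict_id (pinv p) (B i) = pinv (restrict_id p (B i))"
  using restrict_id_comp[of q "B i" p] restrict_id_pinv[of p "B i"] M_D(2,4)[OF assms(1)] M_D(4)[OF assms(2)]
  by simp_all

section \<open>Generation of the product by the translations and their conjugates under the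
  involution\<close>

lemma E_M: "E \<subseteq> M"
  using perm_groupD(1)[OF E_group] E_blk E_even_B by (auto simp: M_def)

lemma t_simps: "pinv t = t" "bij t" "t \<in> BP"
proof -
  show "pinv t = t" using t_inv by (intro inv_unique_comp)
  show "bij t" using t_perm permutes_bij by auto
  show "t \<in> BP" using t_perm t_blk by (auto simp: BP_def)
qed

lemma t_conj_M: "m \<in> M \<Longrightarrow> t \<circ> m \<circ> t \<in> M"
  using M_conj[OF t_simps(3)] t_simps(1) by metis

text \<open>
  \<open>N J i\<close> below is the projection to block \<open>i\<close> of the elements of \<open>Y\<close> that are trivial on the blocks in \<open>J\<close>.
  It is normal in the alternating group of the block, and commutators with the elements from
  \<open>E_sep\<close> show inductively that it stays nontrivial as \<open>J\<close> grows.
\<close>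

lemma gen_M:
  assumes Y: "perm_group \<Omega> Y" and EY: "E \<subseteq> Y" and tEY: "\<And>e. e \<in> E \<Longrightarrow> t \<circ> e \<circ> t \<in> Y"
  shows "M \<subseteq> Y"
proof -
  \<comment> \<open>Inside \<open>M\<close> every element preserves each block, so restricting to a
    block is a homomorphism.\<close>
  define Y0 where "Y0 = Y \<inter> M"
  note Y' = perm_groupD[OF Y] and M' = perm_groupD[OF M_group]
  have Y0: "perm_group \<Omega> Y0" unfolding Y0_def using Y' M' by (intro perm_groupI) auto
  note Y0' = perm_groupD[OF Y0]
  have Y0M: "Y0 \<subseteq> M" by (auto simp: Y0_def)
  define N where "N J i = {restrict_id y (B i) |y. y \<in> Y0 \<and> (\<forall>j\<in>J. restrict_id y (B j) = id)}" for J i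
  have NI: "p \<in> N J i" if "y \<in> Y0" "\<And>j. j \<in> J \<Longrightarrow> restrict_id y (B j) = id" "p = restrict_id y (B i)" for p y J i
    using that by (auto simp: N_def)
  have NE: "\<exists>y\<in>Y0. (\<forall>j\<in>J. restrict_id y (B j) = id) \<and> p = restrict_id y (B i)" if "p \<in> N J i" for p J i
    using that by (auto simp: N_def)
  have N_alt: "N J i \<subseteq> alt (B i)" if "i \<in> I" for J i
    using that Y0M M_restrict by (auto simp: N_def)
  have rid: "restrict_id id (B i) = id" for i by (auto simp: restrict_id_def fun_eq_iff)
  have N_grp: "perm_group (B i) (N J i)" if i: "i \<in> I" for i J
  proof (rule perm_groupI)
    show "p permutes B i" if "p \<in> N J i" for p using that N_alt[OF i] by (auto simp: alt_def)
    show "id \<in> N J i" by (rule NI[of id]) (simp_all only: rid Y0'(2))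
    show "p \<circ> q \<in> N J i" if pq: "p \<in> N J i" "q \<in> N J i" for p q
    proof -
      obtain y z where "y \<in> Y0" "\<forall>j\<in>J. restrict_id y (B j) = id" "p = restrict_id y (B i)"
        "z \<in> Y0" "\<forall>j\<in>J. restrict_id z (B j) = id" "q = restrict_id z (B i)"
        using NE[OF pq(1)] NE[OF pq(2)] by blast
      moreover from this have "y \<in> M" "z \<in> M" using Y0M by auto
      ultimately show ?thesis
        using M_hom(1)[of y z] by (intro NI[of "y \<circ> z"] Y0'(3)) (simp_all only: o_id)
    qed
    show "pinv p \<in> N J i" if p: "p \<in> N J i" for p
    proof -
      obtain y where "y \<in> Y0" "\<forall>j\<in>J. restrict_id y (B j) = id" "p = restrict_id y (B i)"
        using NE[OF p] by blast
      moreover from this have "y \<in> M" using Y0M by auto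
      ultimately show ?thesis
        using M_hom(2)[of y y] by (intro NI[of "pinv y"] Y0'(4)) (simp_all only: inv_id)
    qed
  qed
  \<comment> \<open>With no block required to be trivial, the assumption \<open>block_gen\<close>
    applies, since \<open>Y0\<close> contains \<open>E\<close> and its conjugates under
    \<open>t\<close>.\<close>
  have N0: "N {} i = alt (B i)" if i: "i \<in> I" for i
  proof
    show "alt (B i) \<subseteq> N {} i"
    proof (rule B_gen[OF i N_grp[OF i]])
      fix e assume e: "e \<in> E"
      have "e \<in> Y0" "t \<circ> e \<circ> t \<in> Y0" using e EY E_M tEY t_conj_M by (auto simp: Y0_def)
      then show "restrict_id e (B i) \<in> N {} i" "restrict_id (t \<circ> e \<circ> t) (B i) \<in> N {} i"
        using NI by blast+
    qed
  qed (rule N_alt[OF i])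
  have N_conj: "s \<circ> p \<circ> pinv s \<in> N J i" if i: "i \<in> I" and p: "p \<in> N J i" and s: "s \<in> alt (B i)" for i J p s
  proof -
    \<comment> \<open>The case of empty \<open>J\<close> lifts \<open>s\<close> to an element
      \<open>z\<close> of \<open>Y0\<close>, and conjugation by \<open>z\<close> keeps the blocks in
      \<open>J\<close> trivial.\<close>
    obtain z where z: "z \<in> Y0" "s = restrict_id z (B i)" using s N0[OF i] NE by blast
    obtain y where y: "y \<in> Y0" "\<forall>j\<in>J. restrict_id y (B j) = id" "p = restrict_id y (B i)"
      using NE[OF p] by blast
    have ym: "y \<in> M" "z \<in> M" using y z Y0M by auto
    then have m: "y \<in> M" "z \<in> M" "z \<circ> y \<in> M" "pinv z \<in> M" using M'(3,4) by blast+
    have eq: "restrict_id (z \<circ> y \<circ> pinv z) (B j)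
      = restrict_id z (B j) \<circ> restrict_id y (B j) \<circ> pinv (restrict_id z (B j))" for j
      using M_hom m by metis
    have bz: "bij (restrict_id z (B j))" for j
      using restrict_perm[OF M_D(1,4)[OF m(2)]] permutes_bij by blast
    show ?thesis
    proof (rule NI[of "z \<circ> y \<circ> pinv z"])
      show "z \<circ> y \<circ> pinv z \<in> Y0" using y(1) z(1) by (intro Y0'(3,4))
      show "restrict_id (z \<circ> y \<circ> pinv z) (B j) = id" if "j \<in> J" for j
        using y(2) that eq[of j] pinv_cancel(1)[OF bz[of j]] by (simp only: o_id)
      show "s \<circ> p \<circ> pinv s = restrict_id (z \<circ> y \<circ> pinv z) (B i)"
        using eq[of i] y z by (simp only:)
    qed
  qed
  have N_all: "N J i = alt (B i)" if "finite J" "J \<subseteq> I" "i \<in> I - J" for J i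
    using that
  proof (induction J)
    case (insert j J)
    then have i: "i \<in> I" and j: "j \<in> I" and ij: "i \<noteq> j" and IH: "N J i = alt (B i)" by auto
    obtain e where e: "e \<in> E" "restrict_id e (B j) = id" "restrict_id e (B i) \<noteq> id"
      using E_sep_B[OF i j ij] by blast
    have eY: "e \<in> Y0" "e \<in> M" using e EY E_M by (auto simp: Y0_def)
    let ?r = "restrict_id e (B i)"
    have br: "bij ?r" using restrict_perm[OF M_D(1,4)[OF eY(2)]] permutes_bij by blast
    obtain x where x: "?r x \<noteq> x" using e(3) by (auto simp: fun_eq_iff)
    then have "x \<in> B i" by (auto simp: restrict_id_def split: if_splits)
    then obtain s where s: "s \<in> alt (B i)" "?r \<circ> s \<circ> pinv ?r \<noteq> s"
      using alt_noncommuting[OF finB card_B[OF i] br _ x] by blast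
    obtain y where y: "y \<in> Y0" "\<forall>j\<in>J. restrict_id y (B j) = id" "s = restrict_id y (B i)"
      using IH s NE by blast
    \<comment> \<open>On block \<open>j\<close> the factor \<open>e\<close> is trivial and on the
      blocks in \<open>J\<close> the factor \<open>y\<close> is, so the commutator vanishes on all
      of them. On block \<open>i\<close> it survives by the choice of \<open>s\<close>.\<close>
    define w where "w = e \<circ> y \<circ> pinv e \<circ> pinv y"
    have m: "y \<in> M" "e \<circ> y \<in> M" "pinv e \<in> M" "pinv y \<in> M" "e \<circ> y \<circ> pinv e \<in> M"
      using y(1) Y0M eY(2) by (auto intro!: M'(3,4) simp del: comp_apply)
    have eq: "restrict_id w (B k) = restrict_id e (B k) \<circ> restrict_id y (B k) \<circ>
       pinv (restrict_id e (B k)) \<circ> pinv (restrict_id y (B k))" for k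
      unfolding w_def using M_hom m eY(2) by metis
    have bz: "bij (restrict_id y (B k))" "bij (restrict_id e (B k))" for k
      using restrict_perm[OF M_D(1,4)[OF m(1)]] restrict_perm[OF M_D(1,4)[OF eY(2)]] permutes_bij by blast+
    have wN: "restrict_id w (B i) \<in> N (insert j J) i"
    proof (rule NI[of w])
      show "w \<in> Y0" unfolding w_def using y(1) eY(1) by (intro Y0'(3,4))
      fix k assume k: "k \<in> insert j J"
      show "restrict_id w (B k) = id"
      proof (cases "k = j")
        case True
        then show ?thesis
          using eq[of k] e(2) pinv_cancel(1)[OF bz(1)[of k]] by (simp only: o_id id_o inv_id)
      next
        case False
        then have "restrict_id y (B k) = id" using k y by blast
        then show ?thesis
          using eq[of k] pinv_cancel(1)[OF bz(2)[of k]] by (simp only: o_id id_o inv_id)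
      qed
    qed simp
    have "restrict_id w (B i) \<noteq> id"
    proof
      assume "restrict_id w (B i) = id"
      then have "(?r \<circ> s \<circ> pinv ?r \<circ> pinv s) \<circ> s = s" using eq[of i] y(3) by (simp only: id_o)
      then have "?r \<circ> s \<circ> pinv ?r = s"
        using pinv_cancel(2)[OF bz(1)[of i]] y(3) by (simp add: comp_assoc)
      then show False using s by blast
    qed
    moreover have "normal_in_alt (B i) (N (insert j J) i)"
      by (intro normal_in_alt.intro finB card_B[OF i] N_alt[OF i]
          perm_groupD(2-4)[OF N_grp[OF i]] N_conj[OF i])
    ultimately show ?case using normal_in_alt.all_of_nontrivial wN by blast
  qed (use N0 in auto)
  show ?thesis
  proof (rule M_subset[OF Y'(2,3)])
    fix i assume i: "i \<in> I"
    show "alt (B i) \<subseteq> Y"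
    proof
      fix p assume p: "p \<in> alt (B i)"
      \<comment> \<open>Trivial on every block except \<open>i\<close>, the lifted element
        \<open>y\<close> is \<open>p\<close> itself.\<close>
      then have "p \<in> N (I - {i}) i" using N_all[of "I - {i}" i] i finI by auto
      then obtain y where y: "y \<in> Y0" "\<forall>j\<in>I - {i}. restrict_id y (B j) = id" "p = restrict_id y (B i)"
        using NE by blast
      have "y permutes \<Omega>" using y(1) by (rule Y0'(1))
      have "y x = p x" for x
      proof (cases "x \<in> B i")
        case False
        have "y x = x"
        proof (cases "x \<in> \<Omega>")
          case True
          then have "restrict_id y (B (blk x)) x = x" "x \<in> B (blk x)"
            using False y(2) by (auto simp: I_def B_def)
          then show ?thesis by (simp add: restrict_id_def)
        qed (use permutes_not_in[OF \<open>y permutes \<Omega>\<close>] in auto)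
        then show ?thesis using False y(3) by (simp add: restrict_id_def)
      qed (use y(3) in \<open>simp add: restrict_id_def\<close>)
      then have "y = p" by (rule ext)
      then show "p \<in> Y" using y Y0_def by blast
    qed
  qed
qed

section \<open>The vertex stabilizer and the groups generated from it\<close>

lemma L_group: "perm_group \<Omega> L"
  unfolding L_def using C_norm by (intro perm_group_prod[OF E_group C_group])

lemma E_L: "E \<subseteq> L" and C_L: "C \<subseteq> L"
  using perm_groupD(2)[OF C_group] perm_groupD(2)[OF E_group]
  unfolding L_def by (metis (mono_tags, lifting) comp_id id_comp mem_Collect_eq subsetI)+

lemma C_BP: "C \<subseteq> BP"
  using C_blk perm_groupD(1)[OF C_group] by (auto simp: BP_def)

lemma L_BP: "L \<subseteq> BP"
  using perm_groupD(3)[OF BP_group M_D(5)[OF subsetD[OF E_M]] subsetD[OF C_BP]] by (auto simp: L_def)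

lemma L_\<Delta>: "l \<in> L \<Longrightarrow> x \<in> \<Omega> \<Longrightarrow> l x \<in> \<Delta> \<longleftrightarrow> x \<in> \<Delta>"
  using \<Delta>_inv perm_in[OF perm_groupD(1)[OF C_group]] by (auto simp: L_def)

lemma H_group: "perm_group \<Omega> H"
  unfolding H_def using M_conj L_BP by (intro perm_group_prod[OF M_group L_group]) auto

lemma M_H: "M \<subseteq> H" and L_H: "L \<subseteq> H"
  using perm_groupD(2)[OF M_group] perm_groupD(2)[OF L_group]
  unfolding H_def by (metis (mono_tags, lifting) comp_id id_comp mem_Collect_eq subsetI)+

lemma H_BP: "H \<subseteq> BP"
  using perm_groupD(3)[OF BP_group M_D(5) subsetD[OF L_BP]] by (auto simp: H_def)

lemma t_conj_C: "c \<in> C \<Longrightarrow> t \<circ> c \<circ> t = c"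
  by (simp only: t_C comp_assoc t_inv comp_id)

lemma t_conj_comp: "t \<circ> (p \<circ> q) \<circ> t = (t \<circ> p \<circ> t) \<circ> (t \<circ> q \<circ> t)"
proof -
  have "(t \<circ> p \<circ> t) \<circ> (t \<circ> q \<circ> t) = t \<circ> p \<circ> (t \<circ> t) \<circ> q \<circ> t" by (simp only: comp_assoc)
  then show ?thesis by (simp only: t_inv comp_id comp_assoc)
qed

lemma t_conj_L: "l \<in> L \<Longrightarrow> t \<circ> l \<circ> t \<in> H"
proof -
  assume "l \<in> L"
  then obtain e c where l: "l = e \<circ> c" "e \<in> E" "c \<in> C" by (auto simp: L_def)
  then have "t \<circ> l \<circ> t = (t \<circ> e \<circ> t) \<circ> c" using t_conj_C t_conj_comp by metis
  moreover have "t \<circ> e \<circ> t \<in> M" using l E_M t_conj_M by blast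
  ultimately show ?thesis using l C_L by (auto simp: H_def)
qed

lemma t_conj_H: "h \<in> H \<Longrightarrow> t \<circ> h \<circ> t \<in> H"
proof -
  assume "h \<in> H"
  then obtain m l where h: "h = m \<circ> l" "m \<in> M" "l \<in> L" by (auto simp: H_def)
  then show ?thesis
    using t_conj_comp t_conj_L t_conj_M M_H perm_groupD(3)[OF H_group] by (metis subsetD)
qed

lemma G_group: "perm_group \<Omega> G"
  unfolding G_def
proof (rule perm_group_prod[OF H_group])
  show "perm_group \<Omega> {id, t}"
    using t_perm t_inv t_simps by (intro perm_groupI) (auto simp: permutes_id)
  fix h s assume "h \<in> H" "s \<in> {id, t}"
  then show "s \<circ> h \<circ> pinv s \<in> H" using t_conj_H t_simps(1) by (auto simp: inv_id)
qed

lemma H_G: "H \<subseteq> G" and t_G: "t \<in> G"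
  using perm_groupD(2)[OF H_group] unfolding G_def
  by (metis (mono_tags, lifting) comp_id id_comp mem_Collect_eq subsetI insertCI)+

lemma L_G: "L \<subseteq> G" and M_G: "M \<subseteq> G"
  using H_G L_H M_H by auto

lemma G_BP: "G \<subseteq> BP"
  using H_BP perm_groupD(3)[OF BP_group subsetD[OF H_BP] t_simps(3)] by (auto simp: G_def)

lemma G_cases:
  assumes "g \<in> G" obtains "g \<in> H" | h where "h \<in> H" "g = h \<circ> t"
  using assms by (auto simp: G_def)

lemma H_conj:
  assumes "g \<in> G" "h \<in> H" shows "g \<circ> h \<circ> pinv g \<in> H"
  using assms(1)
proof (cases rule: G_cases)
  case 1
  then show ?thesis using assms by (intro perm_groupD(3,4)[OF H_group])
next
  case (2 k)
  have "g \<circ> h \<circ> pinv g = k \<circ> (t \<circ> h \<circ> t) \<circ> pinv k"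
    using 2 t_simps perm_groupD(5)[OF H_group] by (simp add: pinv_comp comp_assoc)
  then show ?thesis using 2 t_conj_H[OF assms(2)] perm_groupD(3,4)[OF H_group] by metis
qed

text \<open>\<open>L\<close> and its conjugate by \<open>t\<close> become the stabilizers of two
  adjacent vertices, so this is the generation statement behind \<open>Gstar\<close>.\<close>

lemma H_min:
  assumes "perm_group \<Omega> Y" "L \<subseteq> Y" "\<And>l. l \<in> L \<Longrightarrow> t \<circ> l \<circ> t \<in> Y"
  shows "H \<subseteq> Y"
proof -
  have "M \<subseteq> Y" using E_L assms by (intro gen_M) auto
  then show ?thesis using assms(2) perm_groupD(3)[OF assms(1)] unfolding H_def by blast
qed

text \<open>Generation by \<open>L\<close> and \<open>t\<close> is what connectedness of the coset
  graph amounts to.\<close>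

lemma G_min:
  assumes "perm_group \<Omega> Y" "L \<subseteq> Y" "t \<in> Y"
  shows "G \<subseteq> Y"
proof -
  note Y = perm_groupD(3)[OF assms(1)]
  have "H \<subseteq> Y" using assms by (intro H_min Y) auto
  then show ?thesis using assms(3) Y unfolding G_def by fastforce
qed

text \<open>Distinguishes each factor of \<open>M\<close> from \<open>L\<close>, whose elements
  preserve \<open>\<Delta>\<close>.\<close>

lemma alt_moves_\<Delta>:
  assumes "i \<in> I"
  obtains s a where "s \<in> alt (B i)" "a \<in> B i" "a \<in> \<Delta>" "s a \<notin> \<Delta>"
proof -
  obtain x y where xy: "x \<in> B i" "y \<in> B i" "x \<in> \<Delta>" "y \<notin> \<Delta>"
    using \<Delta>_ex_I[OF assms] by (auto simp: B_def)
  obtain z where z: "z \<in> B i" "z \<notin> {x, y}"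
    using exists_outside[of "{x, y}" "B i"] card_B[OF assms] card_length[of "[x, y]"] by auto
  have "cyc3 x y z \<in> alt (B i)" using xy z by (intro cyc3_in_alt) auto
  moreover have "cyc3 x y z x = y" using xy z by (intro cyc3_simps) auto
  ultimately show ?thesis using that xy by metis
qed

lemma I_ne: "\<exists>i. i \<in> I" and I_two: "i \<in> I \<Longrightarrow> \<exists>j\<in>I. j \<noteq> i"
proof -
  show "\<exists>i. i \<in> I" using card_I by (metis card.empty ex_in_conv not_numeral_le_zero)
  show "\<exists>j\<in>I. j \<noteq> i" if "i \<in> I"
  proof (rule ccontr)
    assume "\<not> (\<exists>j\<in>I. j \<noteq> i)"
    then have "I = {i}" using that by blast
    then show False using card_I by simp
  qed
qed

lemma M_not_L: "\<not> M \<subseteq> L"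
proof
  assume sub: "M \<subseteq> L"
  obtain i where i: "i \<in> I" using I_ne by blast
  then obtain s a where "s \<in> alt (B i)" "a \<in> B i" "a \<in> \<Delta>" "s a \<notin> \<Delta>" using alt_moves_\<Delta> by metis
  then show False using L_\<Delta>[of s a] sub alt_M[OF i] B_sub by blast
qed

text \<open>Otherwise \<open>gen_M\<close>, applied to \<open>L\<close> itself, would put
  \<open>M\<close> inside \<open>L\<close>. Every later statement that \<open>t\<close> moves
  something out of \<open>L\<close> goes back to this one.\<close>

lemma tEt_not_L: "\<not> (\<forall>e\<in>E. t \<circ> e \<circ> t \<in> L)"
  using gen_M[OF L_group E_L] M_not_L by blast

lemma t_not_L: "t \<notin> L"
  using tEt_not_L E_L perm_groupD(3)[OF L_group] by (metis subsetD)

text \<open>Conjugation by \<open>C\<close> is transitive on the nontrivial translations, so one of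
  them already yields all; in effect \<open>C\<close> is maximal in \<open>L\<close>.\<close>

lemma E_all:
  assumes Y: "perm_group \<Omega> Y" "C \<subseteq> Y" and e: "e \<in> E" "e \<noteq> id" "e \<in> Y"
  shows "E \<subseteq> Y"
proof
  fix e' assume "e' \<in> E"
  show "e' \<in> Y"
  proof (cases "e' = id")
    case False
    then obtain c where c: "c \<in> C" "c \<circ> e \<circ> pinv c = e'" using C_conj_trans e \<open>e' \<in> E\<close> by blast
    have "c \<circ> e \<circ> pinv c \<in> Y" using Y(2) e(3) c(1) by (intro perm_groupD(3,4)[OF Y(1)]) auto
    then show ?thesis using c by simp
  qed (use perm_groupD(2)[OF Y(1)] in simp)
qed

text \<open>A common nontrivial element would force all of \<open>E\<close> into \<open>C\<close>,
  hence into the centralizer of \<open>t\<close>, against \<open>tEt_not_L\<close>.\<close>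

lemma E_C_disjoint:
  assumes "e \<in> E" "e \<in> C" shows "e = id"
proof (rule ccontr)
  assume "e \<noteq> id"
  then have "E \<subseteq> C" using E_all[OF C_group _ assms(1) _ assms(2)] by blast
  then show False using tEt_not_L t_conj_C C_L by (metis subsetD)
qed

text \<open>The stabilizer \<open>L \<inter> t L t\<close> of the base arc contains
  \<open>C\<close>, because \<open>t\<close> centralizes \<open>C\<close>. By \<open>E_all\<close>
  anything larger would contain \<open>E\<close>, and then all conjugates of \<open>E\<close> under
  \<open>t\<close> would lie in \<open>L\<close>.\<close>

lemma arc_stabilizer:
  assumes "l \<in> L" "t \<circ> l \<circ> t \<in> L" shows "l \<in> C"
proof -
  define Y where "Y = {l \<in> L. t \<circ> l \<circ> t \<in> L}"
  note L' = perm_groupD[OF L_group]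
  have Y: "perm_group \<Omega> Y"
  proof (rule perm_groupI)
    show "p \<circ> q \<in> Y" if "p \<in> Y" "q \<in> Y" for p q
      using that L'(3) t_conj_comp[of p q] unfolding Y_def by simp
    show "pinv p \<in> Y" if "p \<in> Y" for p
    proof -
      have "pinv (t \<circ> p \<circ> t) = t \<circ> pinv p \<circ> t"
        using that L'(5) t_simps by (auto simp: Y_def pinv_comp bij_comp comp_assoc)
      then show ?thesis using that L'(4) by (metis (mono_tags, lifting) Y_def mem_Collect_eq)
    qed
  qed (use L' t_inv in \<open>auto simp: Y_def\<close>)
  have CY: "C \<subseteq> Y" using C_L t_conj_C by (auto simp: Y_def)
  obtain e c where l: "l = e \<circ> c" "e \<in> E" "c \<in> C" using assms by (auto simp: L_def)
  have "e = l \<circ> pinv c" using l perm_groupD(5)[OF C_group] by (simp add: comp_assoc pinv_cancel)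
  moreover have "l \<in> Y" "c \<in> Y" using assms CY l by (auto simp: Y_def)
  ultimately have "e \<in> Y" using perm_groupD(3,4)[OF Y] by metis
  then have "e = id" using E_all[OF Y CY l(2)] tEt_not_L by (auto simp: Y_def)
  then show ?thesis using l by auto
qed

text \<open>Two commutators descend into one factor. The commutator of \<open>n\<close> with an
  element of an alternating factor lies in \<open>M\<close>, as \<open>M\<close> is normal; an
  element of \<open>M\<close> preserves each block, so its commutator with an element of a factor
  stays in that factor. Simplicity then gives the whole factor, and \<open>C\<close> carries it to
  all the others.\<close>

lemma normal_contains_M:
  assumes N: "perm_group \<Omega> N" "N \<subseteq> H" and conj: "\<And>n x. n \<in> N \<Longrightarrow> x \<in> H \<Longrightarrow> x \<circ> n \<circ> pinv x \<in> N"
    and n: "n \<in> N" "n \<noteq> id"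
  shows "M \<subseteq> N"
proof -
  note N' = perm_groupD[OF N(1)]
  have comm: "\<exists>i\<in>I. \<exists>s\<in>alt (B i). p \<circ> s \<circ> pinv p \<circ> pinv s \<in> N \<and> p \<circ> s \<circ> pinv p \<circ> pinv s \<noteq> id \<and>
      (p \<in> M \<longrightarrow> p \<circ> s \<circ> pinv p \<circ> pinv s \<in> alt (B i))" if p: "p \<in> N" "p \<noteq> id" for p
  proof -
    obtain x where x: "p x \<noteq> x" using p by (auto simp: fun_eq_iff)
    then have "x \<in> \<Omega>" using N'(1)[OF p(1)] permutes_not_in by metis
    then have i: "blk x \<in> I" "x \<in> B (blk x)" by (auto simp: I_def B_def)
    obtain s where s: "s \<in> alt (B (blk x))" "p \<circ> s \<circ> pinv p \<noteq> s"
      using alt_noncommuting[OF finB card_B[OF i(1)] N'(5)[OF p(1)] i(2) x] by blast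
    have sH: "s \<in> H" using s alt_M[OF i(1)] M_H by blast
    have "p \<circ> (s \<circ> pinv p \<circ> pinv s) \<in> N" by (intro N'(3)[OF p(1)] conj[OF N'(4)[OF p(1)] sH])
    moreover have "p \<circ> s \<circ> pinv p \<circ> pinv s \<noteq> id"
    proof
      assume "p \<circ> s \<circ> pinv p \<circ> pinv s = id"
      then have "p \<circ> s \<circ> pinv p \<circ> pinv s \<circ> s = s" by (simp only: id_o)
      then show False using s perm_groupD(5)[OF H_group sH] by (simp add: comp_assoc pinv_cancel)
    qed
    moreover have "p \<circ> s \<circ> pinv p \<circ> pinv s \<in> alt (B (blk x))" if "p \<in> M"
    proof -
      have "p \<circ> s \<circ> pinv p \<in> alt (B (blk x))"
        using conj_alt[OF s(1) fin B_sub M_D(1)[OF that]] M_D(4)[OF that] by metis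
      then show ?thesis by (rule alt_closed(2)[OF finB _ alt_closed(3)[OF finB s(1)]])
    qed
    ultimately show ?thesis using i(1) s(1) unfolding comp_assoc by blast
  qed
  obtain i s where s: "i \<in> I" "s \<in> alt (B i)" "n \<circ> s \<circ> pinv n \<circ> pinv s \<in> N" "n \<circ> s \<circ> pinv n \<circ> pinv s \<noteq> id"
    using comm[OF n] by blast
  have "n \<circ> s \<circ> pinv n \<in> M" "s \<in> M" using M_conj n N H_BP s alt_M by blast+
  then have "n \<circ> s \<circ> pinv n \<circ> pinv s \<in> M"
    by (rule perm_groupD(3)[OF M_group _ perm_groupD(4)[OF M_group]])
  then obtain k r where k: "k \<in> I" "r \<in> N" "r \<noteq> id" "r \<in> alt (B k)"
    using comm[OF s(3,4)] by blast
  have "normal_in_alt (B k) (N \<inter> alt (B k))"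
  proof (intro normal_in_alt.intro finB card_B[OF k(1)])
    fix p assume p: "p \<in> N \<inter> alt (B k)"
    then show "pinv p \<in> N \<inter> alt (B k)" using N'(4) alt_closed(3)[OF finB] by simp
    show "p \<circ> q \<in> N \<inter> alt (B k)" if "q \<in> N \<inter> alt (B k)" for q
      using p that N'(3) alt_closed(2)[OF finB] by simp
    fix s assume s: "s \<in> alt (B k)"
    then have "s \<in> H" using alt_M[OF k(1)] M_H by blast
    moreover have "s \<circ> p \<circ> pinv s \<in> alt (B k)" using p s by (intro alt_closed(2,3)[OF finB]) auto
    ultimately show "s \<circ> p \<circ> pinv s \<in> N \<inter> alt (B k)" using conj p by simp
  qed (use N'(2) alt_closed(1)[OF finB] in auto)
  then have altN: "alt (B k) \<subseteq> N" using normal_in_alt.all_of_nontrivial k by blast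
  show ?thesis
  proof (rule M_subset[OF N'(2,3)])
    fix j assume "j \<in> I"
    then obtain y where y: "y \<in> \<Omega>" "j = blk y" by (auto simp: I_def)
    obtain x where x: "x \<in> \<Omega>" "k = blk x" using k by (auto simp: I_def)
    obtain c where c: "c \<in> C" "blk (c x) = blk y" using C_trans x y by blast
    have im: "c ` B k = B j" using BP_image[of c x] c C_BP x y by auto
    have cp: "c permutes \<Omega>" "bij c" using perm_groupD(1,5)[OF C_group c(1)] .
    have cH: "c \<in> H" using c C_L L_H by blast
    show "alt (B j) \<subseteq> N"
    proof
      fix p assume p: "p \<in> alt (B j)"
      have "pinv c ` B j = B k" using im cp by (metis bij_is_inj image_inv_f_f)
      then have "pinv c \<circ> p \<circ> pinv (pinv c) \<in> N"
        using conj_alt[OF p fin B_sub permutes_inv[OF cp(1)]] altN by auto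
      then have "c \<circ> (pinv c \<circ> p \<circ> pinv (pinv c)) \<circ> pinv c \<in> N" using conj cH by blast
      then show "p \<in> N" using cp by (simp add: comp_assoc pinv_cancel)
    qed
  qed
qed

end

section \<open>The coset graph\<close>

text \<open>Links concrete permutations with the group structures of the definitions. Instances are
  the action on the vertices, its restriction to an orbit of \<open>H\<close>, and its restriction
  to an alternating factor.\<close>

locale perm_hom = group R for R (structure) +
  fixes S :: "'p set" and K :: "('p \<Rightarrow> 'p) set" and f :: "('p \<Rightarrow> 'p) \<Rightarrow> 'a"
  assumes K: "perm_group S K"
    and f_closed: "\<And>p. p \<in> K \<Longrightarrow> f p \<in> carrier R"
    and f_mult: "\<And>p q. p \<in> K \<Longrightarrow> q \<in> K \<Longrightarrow> f (p \<circ> q) = f p \<otimes> f q"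
begin

lemma f_id: "f id = \<one>"
proof -
  have "f id \<otimes> f id = f id" using f_mult[of id id] perm_groupD(2)[OF K] by simp
  then show ?thesis using f_closed[OF perm_groupD(2)[OF K]] by simp
qed

lemma f_pinv: "p \<in> K \<Longrightarrow> f (pinv p) = inv f p"
proof -
  assume p: "p \<in> K"
  have "f (pinv p) \<otimes> f p = f (pinv p \<circ> p)" using f_mult perm_groupD(4)[OF K p] p by simp
  also have "\<dots> = \<one>" using pinv_cancel(2)[OF perm_groupD(5)[OF K p]] f_id by simp
  finally show ?thesis using inv_equality f_closed[OF p] f_closed[OF perm_groupD(4)[OF K p]] by simp
qed

lemma f_conj: "x \<in> K \<Longrightarrow> p \<in> K \<Longrightarrow> f (x \<circ> p \<circ> pinv x) = f x \<otimes> f p \<otimes> inv f x"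
  using f_mult f_pinv perm_groupD(3,4)[OF K] by simp

lemma image_subgroup:
  assumes "perm_group S' P" "P \<subseteq> K" shows "subgroup (f ` P) R"
proof (rule subgroupI)
  show "f ` P \<subseteq> carrier R" using f_closed assms by auto
  show "f ` P \<noteq> {}" using perm_groupD(2)[OF assms(1)] by auto
  fix a assume "a \<in> f ` P"
  then obtain p where p: "p \<in> P" "a = f p" by auto
  then have "inv a = f (pinv p)" using f_pinv assms by auto
  then show "inv a \<in> f ` P" using perm_groupD(4)[OF assms(1)] p by auto
  fix b assume "b \<in> f ` P"
  then obtain q where q: "q \<in> P" "b = f q" by auto
  have "a \<otimes> b = f (p \<circ> q)" using f_mult[of p q] p q assms(2) by (simp add: subsetD)
  then show "a \<otimes> b \<in> f ` P" using perm_groupD(3)[OF assms(1)] p q by auto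
qed

lemma image_group: "group (R\<lparr>carrier := f ` K\<rparr>)"
  using image_subgroup[OF K order_refl] subgroup_imp_group by auto

text \<open>Turns a normal subgroup of the image into a permutation group closed under conjugation,
  the form in which simplicity and \<open>normal_contains_M\<close> are stated.\<close>

lemma preimage_normal:
  assumes N: "N \<lhd> R\<lparr>carrier := f ` K\<rparr>"
  defines "P \<equiv> {p \<in> K. f p \<in> N}"
  shows "perm_group S P" "\<And>n x. n \<in> P \<Longrightarrow> x \<in> K \<Longrightarrow> x \<circ> n \<circ> pinv x \<in> P" "f ` P = N"
proof -
  interpret Q: group "R\<lparr>carrier := f ` K\<rparr>" by (rule image_group)
  have sg: "subgroup N (R\<lparr>carrier := f ` K\<rparr>)" using N by (simp add: Q.normal_inv_iff)
  have fK: "subgroup (f ` K) R" by (rule image_subgroup[OF K order_refl])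
  have invQ: "inv\<^bsub>R\<lparr>carrier := f ` K\<rparr>\<^esub> f p = f (pinv p)" if "p \<in> K" for p
    using m_inv_consistent[OF fK, of "f p"] that f_pinv by simp
  have NK: "N \<subseteq> f ` K" using subgroup.subset[OF sg] by simp
  then show "f ` P = N" by (auto simp: P_def)
  have one: "\<one> \<in> N" using subgroup.one_closed[OF sg] by simp
  have mul: "a \<otimes> b \<in> N" if "a \<in> N" "b \<in> N" for a b
    using subgroup.m_closed[OF sg] that by simp
  have inv: "f (pinv p) \<in> N" if "p \<in> K" "f p \<in> N" for p
    using subgroup.m_inv_closed[OF sg that(2)] invQ[OF that(1)] by simp
  show "perm_group S P"
  proof (rule perm_groupI)
    show "p permutes S" if "p \<in> P" for p using that perm_groupD(1)[OF K] by (simp add: P_def)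
    show "id \<in> P" using perm_groupD(2)[OF K] one f_id by (simp add: P_def)
    show "p \<circ> q \<in> P" if "p \<in> P" "q \<in> P" for p q
      using that perm_groupD(3)[OF K] mul f_mult by (simp add: P_def)
    show "pinv p \<in> P" if "p \<in> P" for p
      using that perm_groupD(4)[OF K] inv by (simp add: P_def)
  qed
  show "x \<circ> n \<circ> pinv x \<in> P" if "n \<in> P" "x \<in> K" for n x
  proof -
    have "f x \<otimes> f n \<otimes> f (pinv x) \<in> N"
      using N that invQ[OF that(2)] unfolding Q.normal_inv_iff P_def by auto
    then have "f (x \<circ> n \<circ> pinv x) \<in> N"
      using that f_mult perm_groupD(3,4)[OF K] by (simp add: P_def)
    then show ?thesis using that perm_groupD(3,4)[OF K] by (simp add: P_def)
  qed
qed

lemma image_normal: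
  assumes P: "perm_group S' P" "P \<subseteq> K" and conj: "\<And>n x. n \<in> P \<Longrightarrow> x \<in> K \<Longrightarrow> x \<circ> n \<circ> pinv x \<in> P"
  shows "f ` P \<lhd> R\<lparr>carrier := f ` K\<rparr>"
proof -
  interpret Q: group "R\<lparr>carrier := f ` K\<rparr>" by (rule image_group)
  have fK: "subgroup (f ` K) R" by (rule image_subgroup[OF K order_refl])
  have "subgroup (f ` P) (R\<lparr>carrier := f ` K\<rparr>)"
    using P by (intro subgroup_incl image_subgroup[OF P] fK) auto
  moreover have "f x \<otimes> f n \<otimes> inv\<^bsub>R\<lparr>carrier := f ` K\<rparr>\<^esub> f x \<in> f ` P" if "x \<in> K" "n \<in> P" for x n
  proof -
    have "inv\<^bsub>R\<lparr>carrier := f ` K\<rparr>\<^esub> f x = inv f x"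
      using m_inv_consistent[OF fK] that by simp
    then have "f x \<otimes> f n \<otimes> inv\<^bsub>R\<lparr>carrier := f ` K\<rparr>\<^esub> f x = f (x \<circ> n \<circ> pinv x)"
      using f_conj[of x n] that P by auto
    then show ?thesis using conj[OF that(2,1)] by simp
  qed
  ultimately show ?thesis by (auto simp: Q.normal_inv_iff)
qed

lemma nonabelian_simple_alt_image:
  assumes fin: "finite A" and card: "5 \<le> card A" and sub: "alt A \<subseteq> K" and inj: "inj_on f K"
  shows "nonabelian_simple (R\<lparr>carrier := f ` alt A\<rparr>)"
proof -
  interpret A: perm_hom R A "alt A" f
    using perm_group_alt[OF fin] f_closed f_mult sub by unfold_locales auto
  interpret Q: group "R\<lparr>carrier := f ` alt A\<rparr>" by (rule A.image_group)
  obtain a where a: "a \<in> A" using card by (metis card.empty ex_in_conv not_numeral_le_zero)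
  obtain b where b: "b \<in> A" "b \<notin> {a}" using exists_outside[of "{a}" A] card by auto
  obtain c where c: "c \<in> A" "c \<notin> {a, b}"
    using exists_outside[of "{a, b}" A] card card_length[of "[a, b]"] by auto
  let ?s = "cyc3 a b c"
  have s: "?s \<in> alt A" "?s a = b" using a b c by (auto intro!: cyc3_in_alt cyc3_simps)
  have sne: "?s \<noteq> id" using s b by auto
  have ne: "f ?s \<noteq> \<one>"
    using sne inj sub s A.f_id perm_groupD(2)[OF K] by (metis inj_onD subsetD)
  have "simple_group (R\<lparr>carrier := f ` alt A\<rparr>)"
  proof
    have "finite (alt A)" using finite_permutations[OF fin] by (rule finite_subset[rotated]) (auto simp: alt_def)
    moreover have "{\<one>, f ?s} \<subseteq> f ` alt A"
      using s A.f_id[symmetric] alt_closed(1)[OF fin] by auto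
    ultimately have "card {\<one>, f ?s} \<le> card (f ` alt A)" by (intro card_mono) auto
    then show "1 < order (R\<lparr>carrier := f ` alt A\<rparr>)" using ne by (simp add: order_def)
    fix N assume N: "N \<lhd> R\<lparr>carrier := f ` alt A\<rparr>"
    define P where "P = {p \<in> alt A. f p \<in> N}"
    note pre = A.preimage_normal[OF N, folded P_def]
    show "N = carrier (R\<lparr>carrier := f ` alt A\<rparr>) \<or> N = {\<one>\<^bsub>R\<lparr>carrier := f ` alt A\<rparr>\<^esub>}"
    proof (cases "P = {id}")
      case True
      then show ?thesis using pre(3) A.f_id by auto
    next
      case False
      then obtain p where p: "p \<in> P" "p \<noteq> id" using perm_groupD(2)[OF pre(1)] by auto
      have sub: "P \<subseteq> alt A" by (auto simp: P_def)
      have "normal_in_alt A P"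
        by (intro normal_in_alt.intro fin card sub perm_groupD(2-4)[OF pre(1)] pre(2))
      then have "P = alt A" using normal_in_alt.all_of_nontrivial p by metis
      then show ?thesis using pre(3) by auto
    qed
  qed
  moreover have "\<not> comm_group (R\<lparr>carrier := f ` alt A\<rparr>)"
  proof
    assume "comm_group (R\<lparr>carrier := f ` alt A\<rparr>)"
    then interpret Q: comm_group "R\<lparr>carrier := f ` alt A\<rparr>" .
    have bs: "bij ?s" using alt_D(4)[OF s(1) fin] .
    have "?s a \<noteq> a" using s b by auto
    then obtain r where r: "r \<in> alt A" "?s \<circ> r \<circ> pinv ?s \<noteq> r"
      using alt_noncommuting[OF fin card bs a] by blast
    have "f ?s \<otimes> f r = f r \<otimes> f ?s" using Q.m_comm[of "f ?s" "f r"] s r by simp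
    then have "f (?s \<circ> r) = f (r \<circ> ?s)" using A.f_mult s r by simp
    then have "?s \<circ> r = r \<circ> ?s"
      using inj_onD[OF inj] sub alt_closed(2)[OF fin] s r by (simp add: subsetD)
    then have "?s \<circ> r \<circ> pinv ?s = r" using bs by (simp add: comp_assoc pinv_cancel)
    then show False using r by simp
  qed
  ultimately show ?thesis by (simp add: nonabelian_simple_def)
qed

lemma conj_image_iso:
  assumes x: "x \<in> K" and P: "perm_group S' P" "P \<subseteq> K"
    and im: "(\<lambda>p. x \<circ> p \<circ> pinv x) ` P = P'"
  shows "R\<lparr>carrier := f ` P\<rparr> \<cong> R\<lparr>carrier := f ` P'\<rparr>"
proof -
  define h where "h y = f x \<otimes> y \<otimes> inv f x" for y
  have fx: "f x \<in> carrier R" "inv f x \<in> carrier R" using x f_closed by auto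
  have fP: "f p \<in> carrier R" if "p \<in> P" for p using that P f_closed by auto
  have hf: "h (f p) = f (x \<circ> p \<circ> pinv x)" if "p \<in> P" for p
    using that f_conj x P by (auto simp: h_def)
  have mult: "h (a \<otimes> b) = h a \<otimes> h b" if "a \<in> f ` P" "b \<in> f ` P" for a b
  proof -
    have ab: "a \<in> carrier R" "b \<in> carrier R" using that fP by auto
    have "h a \<otimes> h b = f x \<otimes> a \<otimes> (inv f x \<otimes> f x) \<otimes> b \<otimes> inv f x"
      using ab fx by (simp only: h_def m_assoc m_closed)
    then show ?thesis using ab fx by (simp add: h_def m_assoc)
  qed
  have "inj_on h (f ` P)"
    using fP fx by (auto simp: inj_on_def h_def)
  moreover have "h ` f ` P = f ` P'"
    using hf by (auto simp: im[symmetric] image_image)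
  ultimately have "h \<in> iso (R\<lparr>carrier := f ` P\<rparr>) (R\<lparr>carrier := f ` P'\<rparr>)"
    using mult by (auto simp: iso_def hom_def bij_betw_def)
  then show ?thesis by (auto simp: is_iso_def)
qed

end

section \<open>Cosets as vertices and the action on them\<close>

context block_data
begin

definition coset where "coset x = (\<lambda>l. x \<circ> l) ` L"
text \<open>The vertices have to be natural numbers; any injective numbering of the finitely many
  cosets will do.\<close>

definition idx :: "('a \<Rightarrow> 'a) set \<Rightarrow> nat" where "idx = (SOME f. inj_on f (coset ` G))"
definition v where "v x = idx (coset x)"
definition V where "V = v ` G"
definition rep where "rep u = (SOME x. x \<in> G \<and> v x = u)"
text \<open>Restricted to \<open>V\<close> because elements of \<open>BijGroup V\<close> are
  extensional. The choice made by \<open>rep\<close> is harmless by \<open>v_left\<close>.\<close>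

definition act where "act g = (\<lambda>u\<in>V. v (g \<circ> rep u))"
text \<open>The \<open>G\<close>-orbit of the arc from \<open>v id\<close> to \<open>v t\<close>; it
  is symmetric since \<open>t\<close> is an involution.\<close>

definition Ed where "Ed = {(v x, v (x \<circ> t)) |x. x \<in> G}"

lemmas G' = perm_groupD[OF G_group] and H' = perm_groupD[OF H_group]
  and L' = perm_groupD[OF L_group] and M' = perm_groupD[OF M_group]
  and E' = perm_groupD[OF E_group] and C' = perm_groupD[OF C_group]

lemma G_simps [simp]: "x \<in> G \<Longrightarrow> y \<in> G \<Longrightarrow> x \<circ> y \<in> G" "x \<in> G \<Longrightarrow> pinv x \<in> G" "t \<in> G" "id \<in> G"
  "x \<in> L \<Longrightarrow> x \<in> G" "x \<in> M \<Longrightarrow> x \<in> G" "x \<in> H \<Longrightarrow> x \<in> G" "x \<in> E \<Longrightarrow> x \<in> G" "x \<in> C \<Longrightarrow> x \<in> G" "x \<in> G \<Longrightarrow> bij x"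
  using G' t_G L_G M_G H_G E_L C_L by auto

lemma finG: "finite G"
  using finite_permutations[OF fin] by (rule finite_subset[rotated]) (use G'(1) in auto)

lemma coset_eq:
  assumes "x \<in> G" "y \<in> G"
  shows "coset x = coset y \<longleftrightarrow> pinv x \<circ> y \<in> L"
proof
  assume "coset x = coset y"
  moreover have "y \<in> coset y" using L'(2) by (auto simp: coset_def image_iff intro!: bexI[of _ id])
  ultimately obtain l where "l \<in> L" "y = x \<circ> l" by (auto simp: coset_def)
  then show "pinv x \<circ> y \<in> L" using assms by (simp add: pinv_cancel)
next
  assume l: "pinv x \<circ> y \<in> L"
  have sub: "coset y' \<subseteq> coset x'" if "x' \<in> G" "y' \<in> G" "pinv x' \<circ> y' \<in> L" for x' y'
  proof
    fix z assume "z \<in> coset y'"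
    then obtain k where k: "k \<in> L" "z = y' \<circ> k" by (auto simp: coset_def)
    have "z = x' \<circ> ((pinv x' \<circ> y') \<circ> k)" using that k by (simp add: comp_assoc pinv_cancel)
    then show "z \<in> coset x'" using L'(3)[OF that(3) k(1)] unfolding coset_def by (rule image_eqI)
  qed
  have "pinv (pinv x \<circ> y) \<in> L" using l L'(4) by blast
  then have "pinv y \<circ> x \<in> L" using assms by (simp add: pinv_comp pinv_cancel)
  then show "coset x = coset y" using sub l assms by (intro equalityI) blast+
qed

lemma v_eq:
  assumes "x \<in> G" "y \<in> G"
  shows "v x = v y \<longleftrightarrow> pinv x \<circ> y \<in> L"
proof -
  have "\<exists>f :: ('a \<Rightarrow> 'a) set \<Rightarrow> nat. inj_on f (coset ` G)"
    using finG finite_imp_inj_to_nat_seg by (metis finite_imageI)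
  then have "inj_on idx (coset ` G)" unfolding idx_def by (rule someI_ex)
  then show ?thesis using inj_on_eq_iff[of idx "coset ` G" "coset x" "coset y"] assms coset_eq by (simp add: v_def)
qed

lemma v_mult_L: "x \<in> G \<Longrightarrow> l \<in> L \<Longrightarrow> v (x \<circ> l) = v x"
  using v_eq[of x "x \<circ> l"] by (simp add: pinv_cancel)

lemma rep: "u \<in> V \<Longrightarrow> rep u \<in> G \<and> v (rep u) = u"
  using someI_ex[of "\<lambda>x. x \<in> G \<and> v x = u"] by (auto simp: rep_def V_def)

lemma v_left:
  assumes "g \<in> G" "x \<in> G" "y \<in> G"
  shows "v (g \<circ> x) = v (g \<circ> y) \<longleftrightarrow> v x = v y"
  using assms by (simp add: v_eq pinv_comp comp_assoc pinv_cancel)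

lemma act_v: "g \<in> G \<Longrightarrow> x \<in> G \<Longrightarrow> act g (v x) = v (g \<circ> x)"
  using rep[of "v x"] v_left[of g "rep (v x)" x] by (auto simp: act_def V_def)

lemma VE: "u \<in> V \<Longrightarrow> (\<And>x. x \<in> G \<Longrightarrow> u = v x \<Longrightarrow> thesis) \<Longrightarrow> thesis"
  by (auto simp: V_def)

lemma v_V [simp]: "x \<in> G \<Longrightarrow> v x \<in> V"
  by (auto simp: V_def)

lemma act_in_V: "g \<in> G \<Longrightarrow> u \<in> V \<Longrightarrow> act g u \<in> V"
  by (auto elim!: VE simp: act_v)

lemma act_comp: "g \<in> G \<Longrightarrow> h \<in> G \<Longrightarrow> u \<in> V \<Longrightarrow> act (g \<circ> h) u = act g (act h u)"
  by (auto elim!: VE simp: act_v comp_assoc)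

lemma act_Bij: "g \<in> G \<Longrightarrow> act g \<in> Bij V"
proof -
  assume g: "g \<in> G"
  have 1: "act (pinv g) (act g u) = u" "act g (act (pinv g) u) = u" if "u \<in> V" for u
    using that g by (auto elim!: VE simp: act_v pinv_cancel)
  have "bij_betw (act g) V V"
    using 1 act_in_V g by (intro bij_betwI[where g = "act (pinv g)"]) auto
  then show ?thesis by (auto simp: Bij_def act_def)
qed

lemma act_mult: "g \<in> G \<Longrightarrow> h \<in> G \<Longrightarrow> act (g \<circ> h) = act g \<otimes>\<^bsub>BijGroup V\<^esub> act h"
proof -
  assume gh: "g \<in> G" "h \<in> G"
  then have "act g \<otimes>\<^bsub>BijGroup V\<^esub> act h = compose V (act g) (act h)"
    using act_Bij by (simp add: BijGroup_def)
  also have "\<dots> = act (g \<circ> h)"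
    using act_comp gh by (auto simp: compose_def fun_eq_iff act_def)
  finally show ?thesis by simp
qed

sublocale act: perm_hom "BijGroup V" \<Omega> G act
  using group_BijGroup G_group act_Bij act_mult
  by (intro perm_hom.intro perm_hom_axioms.intro) (auto simp: BijGroup_def)

text \<open>The kernel \<open>N\<close> of the action fixes the base vertex, so it lies in
  \<open>L\<close>. A nontrivial normal subgroup would contain \<open>M\<close>, which
  \<open>L\<close> does not.\<close>

lemma act_inj: "inj_on act G"
proof (rule inj_onI, rule ccontr)
  fix g h assume gh: "g \<in> G" "h \<in> G" "act g = act h" "g \<noteq> h"
  define N where "N = {k \<in> G. \<forall>x\<in>G. v (k \<circ> x) = v x}"
  have NL: "N \<subseteq> L"
  proof
    fix k assume "k \<in> N"
    then have "k \<in> G" "v (k \<circ> id) = v id" unfolding N_def by (blast intro: G_simps(4))+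
    then have "v id = v k" by simp
    then have "pinv id \<circ> k \<in> L" using v_eq[of id k] \<open>k \<in> G\<close> by (simp del: comp_id id_comp inv_id)
    then show "k \<in> L" by simp
  qed
  have N: "perm_group \<Omega> N"
  proof (rule perm_groupI)
    show "p permutes \<Omega>" if "p \<in> N" for p using that G'(1) by (simp add: N_def)
    show "id \<in> N" using G'(2) by (simp add: N_def)
    show "p \<circ> q \<in> N" if "p \<in> N" "q \<in> N" for p q
      using that by (auto simp: N_def comp_assoc simp del: comp_apply)
    show "pinv p \<in> N" if p: "p \<in> N" for p
    proof -
      have "v (pinv p \<circ> x) = v x" if x: "x \<in> G" for x
      proof -
        have "v (p \<circ> (pinv p \<circ> x)) = v (pinv p \<circ> x)" using p x by (simp add: N_def)
        then show ?thesis using p x by (simp add: N_def pinv_cancel)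
      qed
      then show ?thesis using p by (simp add: N_def)
    qed
  qed
  have "v (pinv h \<circ> g \<circ> x) = v x" if x: "x \<in> G" for x
  proof -
    have "v (g \<circ> x) = v (h \<circ> x)" using act_v[of g x] act_v[of h x] gh x by simp
    then have "v (pinv h \<circ> (g \<circ> x)) = v (pinv h \<circ> (h \<circ> x))" using v_left[of "pinv h"] gh x by simp
    then show ?thesis using gh x by (simp add: comp_assoc pinv_cancel)
  qed
  then have k: "pinv h \<circ> g \<in> N" using gh by (simp add: N_def)
  have kne: "pinv h \<circ> g \<noteq> id"
  proof
    assume "pinv h \<circ> g = id"
    then have "h \<circ> (pinv h \<circ> g) = h" by simp
    then show False using gh by (simp add: pinv_cancel)
  qed
  have "M \<subseteq> N"
  proof (rule normal_contains_M[OF N _ _ k kne])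
    show "N \<subseteq> H" using NL L_H by blast
    fix n x assume n: "n \<in> N" and x: "x \<in> H"
    have "v (x \<circ> n \<circ> pinv x \<circ> y) = v y" if y: "y \<in> G" for y
    proof -
      have "v (n \<circ> (pinv x \<circ> y)) = v (pinv x \<circ> y)" "n \<in> G" using n x y by (simp_all add: N_def)
      then have "v (x \<circ> (n \<circ> (pinv x \<circ> y))) = v (x \<circ> (pinv x \<circ> y))" using v_left[of x] x y by simp
      then show ?thesis using x by (simp add: comp_assoc pinv_cancel)
    qed
    then show "x \<circ> n \<circ> pinv x \<in> N" using n x by (simp add: N_def)
  qed
  then show False using NL M_not_L by blast
qed

section \<open>Adjacency, connectedness and two-arcs\<close>

lemma Ed_iff:
  assumes x: "x \<in> G"
  shows "(v x, y) \<in> Ed \<longleftrightarrow> (\<exists>e\<in>E. y = v (x \<circ> e \<circ> t))"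
proof
  assume "(v x, y) \<in> Ed"
  then obtain z where z: "z \<in> G" "v x = v z" "y = v (z \<circ> t)" by (auto simp: Ed_def)
  then have "pinv x \<circ> z \<in> L" using v_eq x by blast
  then obtain e c where l: "pinv x \<circ> z = e \<circ> c" "e \<in> E" "c \<in> C" by (auto simp: L_def)
  have "z = x \<circ> (pinv x \<circ> z)" using x by (simp add: pinv_cancel)
  then have "z = x \<circ> (e \<circ> c)" unfolding l(1) .
  \<comment> \<open>As \<open>c\<close> commutes with \<open>t\<close>, it moves to the right end
    and is absorbed by the coset; only the translation \<open>e\<close> is left to label the
    neighbour.\<close>
  then have "z \<circ> t = x \<circ> e \<circ> t \<circ> c" by (simp add: comp_assoc t_C[OF l(3)])
  then have "y = v (x \<circ> e \<circ> t)" using z v_mult_L[of "x \<circ> e \<circ> t" c] x l C_L by auto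
  then show "\<exists>e\<in>E. y = v (x \<circ> e \<circ> t)" using l by blast
next
  assume "\<exists>e\<in>E. y = v (x \<circ> e \<circ> t)"
  then obtain e where e: "e \<in> E" "y = v (x \<circ> e \<circ> t)" by blast
  have "v (x \<circ> e) = v x" using v_mult_L x e E_L by blast
  then have "(v x, y) = (v (x \<circ> e), v (x \<circ> e \<circ> t))" "x \<circ> e \<in> G" using e x by auto
  then show "(v x, y) \<in> Ed" unfolding Ed_def by blast
qed

text \<open>Two translations give the same neighbour only if they differ by an element of the arc
  stabilizer \<open>C\<close>, which meets \<open>E\<close> trivially. Hence the valency is exactly
  \<open>card E\<close>.\<close>

lemma nbr_inj:
  assumes "x \<in> G" "e \<in> E" "e' \<in> E" "v (x \<circ> e \<circ> t) = v (x \<circ> e' \<circ> t)"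
  shows "e = e'"
proof -
  have "v (e \<circ> t) = v (e' \<circ> t)" using assms v_left[of x "e \<circ> t" "e' \<circ> t"] by (simp add: comp_assoc)
  then have "t \<circ> (pinv e \<circ> e') \<circ> t \<in> L"
    using assms t_simps v_eq[of "e \<circ> t" "e' \<circ> t"] by (simp add: pinv_comp comp_assoc)
  moreover have ee: "pinv e \<circ> e' \<in> E" using assms E'(3,4) by blast
  ultimately have "pinv e \<circ> e' \<in> C" using arc_stabilizer E_L by blast
  then have "pinv e \<circ> e' = id" using E_C_disjoint ee by blast
  then have "e \<circ> (pinv e \<circ> e') = e" by simp
  then show ?thesis using assms by (simp add: pinv_cancel)
qed

lemma graph_Ed: "simple_graph V Ed"
  unfolding simple_graph_def
proof (intro conjI allI)
  show "finite V" using finG by (simp add: V_def)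
  show "Ed \<subseteq> V \<times> V" by (auto simp: Ed_def)
  show "sym Ed"
  proof (rule symI)
    fix a b assume "(a, b) \<in> Ed"
    then obtain x where x: "x \<in> G" "a = v x" "b = v (x \<circ> t)" by (auto simp: Ed_def)
    have "x \<circ> t \<circ> t = x" by (simp add: comp_assoc t_inv)
    then have "(b, a) = (v (x \<circ> t), v (x \<circ> t \<circ> t))" "x \<circ> t \<in> G" using x by auto
    then show "(b, a) \<in> Ed" unfolding Ed_def by blast
  qed
  fix a
  show "(a, a) \<notin> Ed"
  proof
    assume "(a, a) \<in> Ed"
    then obtain x where x: "x \<in> G" "v x = v (x \<circ> t)" by (auto simp: Ed_def)
    then have "pinv x \<circ> (x \<circ> t) \<in> L" using v_eq[of x "x \<circ> t"] by simp
    then show False using x t_not_L by (simp add: pinv_cancel)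
  qed
qed

lemma connected_Ed: "connected_graph V Ed"
proof -
  have symE: "sym Ed" using graph_Ed by (simp add: simple_graph_def)
  \<comment> \<open>The right multipliers that never leave a connected component: \<open>L\<close>
    fixes the vertex and \<open>t\<close> leads to a neighbour.\<close>
  define Y where "Y = {y \<in> G. \<forall>x\<in>G. (v x, v (x \<circ> y)) \<in> Ed\<^sup>*}"
  have Y: "perm_group \<Omega> Y"
  proof (rule perm_groupI)
    show "p permutes \<Omega>" if "p \<in> Y" for p using that G'(1) by (simp add: Y_def)
    show "id \<in> Y" using G'(2) by (simp add: Y_def)
    show "p \<circ> q \<in> Y" if pq: "p \<in> Y" "q \<in> Y" for p q
    proof -
      have "(v x, v (x \<circ> (p \<circ> q))) \<in> Ed\<^sup>*" if "x \<in> G" for x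
      proof -
        have "(v x, v (x \<circ> p)) \<in> Ed\<^sup>*" "(v (x \<circ> p), v (x \<circ> p \<circ> q)) \<in> Ed\<^sup>*"
          using that pq by (simp_all add: Y_def)
        then show ?thesis by (simp add: comp_assoc)
      qed
      then show ?thesis using pq by (simp add: Y_def)
    qed
    show "pinv p \<in> Y" if p: "p \<in> Y" for p
    proof -
      have "(v x, v (x \<circ> pinv p)) \<in> Ed\<^sup>*" if "x \<in> G" for x
      proof -
        have "(v (x \<circ> pinv p), v (x \<circ> pinv p \<circ> p)) \<in> Ed\<^sup>*" "p \<in> G" using that p by (simp_all add: Y_def)
        then have "(v (x \<circ> pinv p), v x) \<in> Ed\<^sup>*" by (simp add: comp_assoc pinv_cancel)
        then show ?thesis using sym_rtrancl[OF symE] by (blast dest: symD)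
      qed
      then show ?thesis using p by (simp add: Y_def)
    qed
  qed
  have "L \<subseteq> Y" using v_mult_L by (auto simp: Y_def)
  moreover have "t \<in> Y" by (auto simp: Y_def Ed_def intro!: r_into_rtrancl)
  ultimately have GY: "G \<subseteq> Y" using G_min[OF Y] by blast
  have "(v x, v y) \<in> Ed\<^sup>*" if "x \<in> G" "y \<in> G" for x y
  proof -
    have "pinv x \<circ> y \<in> Y" using that GY by auto
    then have "(v x, v (x \<circ> (pinv x \<circ> y))) \<in> Ed\<^sup>*" using that unfolding Y_def by blast
    then show ?thesis using that by (simp add: pinv_cancel)
  qed
  moreover have "V \<noteq> {}" using G'(2) by (auto simp: V_def simp del: G_simps)
  ultimately show ?thesis by (auto simp: connected_graph_def V_def)
qed

lemma valency_Ed: "has_valency V Ed (card E)"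
  unfolding has_valency_def
proof
  fix u assume "u \<in> V"
  then obtain x where x: "x \<in> G" "u = v x" by (auto simp: V_def)
  have "{y. (u, y) \<in> Ed} = (\<lambda>e. v (x \<circ> e \<circ> t)) ` E" using Ed_iff[OF x(1)] x by auto
  moreover have "inj_on (\<lambda>e. v (x \<circ> e \<circ> t)) E" using nbr_inj[OF x(1)] by (auto simp: inj_on_def)
  ultimately show "card {y. (u, y) \<in> Ed} = card E" by (simp add: card_image)
qed

lemma act_Ed:
  assumes "g \<in> G" "(a, b) \<in> Ed" shows "(act g a, act g b) \<in> Ed"
proof -
  obtain x where x: "x \<in> G" "a = v x" "b = v (x \<circ> t)" using assms by (auto simp: Ed_def)
  then have "(act g a, act g b) = (v (g \<circ> x), v (g \<circ> x \<circ> t))" "g \<circ> x \<in> G"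
    using assms by (auto simp: act_v comp_assoc)
  then show ?thesis unfolding Ed_def by blast
qed

lemma aut_Ed: "aut_subgroup V Ed (act ` G)"
  unfolding aut_subgroup_def
proof
  show "subgroup (act ` G) (BijGroup V)" by (rule act.image_subgroup[OF G_group order_refl])
  have "(x, y) \<in> Ed \<longleftrightarrow> (act g x, act g y) \<in> Ed" if g: "g \<in> G" and "x \<in> V" "y \<in> V" for g x y
  proof
    assume "(act g x, act g y) \<in> Ed"
    then have "(act (pinv g) (act g x), act (pinv g) (act g y)) \<in> Ed" using act_Ed g by simp
    then show "(x, y) \<in> Ed" using that by (auto elim!: VE simp: act_v pinv_cancel)
  qed (rule act_Ed[OF g])
  then show "act ` G \<subseteq> graph_aut V Ed"
    using act_Bij by (auto simp: graph_aut_def BijGroup_def)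
qed

lemma nontrivial_on_block:
  assumes "i \<in> I" obtains e where "e \<in> E" "restrict_id e (B i) \<noteq> id"
  using I_two[OF assms] E_sep_B[OF assms] by metis

text \<open>Every two-arc is brought to a standard form with one fixed translation
  \<open>e0\<close>. Two elements \<open>x\<close> and \<open>y\<close> describing standard forms
  are then related by left multiplication with \<open>y \<circ> pinv x\<close>.\<close>

lemma two_arc_trans_Ed: "two_arc_transitive Ed (act ` G)"
proof -
  obtain i where i: "i \<in> I" using I_ne by blast
  obtain e0 where e0: "e0 \<in> E" "restrict_id e0 (B i) \<noteq> id" using nontrivial_on_block[OF i] .
  have e0n: "e0 \<noteq> id"
  proof
    assume "e0 = id"
    then have "restrict_id e0 (B i) = id" by (auto simp: restrict_id_def fun_eq_iff)
    then show False using e0 by simp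
  qed
  have std: "\<exists>x\<in>G. a = v (x \<circ> t) \<and> b = v x \<and> c = v (x \<circ> e0 \<circ> t)" if abc: "(a, b, c) \<in> two_arcs Ed" for a b c
  proof -
    have symE: "sym Ed" using graph_Ed by (simp add: simple_graph_def)
    have ab: "(b, a) \<in> Ed" "(b, c) \<in> Ed" "a \<noteq> c" using abc symE by (auto simp: two_arcs_def dest: symD)
    obtain x where x: "x \<in> G" "b = v x" using ab by (auto simp: Ed_def)
    obtain e1 e2 where e: "e1 \<in> E" "e2 \<in> E" "a = v (x \<circ> e1 \<circ> t)" "c = v (x \<circ> e2 \<circ> t)"
      using ab Ed_iff[OF x(1)] x by auto
    \<comment> \<open>Another representative of \<open>b\<close>, chosen so that \<open>a\<close>
      becomes the neighbour labelled by the identity translation; the label of \<open>c\<close>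
      becomes the quotient \<open>e\<close>.\<close>
    define y where "y = x \<circ> e1"
    have y: "y \<in> G" "b = v y" using x e v_mult_L E_L by (auto simp: y_def)
    define e where "e = pinv e1 \<circ> e2"
    have eE: "e \<in> E" using \<open>e1 \<in> E\<close> \<open>e2 \<in> E\<close> E'(3,4) by (simp add: e_def)
    have c: "c = v (y \<circ> e \<circ> t)" using \<open>c = _\<close> \<open>e1 \<in> E\<close> by (simp add: y_def e_def comp_assoc pinv_cancel)
    have a: "a = v (y \<circ> t)" using \<open>a = _\<close> by (simp add: y_def)
    have "e \<noteq> id" using ab(3) a c by auto
    \<comment> \<open>Replacing \<open>y\<close> by \<open>y \<circ> d\<close> keeps
      \<open>b\<close> and, as \<open>d\<close> commutes with \<open>t\<close>, also
      \<open>a\<close>; the label of \<open>c\<close> changes from \<open>e\<close> to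
      \<open>e0\<close>.\<close>
    then obtain d where d: "d \<in> C" "d \<circ> e0 \<circ> pinv d = e" using C_conj_trans e0 e0n eE by blast
    have de: "d \<circ> e0 = e \<circ> d" using d by (simp add: d(2)[symmetric] comp_assoc pinv_cancel)
    have dL: "d \<in> L" using d C_L by blast
    have 1: "v (y \<circ> d) = v y" using y dL v_mult_L by blast
    have "y \<circ> d \<circ> t = y \<circ> t \<circ> d" using t_C[OF d(1)] by (simp add: comp_assoc)
    then have 2: "v (y \<circ> d \<circ> t) = v (y \<circ> t)" using v_mult_L[OF _ dL, of "y \<circ> t"] y by simp
    have "y \<circ> d \<circ> e0 \<circ> t = y \<circ> (d \<circ> e0) \<circ> t" by (simp add: comp_assoc)
    also have "\<dots> = y \<circ> e \<circ> (d \<circ> t)" unfolding de by (simp add: comp_assoc)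
    also have "\<dots> = y \<circ> e \<circ> t \<circ> d" unfolding t_C[OF d(1), symmetric] by (simp add: comp_assoc)
    finally have 3: "v (y \<circ> d \<circ> e0 \<circ> t) = v (y \<circ> e \<circ> t)"
      using v_mult_L[OF _ dL, of "y \<circ> e \<circ> t"] y eE by simp
    show ?thesis using 1 2 3 a c y d by (intro bexI[of _ "y \<circ> d"]) auto
  qed
  have "\<exists>g\<in>act ` G. (g a, g b, g c) = (a', b', c')"
    if arcs: "(a, b, c) \<in> two_arcs Ed" "(a', b', c') \<in> two_arcs Ed" for a b c a' b' c'
  proof -
    obtain x where x: "x \<in> G" "a = v (x \<circ> t)" "b = v x" "c = v (x \<circ> e0 \<circ> t)" using std[OF arcs(1)] by blast
    obtain y where y: "y \<in> G" "a' = v (y \<circ> t)" "b' = v y" "c' = v (y \<circ> e0 \<circ> t)" using std[OF arcs(2)] by blast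
    have "act (y \<circ> pinv x) (v (x \<circ> z)) = v (y \<circ> z)" if "z \<in> G" for z
      using x y that by (simp add: act_v comp_assoc pinv_cancel)
    from this[of t] this[of id] this[of "e0 \<circ> t"] show ?thesis
      using x y e0 by (intro bexI[of _ "act (y \<circ> pinv x)"]) (auto simp: comp_assoc)
  qed
  then show ?thesis unfolding two_arc_transitive_def by fast
qed

end

context block_data
begin

subsection \<open>Product action type\<close>

lemma stab_act:
  assumes "x \<in> G" "P \<subseteq> G"
  shows "stab (act ` P) (v x) = act ` {g \<in> P. pinv x \<circ> g \<circ> x \<in> L}"
proof -
  have "act g (v x) = v x \<longleftrightarrow> pinv x \<circ> g \<circ> x \<in> L" if "g \<in> P" for g
  proof -
    have "g \<in> G" using that assms by auto
    then show ?thesis using assms v_eq[of x "g \<circ> x"] by (auto simp: act_v comp_assoc simp del: comp_apply)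
  qed
  then show ?thesis by (auto simp: stab_def)
qed

text \<open>The two stabilizers are the conjugates by \<open>x\<close> of \<open>L\<close> and
  \<open>t L t\<close>. Since \<open>H\<close> is normal in \<open>G\<close>, they generate the same
  group for every edge.\<close>

lemma Gstar_eq:
  assumes x: "x \<in> G"
  shows "Gstar V (act ` G) (v x) (v (x \<circ> t)) = act ` H"
  unfolding Gstar_def
proof (rule act.generateI[symmetric])
  show "subgroup (act ` H) (BijGroup V)" by (rule act.image_subgroup[OF H_group H_G])
  have st: "stab (act ` G) (v x) = act ` {g \<in> G. pinv x \<circ> g \<circ> x \<in> L}"
    "stab (act ` G) (v (x \<circ> t)) = act ` {g \<in> G. pinv (x \<circ> t) \<circ> g \<circ> (x \<circ> t) \<in> L}"
    using stab_act[of x G] stab_act[of "x \<circ> t" G] x by simp_all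
  have inH: "g \<in> H" if "y \<in> G" "g \<in> G" "pinv y \<circ> g \<circ> y \<in> L" for y g
  proof -
    have "y \<circ> (pinv y \<circ> g \<circ> y) \<circ> pinv y \<in> H" using that L_H by (intro H_conj) auto
    then show ?thesis using that by (simp add: comp_assoc pinv_cancel)
  qed
  have "x \<circ> t \<in> G" using x by simp
  then show "stab (act ` G) (v x) \<union> stab (act ` G) (v (x \<circ> t)) \<subseteq> act ` H"
    unfolding st using inH[OF x] inH[of "x \<circ> t"] by (intro Un_least image_mono subsetI) blast+
  fix K assume K: "subgroup K (BijGroup V)" and sub: "stab (act ` G) (v x) \<union> stab (act ` G) (v (x \<circ> t)) \<subseteq> K"
  \<comment> \<open>Conjugating back by \<open>x\<close> moves the edge to the base arc, where
    \<open>H_min\<close> applies.\<close>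
  define Y where "Y = {g \<in> G. act (x \<circ> g \<circ> pinv x) \<in> K}"
  have Y: "perm_group \<Omega> Y"
  proof (rule perm_groupI)
    show "p permutes \<Omega>" if "p \<in> Y" for p using that G'(1) by (simp add: Y_def)
    have "x \<circ> id \<circ> pinv x = id" using x by (simp add: pinv_cancel)
    then show "id \<in> Y" using subgroup.one_closed[OF K] act.f_id by (simp add: Y_def)
    show "p \<circ> q \<in> Y" if "p \<in> Y" "q \<in> Y" for p q
    proof -
      have "x \<circ> (p \<circ> q) \<circ> pinv x = (x \<circ> p \<circ> pinv x) \<circ> (x \<circ> q \<circ> pinv x)"
        using x by (simp add: comp_assoc pinv_cancel)
      then have "act (x \<circ> (p \<circ> q) \<circ> pinv x) = act (x \<circ> p \<circ> pinv x) \<otimes>\<^bsub>BijGroup V\<^esub> act (x \<circ> q \<circ> pinv x)"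
        using act_mult that x by (simp add: Y_def)
      then show ?thesis using that subgroup.m_closed[OF K] by (simp add: Y_def)
    qed
    show "pinv p \<in> Y" if "p \<in> Y" for p
    proof -
      have p: "p \<in> G" using that by (simp add: Y_def)
      then have "x \<circ> pinv p \<circ> pinv x = pinv (x \<circ> p \<circ> pinv x)"
        using x by (simp add: comp_assoc pinv_cancel pinv_comp bij_comp)
      then have "act (x \<circ> pinv p \<circ> pinv x) = inv\<^bsub>BijGroup V\<^esub> act (x \<circ> p \<circ> pinv x)"
        using act.f_pinv[of "x \<circ> p \<circ> pinv x"] p x by simp
      then show ?thesis using that subgroup.m_inv_closed[OF K] by (simp add: Y_def)
    qed
  qed
  have conjK: "act (y \<circ> l \<circ> pinv y) \<in> stab (act ` G) (v y)" if "y \<in> G" "l \<in> L" for y l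
  proof -
    have "pinv y \<circ> (y \<circ> l \<circ> pinv y) \<circ> y = l" using that by (simp add: comp_assoc pinv_cancel)
    then have "y \<circ> l \<circ> pinv y \<in> {g \<in> G. pinv y \<circ> g \<circ> y \<in> L}" using that by simp
    then show ?thesis unfolding stab_act[OF that(1) order_refl] by (rule imageI)
  qed
  have "H \<subseteq> Y"
  proof (rule H_min[OF Y])
    show "L \<subseteq> Y" using conjK[OF x] sub by (auto simp: Y_def)
    fix l assume l: "l \<in> L"
    have "x \<circ> (t \<circ> l \<circ> t) \<circ> pinv x = (x \<circ> t) \<circ> l \<circ> pinv (x \<circ> t)"
      using x t_simps by (simp add: comp_assoc pinv_comp)
    then have "act (x \<circ> (t \<circ> l \<circ> t) \<circ> pinv x) \<in> K" using conjK[of "x \<circ> t" l] x l sub by auto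
    then show "t \<circ> l \<circ> t \<in> Y" using l by (simp add: Y_def)
  qed
  show "act ` H \<subseteq> K"
  proof
    fix y assume "y \<in> act ` H"
    then obtain h where h: "h \<in> H" "y = act h" by auto
    have "pinv x \<circ> h \<circ> pinv (pinv x) \<in> H" using x h by (intro H_conj) auto
    then have "act (x \<circ> (pinv x \<circ> h \<circ> pinv (pinv x)) \<circ> pinv x) \<in> K" using \<open>H \<subseteq> Y\<close> unfolding Y_def by blast
    then show "y \<in> K" using x h by (simp add: comp_assoc pinv_cancel)
  qed
qed

text \<open>A nontrivial normal subgroup of the image has a nontrivial preimage even if
  \<open>f\<close> has a kernel. The same statement thus serves the action on \<open>V\<close> and
  the action induced on a single orbit.\<close>

lemma hom_normal_contains_M:
  assumes "perm_hom R \<Omega> H f" and N: "N \<lhd> R\<lparr>carrier := f ` H\<rparr>" "N \<noteq> {\<one>\<^bsub>R\<^esub>}"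
  shows "M \<subseteq> {h \<in> H. f h \<in> N}"
proof -
  interpret perm_hom R \<Omega> H f by fact
  note pre = preimage_normal[OF N(1)]
  have "\<exists>n. n \<in> {h \<in> H. f h \<in> N} \<and> n \<noteq> id"
  proof (rule ccontr)
    assume "\<not> ?thesis"
    then have "{h \<in> H. f h \<in> N} = {id}" using perm_groupD(2)[OF pre(1)] by blast
    then have "N = f ` {id}" using pre(3) by simp
    then show False using N(2) f_id by simp
  qed
  then obtain n where n: "n \<in> {h \<in> H. f h \<in> N}" "n \<noteq> id" by blast
  show ?thesis by (rule normal_contains_M[OF pre(1) _ pre(2) n]) auto
qed

text \<open>\<open>H\<close> is \<open>M\<close> times the stabilizer of the base vertex, and
  conjugation by \<open>z\<close> carries this factorization to \<open>v z\<close>; so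
  \<open>M\<close> has the same orbits on vertices as \<open>H\<close>.\<close>

lemma M_transitive:
  assumes "z \<in> G" "k \<in> H" shows "\<exists>m\<in>M. v (k \<circ> z) = v (m \<circ> z)"
proof -
  have "pinv z \<circ> k \<circ> pinv (pinv z) \<in> H" using assms by (intro H_conj) auto
  then have "pinv z \<circ> k \<circ> z \<in> H" using assms by (simp add: pinv_cancel)
  then obtain m l where ml: "pinv z \<circ> k \<circ> z = m \<circ> l" "m \<in> M" "l \<in> L" unfolding H_def by blast
  have mM: "z \<circ> m \<circ> pinv z \<in> M" using ml assms G_BP by (intro M_conj) auto
  have "k \<circ> z = z \<circ> (pinv z \<circ> k \<circ> z)" using assms by (simp add: comp_assoc pinv_cancel)
  also have "\<dots> = (z \<circ> m \<circ> pinv z) \<circ> z \<circ> l" unfolding ml(1) using assms by (simp add: comp_assoc pinv_cancel)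
  finally have "v (k \<circ> z) = v ((z \<circ> m \<circ> pinv z) \<circ> z)"
    using v_mult_L[of "(z \<circ> m \<circ> pinv z) \<circ> z" l] ml assms by simp
  then show ?thesis using mM by blast
qed

text \<open>Every nontrivial normal subgroup of the induced group, minimal or not, contains the
  image of \<open>M\<close>, which is transitive on the orbit.\<close>

lemma quasiprimitive_orbit:
  assumes "u \<in> V"
  shows "quasiprimitive (orbit (act ` H) u) (induced_perm_group (orbit (act ` H) u) (act ` H))"
proof -
  obtain y where y: "y \<in> G" "u = v y" using assms by (auto simp: V_def)
  define D where "D = orbit (act ` H) u"
  have D: "D = {v (h \<circ> y) |h. h \<in> H}" using y by (auto simp: D_def orbit_def image_image act_v)
  have DV: "D \<subseteq> V" using y by (auto simp: D)
  define \<rho> where "\<rho> h = restrict (act h) D" for h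
  have ind: "induced_perm_group D (act ` H) = \<rho> ` H"
    by (simp add: induced_perm_group_def \<rho>_def image_image)
  have inD: "act h d \<in> D" if hd: "h \<in> H" "d \<in> D" for h d
  proof -
    obtain k where k: "k \<in> H" "d = v (k \<circ> y)" using hd D by auto
    have "act h d = v ((h \<circ> k) \<circ> y)" using k hd y by (simp add: act_v comp_assoc)
    then show ?thesis using H'(3)[OF hd(1) k(1)] unfolding D by blast
  qed
  have cancel: "act (pinv h) (act h d) = d" "act h (act (pinv h) d) = d" if "h \<in> H" "d \<in> D" for h d
    using that DV y by (auto simp: D act_v pinv_cancel)
  have \<rho>_Bij: "\<rho> h \<in> Bij D" if h: "h \<in> H" for h
  proof -
    have "bij_betw (act h) D D"
      using inD[OF h] inD[OF H'(4)[OF h]] cancel[OF h] by (intro bij_betwI[where g = "act (pinv h)"]) auto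
    then have "bij_betw (\<rho> h) D D" unfolding \<rho>_def by (simp cong: bij_betw_cong)
    then show ?thesis by (simp add: Bij_def \<rho>_def)
  qed
  have \<rho>: "perm_hom (BijGroup D) \<Omega> H \<rho>"
  proof (intro perm_hom.intro perm_hom_axioms.intro group_BijGroup H_group)
    show "\<rho> p \<in> carrier (BijGroup D)" if "p \<in> H" for p using \<rho>_Bij that by (simp add: BijGroup_def)
    show "\<rho> (p \<circ> q) = \<rho> p \<otimes>\<^bsub>BijGroup D\<^esub> \<rho> q" if pq: "p \<in> H" "q \<in> H" for p q
    proof -
      have "\<rho> p \<otimes>\<^bsub>BijGroup D\<^esub> \<rho> q = compose D (\<rho> p) (\<rho> q)" using \<rho>_Bij pq by (simp add: BijGroup_def)
      also have "\<dots> = \<rho> (p \<circ> q)"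
        using inD[OF pq(2)] act_comp pq DV by (auto simp: compose_def \<rho>_def fun_eq_iff)
      finally show ?thesis by simp
    qed
  qed
  interpret \<rho>: perm_hom "BijGroup D" \<Omega> H \<rho> by (rule \<rho>)
  have "quasiprimitive D (\<rho> ` H)"
    unfolding quasiprimitive_def
  proof (intro conjI allI impI)
    show "subgroup (\<rho> ` H) (BijGroup D)" by (rule \<rho>.image_subgroup[OF H_group order_refl])
    fix N assume "minimal_normal N (BijGroup D\<lparr>carrier := \<rho> ` H\<rparr>)"
    then have N: "N \<lhd> BijGroup D\<lparr>carrier := \<rho> ` H\<rparr>" "N \<noteq> {\<one>\<^bsub>BijGroup D\<^esub>}" by (auto simp: minimal_normal_def)
    note MN = hom_normal_contains_M[OF \<rho> N]
    show "transitive_on N D"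
      unfolding transitive_on_def
    proof (intro ballI)
      fix a b assume ab: "a \<in> D" "b \<in> D"
      obtain h k where hk: "h \<in> H" "k \<in> H" "a = v (h \<circ> y)" "b = v (k \<circ> y)" using ab D by auto
      have "k \<circ> pinv h \<in> H" using hk H'(3,4) by blast
      then obtain m where m: "m \<in> M" "v ((k \<circ> pinv h) \<circ> (h \<circ> y)) = v (m \<circ> (h \<circ> y))"
        using M_transitive[of "h \<circ> y" "k \<circ> pinv h"] hk y by auto
      have "v ((k \<circ> pinv h) \<circ> (h \<circ> y)) = b" using hk y by (simp add: comp_assoc pinv_cancel)
      then have "\<rho> m a = b" using m hk y ab by (simp add: \<rho>_def act_v)
      then show "\<exists>n\<in>N. n a = b" using MN m by blast
    qed
  qed
  then show ?thesis by (simp add: ind[unfolded D_def] D_def)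
qed

lemma act_H_hom: "perm_hom (BijGroup V) \<Omega> H act"
  using H_group act_Bij act_mult
  by (intro perm_hom.intro perm_hom_axioms.intro group_BijGroup) (auto simp: BijGroup_def)

lemma act_M_nontrivial: "act ` M \<noteq> {\<one>\<^bsub>BijGroup V\<^esub>}"
proof
  assume triv: "act ` M = {\<one>\<^bsub>BijGroup V\<^esub>}"
  obtain i where i: "i \<in> I" using I_ne by blast
  obtain s a where s: "s \<in> alt (B i)" "a \<in> \<Delta>" "s a \<notin> \<Delta>" using alt_moves_\<Delta>[OF i] by metis
  have sM: "s \<in> M" using s alt_M[OF i] by blast
  then have "act s = act id" using triv act.f_id by auto
  then have "s = id" using act_inj sM by (auto dest: inj_onD)
  then show False using s by auto
qed

lemma minimal_M: "minimal_normal (act ` M) (BijGroup V\<lparr>carrier := act ` H\<rparr>)"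
  and unique_M: "minimal_normal N (BijGroup V\<lparr>carrier := act ` H\<rparr>) \<Longrightarrow> N = act ` M"
proof -
  interpret h: perm_hom "BijGroup V" \<Omega> H act by (rule act_H_hom)
  have norm: "act ` M \<lhd> BijGroup V\<lparr>carrier := act ` H\<rparr>"
    using M_conj H_BP by (intro h.image_normal[OF M_group M_H]) blast
  have cont: "act ` M \<subseteq> N" if "N \<lhd> BijGroup V\<lparr>carrier := act ` H\<rparr>" "N \<noteq> {\<one>\<^bsub>BijGroup V\<^esub>}" for N
    using hom_normal_contains_M[OF act_H_hom that] by auto
  show "minimal_normal (act ` M) (BijGroup V\<lparr>carrier := act ` H\<rparr>)"
    unfolding minimal_normal_def using norm act_M_nontrivial cont by auto
  show "N = act ` M" if "minimal_normal N (BijGroup V\<lparr>carrier := act ` H\<rparr>)"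
  proof -
    have "N \<lhd> BijGroup V\<lparr>carrier := act ` H\<rparr>" "N \<noteq> {\<one>\<^bsub>BijGroup V\<^esub>}"
      and K: "\<And>K. K \<lhd> BijGroup V\<lparr>carrier := act ` H\<rparr> \<Longrightarrow> K \<subseteq> N \<Longrightarrow> K = {\<one>\<^bsub>BijGroup V\<^esub>} \<or> K = N"
      using that by (simp_all add: minimal_normal_def)
    then show ?thesis using K[OF norm cont] act_M_nontrivial by blast
  qed
qed

section \<open>The direct decomposition and the projections of vertex stabilizers\<close>

lemma assemble:
  assumes P: "\<And>j. j \<in> I \<Longrightarrow> P j \<in> alt (B j)"
  obtains m where "m \<in> M" "\<And>j. j \<in> I \<Longrightarrow> restrict_id m (B j) = P j"
proof -
  define m where "m a = (if a \<in> \<Omega> then P (blk a) a else a)" for a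
  have Pp: "P j permutes B j" if "j \<in> I" for j using P[OF that] by (simp add: alt_def)
  have mB: "m a \<in> B (blk a)" if "a \<in> \<Omega>" for a
  proof -
    have "blk a \<in> I" "a \<in> B (blk a)" using that by (auto simp: I_def B_def)
    then show ?thesis using permutes_in_image[OF Pp] that by (simp add: m_def)
  qed
  have restr: "restrict_id m (B j) = P j" if j: "j \<in> I" for j
  proof
    fix a show "restrict_id m (B j) a = P j a"
      using permutes_not_in[OF Pp[OF j], of a] by (auto simp: restrict_id_def m_def B_def)
  qed
  have inj: "inj_on m \<Omega>"
  proof (rule inj_onI)
    fix a b assume ab: "a \<in> \<Omega>" "b \<in> \<Omega>" "m a = m b"
    then have "blk a = blk b" using mB[of a] mB[of b] by (simp add: B_def)
    then have "P (blk a) a = P (blk a) b" using ab by (simp add: m_def)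
    moreover have "blk a \<in> I" using ab by (simp add: I_def)
    ultimately show "a = b" using permutes_inj[OF Pp] by (auto dest: injD)
  qed
  have "m permutes \<Omega>"
    by (rule inj_imp_permutes[OF inj fin]) (use mB B_sub in \<open>auto simp: m_def\<close>)
  then have "m \<in> M"
    using mB restr P by (intro M_I) (auto simp: B_def)
  then show ?thesis using that restr by blast
qed

lemma M_eqI:
  assumes "m \<in> M" "m' \<in> M" "\<And>i. i \<in> I \<Longrightarrow> restrict_id m (B i) = restrict_id m' (B i)"
  shows "m = m'"
proof
  fix a
  show "m a = m' a"
  proof (cases "a \<in> \<Omega>")
    case True
    then have "blk a \<in> I" "a \<in> B (blk a)" by (auto simp: I_def B_def)
    then have "restrict_id m (B (blk a)) a = restrict_id m' (B (blk a)) a" using assms(3) by metis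
    then show ?thesis using \<open>a \<in> B (blk a)\<close> by (simp add: restrict_id_def)
  qed (use permutes_not_in M_D(1) assms in metis)
qed

text \<open>The stabilizer of \<open>v x\<close> in \<open>M\<close>, kept as permutations of
  \<open>\<Omega>\<close> until \<open>act\<close> is applied.\<close>

definition Mx where "Mx x = {m \<in> M. pinv x \<circ> m \<circ> x \<in> L}"
definition Rp where "Rp x i = (\<lambda>m. restrict_id m (B i)) ` Mx x"

context
  fixes x assumes x: "x \<in> G"
begin

lemma x_simps: "bij x" "x \<in> BP" "x permutes \<Omega>"
  using x G_BP G'(1) by auto

lemma Mx_group: "perm_group \<Omega> (Mx x)"
proof (rule perm_groupI)
  show "p permutes \<Omega>" if "p \<in> Mx x" for p using that M'(1) by (simp add: Mx_def)
  show "id \<in> Mx x" using M'(2) L'(2) x_simps by (simp add: Mx_def pinv_cancel)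
  show "p \<circ> q \<in> Mx x" if pq: "p \<in> Mx x" "q \<in> Mx x" for p q
  proof -
    have "pinv x \<circ> (p \<circ> q) \<circ> x = (pinv x \<circ> p \<circ> x) \<circ> (pinv x \<circ> q \<circ> x)"
      using x_simps by (simp add: comp_assoc pinv_cancel)
    then show ?thesis using pq L'(3) M'(3) by (simp add: Mx_def)
  qed
  show "pinv p \<in> Mx x" if p: "p \<in> Mx x" for p
  proof -
    have "pinv (pinv x \<circ> p \<circ> x) = pinv x \<circ> pinv p \<circ> x"
      using x_simps p by (simp add: comp_assoc pinv_cancel pinv_comp bij_comp Mx_def)
    then show ?thesis using p L'(4)[of "pinv x \<circ> p \<circ> x"] M'(4) by (simp add: Mx_def)
  qed
qed

lemma Mx_M: "Mx x \<subseteq> M"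
  by (auto simp: Mx_def)

lemma Rp_alt: "i \<in> I \<Longrightarrow> Rp x i \<subseteq> alt (B i)"
  using M_restrict by (auto simp: Rp_def Mx_def)

lemma Rp_group:
  assumes i: "i \<in> I" shows "perm_group (B i) (Rp x i)"
proof (rule perm_groupI)
  show "p permutes B i" if "p \<in> Rp x i" for p using that Rp_alt[OF i] by (auto simp: alt_def)
  have "restrict_id id (B i) = id" by (auto simp: restrict_id_def fun_eq_iff)
  then show "id \<in> Rp x i" using perm_groupD(2)[OF Mx_group] unfolding Rp_def by (metis imageI)
  fix p assume "p \<in> Rp x i"
  then obtain m where m: "m \<in> Mx x" "p = restrict_id m (B i)" by (auto simp: Rp_def)
  have "pinv p = restrict_id (pinv m) (B i)" using m M_hom(2)[of m m] Mx_M by auto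
  then show "pinv p \<in> Rp x i" using perm_groupD(4)[OF Mx_group m(1)] unfolding Rp_def by (metis imageI)
  fix q assume "q \<in> Rp x i"
  then obtain k where k: "k \<in> Mx x" "q = restrict_id k (B i)" by (auto simp: Rp_def)
  have "p \<circ> q = restrict_id (m \<circ> k) (B i)"
    unfolding m(2) k(2) using m(1) k(1) Mx_M by (intro M_hom(1)[symmetric]) auto
  then show "p \<circ> q \<in> Rp x i" using perm_groupD(3)[OF Mx_group m(1) k(1)] unfolding Rp_def by (metis imageI)
qed

lemma conj_E_Mx: "e \<in> E \<Longrightarrow> x \<circ> e \<circ> pinv x \<in> Mx x"
proof -
  assume e: "e \<in> E"
  have "x \<circ> e \<circ> pinv x \<in> M" using M_conj[OF x_simps(2)] e E_M by blast
  moreover have "pinv x \<circ> (x \<circ> e \<circ> pinv x) \<circ> x = e" using x_simps by (simp add: comp_assoc pinv_cancel)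
  ultimately show ?thesis using e E_L by (auto simp: Mx_def)
qed

lemma conj_id: "x \<circ> p \<circ> pinv x = id \<longleftrightarrow> p = id"
proof
  assume "x \<circ> p \<circ> pinv x = id"
  then have "pinv x \<circ> (x \<circ> p \<circ> pinv x) \<circ> x = id" using x_simps by (simp add: pinv_cancel)
  then show "p = id" using x_simps by (simp add: comp_assoc pinv_cancel)
qed (use x_simps in \<open>simp add: pinv_cancel\<close>)

lemma Rp_nontrivial: assumes i: "i \<in> I" shows "Rp x i \<noteq> {id}"
proof -
  obtain j where j: "j \<in> I" "x ` B j = B i" using BP_img'[OF x_simps(2) i] .
  obtain e where e: "e \<in> E" "restrict_id e (B j) \<noteq> id" using nontrivial_on_block[OF j(1)] .
  have "restrict_id (x \<circ> e \<circ> pinv x) (B i) = x \<circ> restrict_id e (B j) \<circ> pinv x"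
    using restrict_id_conj[OF x_simps(1), of e "B j"] j by simp
  then have "restrict_id (x \<circ> e \<circ> pinv x) (B i) \<noteq> id" using e conj_id by simp
  moreover have "restrict_id (x \<circ> e \<circ> pinv x) (B i) \<in> Rp x i"
    unfolding Rp_def using conj_E_Mx[OF e(1)] by (rule imageI)
  ultimately show ?thesis by auto
qed

text \<open>The stabilizer is conjugate by \<open>x\<close> into \<open>L\<close>, which preserves
  \<open>\<Delta>\<close>; the full alternating group contains a conjugate of an element that does
  not.\<close>

lemma Rp_proper: assumes i: "i \<in> I" shows "Rp x i \<noteq> alt (B i)"
proof
  assume eq: "Rp x i = alt (B i)"
  obtain j where j: "j \<in> I" "x ` B j = B i" using BP_img'[OF x_simps(2) i] .
  obtain s a where s: "s \<in> alt (B j)" "a \<in> B j" "a \<in> \<Delta>" "s a \<notin> \<Delta>" using alt_moves_\<Delta>[OF j(1)] .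
  have "x \<circ> s \<circ> pinv x \<in> alt (B i)" using conj_alt[OF s(1) fin B_sub x_simps(3)] j by simp
  then obtain m where m: "m \<in> Mx x" "x \<circ> s \<circ> pinv x = restrict_id m (B i)" using eq by (auto simp: Rp_def)
  have "x a \<in> B i" using j s by auto
  then have "(x \<circ> s \<circ> pinv x) (x a) = m (x a)" unfolding m(2) by (simp add: restrict_id_def)
  then have "x (s a) = m (x a)" using x_simps by (simp add: pinv_cancel)
  then have "(pinv x \<circ> m \<circ> x) a = s a" using x_simps by (simp add: pinv_cancel flip: \<open>x (s a) = m (x a)\<close>)
  moreover have "pinv x \<circ> m \<circ> x \<in> L" using m by (simp add: Mx_def)
  ultimately show False using L_\<Delta>[of "pinv x \<circ> m \<circ> x" a] s B_sub by auto
qed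

text \<open>The condition on \<open>u\<close> says that \<open>u\<close> fixes \<open>v x\<close>.
  Conjugation by \<open>u\<close> therefore preserves the stabilizer of \<open>v x\<close> in
  \<open>M\<close> and only relabels the blocks.\<close>

lemma Rp_conj_subset:
  assumes u: "u \<in> G" "pinv x \<circ> u \<circ> x \<in> L" "u ` B i = B j" and p: "p \<in> Rp x i"
  shows "u \<circ> p \<circ> pinv u \<in> Rp x j"
proof -
  obtain m where m: "m \<in> Mx x" "p = restrict_id m (B i)" using p by (auto simp: Rp_def)
  have "u \<circ> m \<circ> pinv u \<in> M" using m u G_BP Mx_M by (intro M_conj) auto
  moreover have "pinv x \<circ> (u \<circ> m \<circ> pinv u) \<circ> x = (pinv x \<circ> u \<circ> x) \<circ> (pinv x \<circ> m \<circ> x) \<circ> pinv (pinv x \<circ> u \<circ> x)"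
    using u x_simps by (simp add: comp_assoc pinv_cancel pinv_comp bij_comp)
  moreover have "(pinv x \<circ> u \<circ> x) \<circ> (pinv x \<circ> m \<circ> x) \<circ> pinv (pinv x \<circ> u \<circ> x) \<in> L"
    using m by (intro L'(3)[OF L'(3)[OF u(2)] L'(4)[OF u(2)]]) (simp add: Mx_def)
  ultimately have "u \<circ> m \<circ> pinv u \<in> Mx x" unfolding Mx_def by simp
  moreover have "u \<circ> p \<circ> pinv u = restrict_id (u \<circ> m \<circ> pinv u) (B j)"
    using restrict_id_conj[of u m "B i"] u m by simp
  ultimately show ?thesis unfolding Rp_def by (metis imageI)
qed

text \<open>Conjugates of elements of \<open>C\<close> by \<open>x\<close> fix \<open>v x\<close>
  and still permute the blocks transitively. They provide the isomorphisms between the factors as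
  well as between the projections.\<close>

lemma block_mover:
  assumes "i \<in> I" "j \<in> I"
  obtains u where "u \<in> G" "pinv x \<circ> u \<circ> x \<in> L" "u ` B i = B j"
proof -
  obtain i0 where i0: "i0 \<in> I" "x ` B i0 = B i" using BP_img'[OF x_simps(2) assms(1)] .
  obtain j0 where j0: "j0 \<in> I" "x ` B j0 = B j" using BP_img'[OF x_simps(2) assms(2)] .
  obtain a where a: "a \<in> \<Omega>" "i0 = blk a" using i0 by (auto simp: I_def)
  obtain b where b: "b \<in> \<Omega>" "j0 = blk b" using j0 by (auto simp: I_def)
  obtain c where c: "c \<in> C" "blk (c a) = blk b" using C_trans a b by blast
  have im: "c ` B i0 = B j0" using BP_image[of c a] c C_BP a b by auto
  have xi: "pinv x ` B i = B i0" unfolding i0(2)[symmetric] using x_simps by (simp add: bij_is_inj)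
  have "(x \<circ> c \<circ> pinv x) ` B i = x ` c ` pinv x ` B i" by (simp add: image_comp comp_assoc)
  then have "(x \<circ> c \<circ> pinv x) ` B i = B j" unfolding xi im j0(2) .
  moreover have "pinv x \<circ> (x \<circ> c \<circ> pinv x) \<circ> x \<in> L"
    using c C_L x_simps by (auto simp: comp_assoc pinv_cancel simp del: comp_apply)
  ultimately show ?thesis using that[of "x \<circ> c \<circ> pinv x"] c x by simp
qed

lemma block_mover_inv:
  assumes "u \<in> G" "pinv x \<circ> u \<circ> x \<in> L" "u ` B i = B j"
  shows "pinv u \<in> G" "pinv x \<circ> pinv u \<circ> x \<in> L" "pinv u ` B j = B i"
proof -
  show "pinv u \<in> G" using assms by simp
  have "pinv (pinv x \<circ> u \<circ> x) = pinv x \<circ> pinv u \<circ> x"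
    using assms x_simps by (simp add: comp_assoc pinv_cancel pinv_comp bij_comp)
  then show "pinv x \<circ> pinv u \<circ> x \<in> L" using L'(4)[OF assms(2)] by simp
  show "pinv u ` B j = B i" unfolding assms(3)[symmetric] using assms(1) by (simp add: bij_is_inj)
qed

lemma conj_image_eq:
  assumes "bij u" "\<And>p. p \<in> P \<Longrightarrow> u \<circ> p \<circ> pinv u \<in> P'" "\<And>p. p \<in> P' \<Longrightarrow> pinv u \<circ> p \<circ> pinv (pinv u) \<in> P"
  shows "(\<lambda>p. u \<circ> p \<circ> pinv u) ` P = P'"
proof
  show "(\<lambda>p. u \<circ> p \<circ> pinv u) ` P \<subseteq> P'" using assms(2) by auto
  show "P' \<subseteq> (\<lambda>p. u \<circ> p \<circ> pinv u) ` P"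
  proof
    fix p assume "p \<in> P'"
    then have "pinv u \<circ> p \<circ> pinv (pinv u) \<in> P" by (rule assms(3))
    moreover have "p = u \<circ> (pinv u \<circ> p \<circ> pinv (pinv u)) \<circ> pinv u"
      using assms(1) by (simp add: comp_assoc pinv_cancel)
    ultimately show "p \<in> (\<lambda>p. u \<circ> p \<circ> pinv u) ` P"
      using image_eqI[of p "\<lambda>p. u \<circ> p \<circ> pinv u" "pinv u \<circ> p \<circ> pinv (pinv u)" P] by metis
  qed
qed

lemma Rp_iso:
  assumes "i \<in> I" "j \<in> I"
  shows "BijGroup V\<lparr>carrier := act ` Rp x i\<rparr> \<cong> BijGroup V\<lparr>carrier := act ` Rp x j\<rparr>"
proof -
  obtain u where u: "u \<in> G" "pinv x \<circ> u \<circ> x \<in> L" "u ` B i = B j" using block_mover[OF assms] .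
  note u' = block_mover_inv[OF u]
  have im: "(\<lambda>p. u \<circ> p \<circ> pinv u) ` Rp x i = Rp x j"
    using Rp_conj_subset[OF u] Rp_conj_subset[OF u'] u by (intro conj_image_eq) auto
  show ?thesis
    using Rp_alt[OF assms(1)] alt_M[OF assms(1)] M_G
    by (intro act.conj_image_iso[OF u(1) Rp_group[OF assms(1)] _ im]) auto
qed

lemma alt_iso:
  assumes "i \<in> I" "j \<in> I"
  shows "BijGroup V\<lparr>carrier := act ` alt (B i)\<rparr> \<cong> BijGroup V\<lparr>carrier := act ` alt (B j)\<rparr>"
proof -
  obtain u where u: "u \<in> G" "pinv x \<circ> u \<circ> x \<in> L" "u ` B i = B j" using block_mover[OF assms] .
  note u' = block_mover_inv[OF u]
  have im: "(\<lambda>p. u \<circ> p \<circ> pinv u) ` alt (B i) = alt (B j)"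
    using conj_alt[OF _ fin B_sub G'(1)[OF u(1)], of _ i] conj_alt[OF _ fin B_sub G'(1)[OF u'(1)], of _ j] u u'
    by (intro conj_image_eq) auto
  show ?thesis
    using alt_M[OF assms(1)] M_G
    by (intro act.conj_image_iso[OF u(1) perm_group_alt[OF finB] _ im]) auto
qed

text \<open>By \<open>E_sep\<close> some translation is trivial on one block and not on another, and
  its conjugate by \<open>x\<close> lies in the stabilizer of \<open>v x\<close>. A single
  projection that fails to be injective excludes the diagonal type.\<close>

lemma Mx_not_inj:
  obtains i m where "i \<in> I" "m \<in> Mx x" "m \<noteq> id" "restrict_id m (B i) = id"
proof -
  obtain k where k: "k \<in> I" using I_ne by blast
  obtain j where j: "j \<in> I" "j \<noteq> k" using I_two[OF k] by blast
  obtain e where e: "e \<in> E" "restrict_id e (B j) = id" "restrict_id e (B k) \<noteq> id"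
    using E_sep_B[OF k j(1)] j by metis
  have "e \<noteq> id"
  proof
    assume "e = id"
    then have "restrict_id e (B k) = id" by (auto simp: restrict_id_def fun_eq_iff)
    then show False using e by simp
  qed
  obtain i where i: "i \<in> I" "x ` B j = B i" using BP_img[OF x_simps(2) j(1)] .
  have "restrict_id (x \<circ> e \<circ> pinv x) (B i) = x \<circ> restrict_id e (B j) \<circ> pinv x"
    using restrict_id_conj[OF x_simps(1), of e "B j"] i by simp
  also have "\<dots> = id" using conj_id e(2) by blast
  finally show ?thesis using that[OF i(1) conj_E_Mx[OF e(1)]] conj_id \<open>e \<noteq> id\<close> by simp
qed

lemma carrier_upd:
  "R\<lparr>carrier := P\<rparr>\<lparr>carrier := Q\<rparr> = R\<lparr>carrier := Q\<rparr>" "\<one>\<^bsub>R\<lparr>carrier := P\<rparr>\<^esub> = \<one>\<^bsub>R\<^esub>"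
  for R :: "('c, 'd) monoid_scheme"
  by simp_all

lemma PA_type_edge: "PA_type False V Ed (act ` G) (v x) (v (x \<circ> t))"
proof -
  let ?B = "BijGroup V"
  define n where "n = card I"
  \<comment> \<open>Factors are to be indexed by an initial segment of the natural numbers, so the
    blocks are numbered arbitrarily.\<close>
  obtain \<iota> where \<iota>: "bij_betw \<iota> {..<n} I"
    using ex_bij_betw_nat_finite[OF finI] by (auto simp: n_def atLeast0LessThan)
  have \<iota>I: "\<iota> i \<in> I" if "i < n" for i using \<iota> that by (auto simp: bij_betw_def)
  have \<iota>_eq: "\<iota> i = \<iota> j \<longleftrightarrow> i = j" if "i < n" "j < n" for i j
    using \<iota> that by (auto simp: bij_betw_def inj_on_def)
  \<comment> \<open>Coordinate maps take elements of the image group; faithfulness of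
    \<open>act\<close> allows the permutation of \<open>\<Omega>\<close> to be recovered
    first.\<close>
  define ai where "ai = inv_into G act"
  have ai: "ai (act g) = g" if "g \<in> G" for g using act_inj that by (simp add: ai_def)
  define T where "T i = act ` alt (B (\<iota> i))" for i
  define pr where "pr i y = act (restrict_id (ai y) (B (\<iota> i)))" for i y
  define R where "R i = act ` Rp x (\<iota> i)" for i
  have pr: "pr i (act m) = act (restrict_id m (B (\<iota> i)))" if "m \<in> M" for i m
    using that ai by (simp add: pr_def)
  have restr_G: "restrict_id m (B (\<iota> i)) \<in> alt (B (\<iota> i))" "restrict_id m (B (\<iota> i)) \<in> G" if "m \<in> M" "i < n" for i m
    using M_restrict[OF that(1) \<iota>I[OF that(2)]] alt_M[OF \<iota>I[OF that(2)]] by auto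
  have pr_mult: "pr i (act m \<otimes>\<^bsub>?B\<^esub> act k) = pr i (act m) \<otimes>\<^bsub>?B\<^esub> pr i (act k)" if "m \<in> M" "k \<in> M" "i < n" for i m k
  proof -
    have "act m \<otimes>\<^bsub>?B\<^esub> act k = act (m \<circ> k)" using act_mult that by simp
    then show ?thesis using that pr[of "m \<circ> k" i] pr[of m i] pr[of k i] M'(3) M_hom(1)[of m k] restr_G act_mult by simp
  qed
  have actM: "subgroup (act ` M) ?B" using act.image_subgroup[OF M_group M_G] .
  have Tsub: "T i \<subseteq> act ` M" if "i < n" for i using alt_M[OF \<iota>I[OF that]] by (auto simp: T_def)
  have Tsg: "subgroup (T i) ?B" if "i < n" for i
    unfolding T_def using alt_M[OF \<iota>I[OF that]] M_G
    by (intro act.image_subgroup[OF perm_group_alt[OF finB]]) auto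
  have d1: "n \<ge> 2" using card_I by (simp add: n_def)
  have d2: "\<forall>i<n. subgroup (T i) (?B\<lparr>carrier := act ` M\<rparr>) \<and> nonabelian_simple (?B\<lparr>carrier := T i\<rparr>)"
  proof (intro allI impI conjI)
    fix i assume i: "i < n"
    show "subgroup (T i) (?B\<lparr>carrier := act ` M\<rparr>)"
      by (rule act.subgroup_incl[OF Tsg[OF i] actM Tsub[OF i]])
    show "nonabelian_simple (?B\<lparr>carrier := T i\<rparr>)"
      unfolding T_def using alt_M[OF \<iota>I[OF i]] M_G
      by (intro act.nonabelian_simple_alt_image finB card_B[OF \<iota>I[OF i]] act_inj) auto
  qed
  have d3: "\<forall>i<n. \<forall>j<n. ?B\<lparr>carrier := T i\<rparr> \<cong> ?B\<lparr>carrier := T j\<rparr>"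
    using alt_iso \<iota>I by (simp add: T_def)
  have d4: "\<forall>i<n. pr i \<in> hom (?B\<lparr>carrier := act ` M\<rparr>) (?B\<lparr>carrier := T i\<rparr>)"
    using pr restr_G pr_mult by (auto simp: hom_def T_def)
  have d5: "(\<lambda>y. \<lambda>i\<in>{..<n}. pr i y) \<in>
      iso (?B\<lparr>carrier := act ` M\<rparr>) (product_group {..<n} (\<lambda>i. ?B\<lparr>carrier := T i\<rparr>))"
  proof -
    let ?\<Phi> = "\<lambda>y. \<lambda>i\<in>{..<n}. pr i y"
    have prT: "pr i (act m) \<in> T i" if "m \<in> M" "i < n" for m i
      using that pr restr_G by (simp add: T_def)
    then have car: "?\<Phi> (act m) \<in> (\<Pi>\<^sub>E i\<in>{..<n}. T i)" if "m \<in> M" for m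
      using that by auto
    have "?\<Phi> \<in> hom (?B\<lparr>carrier := act ` M\<rparr>) (product_group {..<n} (\<lambda>i. ?B\<lparr>carrier := T i\<rparr>))"
      using prT pr_mult by (auto simp: hom_def product_group_def intro!: restrict_ext)
    moreover have "inj_on ?\<Phi> (act ` M)"
    proof (rule inj_onI)
      fix a b assume ab: "a \<in> act ` M" "b \<in> act ` M" "?\<Phi> a = ?\<Phi> b"
      obtain m k where mk: "m \<in> M" "k \<in> M" "a = act m" "b = act k" using ab by auto
      have "restrict_id m (B i) = restrict_id k (B i)" if i: "i \<in> I" for i
      proof -
        obtain i' where i': "i' < n" "i = \<iota> i'" using \<iota> i by (auto simp: bij_betw_def)
        have "?\<Phi> a i' = ?\<Phi> b i'" using ab by simp
        then have "act (restrict_id m (B i)) = act (restrict_id k (B i))" using mk i' pr by simp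
        then show ?thesis using act_inj restr_G mk i' by (auto dest: inj_onD)
      qed
      then show "a = b" using M_eqI mk by metis
    qed
    moreover have "?\<Phi> ` act ` M = (\<Pi>\<^sub>E i\<in>{..<n}. T i)"
    proof
      show "?\<Phi> ` act ` M \<subseteq> (\<Pi>\<^sub>E i\<in>{..<n}. T i)" using car by blast
      show "(\<Pi>\<^sub>E i\<in>{..<n}. T i) \<subseteq> ?\<Phi> ` act ` M"
      proof
        fix y assume y: "y \<in> (\<Pi>\<^sub>E i\<in>{..<n}. T i)"
        \<comment> \<open>The component of \<open>y\<close> belonging to block \<open>j\<close>,
          pulled back to a permutation; \<open>assemble\<close> glues these into one element of
          \<open>M\<close>.\<close>
        define P where "P j = ai (y (inv_into {..<n} \<iota> j))" for j
        have inv\<iota>: "inv_into {..<n} \<iota> (\<iota> i) = i" if "i < n" for i using \<iota> that by (simp add: bij_betw_def)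
        have P: "P (\<iota> i) \<in> alt (B (\<iota> i)) \<and> act (P (\<iota> i)) = y i" if i: "i < n" for i
        proof -
          have "y i \<in> T i" using y i by auto
          then obtain p where p: "p \<in> alt (B (\<iota> i))" "y i = act p" by (auto simp: T_def)
          have "p \<in> G" using p alt_M[OF \<iota>I[OF i]] by auto
          then show ?thesis using p ai inv\<iota>[OF i] by (simp add: P_def)
        qed
        have "P j \<in> alt (B j)" if j: "j \<in> I" for j
        proof -
          obtain i where "i < n" "j = \<iota> i" using \<iota> j by (auto simp: bij_betw_def)
          then show ?thesis using P by simp
        qed
        then obtain m where m: "m \<in> M" "\<And>j. j \<in> I \<Longrightarrow> restrict_id m (B j) = P j" using assemble by metis
        have "?\<Phi> (act m) = y"
        proof
          fix i show "?\<Phi> (act m) i = y i"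
            using y pr[OF m(1)] m(2) P \<iota>I by (cases "i < n") (auto simp: PiE_def extensional_def)
        qed
        then show "y \<in> ?\<Phi> ` act ` M" using m by blast
      qed
    qed
    ultimately show ?thesis by (simp add: iso_def bij_betw_def product_group_def)
  qed
  have d6: "\<forall>i<n. \<forall>j<n. \<forall>y\<in>T j. pr i y = (if i = j then y else \<one>\<^bsub>?B\<^esub>)"
  proof (intro allI impI ballI)
    fix i j y assume ij: "i < n" "j < n" and "y \<in> T j"
    then obtain p where p: "p \<in> alt (B (\<iota> j))" "y = act p" by (auto simp: T_def)
    have pM: "p \<in> M" using p alt_M[OF \<iota>I[OF ij(2)]] by auto
    have pp: "p permutes B (\<iota> j)" using p by (simp add: alt_def)
    show "pr i y = (if i = j then y else \<one>\<^bsub>?B\<^esub>)"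
    proof (cases "i = j")
      case True
      have "restrict_id p (B (\<iota> j)) = p" using permutes_not_in[OF pp] by (auto simp: restrict_id_def fun_eq_iff)
      then show ?thesis using True pr[OF pM] p by simp
    next
      case False
      then have ne: "\<iota> i \<noteq> \<iota> j" using \<iota>_eq ij by simp
      have "p a = a" if "a \<in> B (\<iota> i)" for a
        using that ne permutes_not_in[OF pp, of a] by (auto simp: B_def)
      then have "restrict_id p (B (\<iota> i)) = id" by (auto simp: restrict_id_def fun_eq_iff)
      then show ?thesis using False pr[OF pM] p act.f_id by simp
    qed
  qed
  have stabM: "stab (act ` M) (v x) = act ` Mx x"
    using stab_act[OF x M_G] by (simp add: Mx_def)
  have d10: "\<forall>i<n. pr i ` stab (act ` M) (v x) = R i"
    unfolding stabM R_def Rp_def image_image using pr Mx_M by (intro allI impI image_cong) auto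
  have d7: "\<forall>i<n. subgroup (R i) (?B\<lparr>carrier := T i\<rparr>) \<and> R i \<noteq> {\<one>\<^bsub>?B\<^esub>} \<and> R i \<noteq> T i"
  proof (intro allI impI conjI)
    fix i assume i: "i < n"
    have RG: "Rp x (\<iota> i) \<subseteq> G" "alt (B (\<iota> i)) \<subseteq> G" using Rp_alt[OF \<iota>I[OF i]] alt_M[OF \<iota>I[OF i]] M_G by auto
    have "subgroup (R i) ?B" unfolding R_def by (rule act.image_subgroup[OF Rp_group[OF \<iota>I[OF i]] RG(1)])
    then show "subgroup (R i) (?B\<lparr>carrier := T i\<rparr>)"
      using Rp_alt[OF \<iota>I[OF i]] Tsg[OF i] by (intro act.subgroup_incl) (auto simp: R_def T_def)
    show "R i \<noteq> {\<one>\<^bsub>?B\<^esub>}"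
    proof
      assume "R i = {\<one>\<^bsub>?B\<^esub>}"
      then have "act ` Rp x (\<iota> i) = act ` {id}" using act.f_id by (simp add: R_def)
      then have "Rp x (\<iota> i) = {id}" using inj_on_image_eq_iff[OF act_inj RG(1), of "{id}"] by simp
      then show False using Rp_nontrivial[OF \<iota>I[OF i]] by simp
    qed
    show "R i \<noteq> T i"
      using inj_on_image_eq_iff[OF act_inj RG] Rp_proper[OF \<iota>I[OF i]] by (simp add: R_def T_def)
  qed
  have d8: "\<forall>i<n. \<forall>j<n. ?B\<lparr>carrier := R i\<rparr> \<cong> ?B\<lparr>carrier := R j\<rparr>"
    using Rp_iso \<iota>I by (simp add: R_def)
  have d11: "False \<longleftrightarrow> (\<forall>i<n. inj_on (pr i) (stab (act ` M) (v x)))"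
  proof -
    obtain i m where m: "i \<in> I" "m \<in> Mx x" "m \<noteq> id" "restrict_id m (B i) = id" using Mx_not_inj .
    obtain i' where i': "i' < n" "i = \<iota> i'" using \<iota> m(1) by (auto simp: bij_betw_def)
    have mM: "m \<in> M" "id \<in> M" "id \<in> Mx x" using m Mx_M M'(2) perm_groupD(2)[OF Mx_group] by auto
    have "restrict_id id (B i) = id" by (auto simp: restrict_id_def fun_eq_iff)
    then have "pr i' (act m) = pr i' (act id)" using pr[OF mM(1)] pr[OF mM(2)] m i' by simp
    moreover have "act m \<noteq> act id" using act_inj m(3) mM by (auto dest: inj_onD)
    ultimately have "\<not> inj_on (pr i') (stab (act ` M) (v x))"
      using m mM unfolding stabM by (auto dest: inj_onD)
    then show ?thesis using i' by blast
  qed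
  have d9: "\<forall>y\<in>stab (act ` M) (v x). \<forall>i<n. pr i y \<in> R i" using d10 by blast
  have dec: "\<exists>n T pr. n \<ge> (2::nat) \<and>
         (\<forall>i<n. subgroup (T i) (?B\<lparr>carrier := act ` M\<rparr>) \<and> nonabelian_simple (?B\<lparr>carrier := T i\<rparr>)) \<and>
         (\<forall>i<n. \<forall>j<n. ?B\<lparr>carrier := T i\<rparr> \<cong> ?B\<lparr>carrier := T j\<rparr>) \<and>
         (\<forall>i<n. pr i \<in> hom (?B\<lparr>carrier := act ` M\<rparr>) (?B\<lparr>carrier := T i\<rparr>)) \<and>
         (\<lambda>x. \<lambda>i\<in>{..<n}. pr i x) \<in> iso (?B\<lparr>carrier := act ` M\<rparr>) (product_group {..<n} (\<lambda>i. ?B\<lparr>carrier := T i\<rparr>)) \<and>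
         (\<forall>i<n. \<forall>j<n. \<forall>x\<in>T j. pr i x = (if i = j then x else \<one>\<^bsub>?B\<^esub>)) \<and>
         (\<exists>R. (\<forall>i<n. subgroup (R i) (?B\<lparr>carrier := T i\<rparr>) \<and> R i \<noteq> {\<one>\<^bsub>?B\<^esub>} \<and> R i \<noteq> T i) \<and>
              (\<forall>i<n. \<forall>j<n. ?B\<lparr>carrier := R i\<rparr> \<cong> ?B\<lparr>carrier := R j\<rparr>) \<and>
              (\<forall>y\<in>stab (act ` M) (v x). \<forall>i<n. pr i y \<in> R i) \<and>
              (\<forall>i<n. pr i ` stab (act ` M) (v x) = R i) \<and>
              (False \<longleftrightarrow> (\<forall>i<n. inj_on (pr i) (stab (act ` M) (v x)))))"
    by (rule exI[of _ n], rule exI[of _ T], rule exI[of _ pr])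
      (intro conjI d1 d2 d3 d4 d5 d6 exI[of _ R] d7 d8 d9 d10 d11)
  show ?thesis
    unfolding PA_type_def Let_def Gstar_eq[OF x] carrier_upd
    using quasiprimitive_orbit minimal_M unique_M dec
    by (intro conjI exI[of _ "act ` M"] ballI allI impI)
qed

end

text \<open>The type is demanded at every edge; each edge has the form
  \<open>(v x, v (x \<circ> t))\<close>, and \<open>PA_type_edge\<close> is uniform in
  \<open>x\<close>.\<close>

lemma coset_graph:
  "simple_graph V Ed \<and> connected_graph V Ed \<and> has_valency V Ed (card E) \<and> aut_subgroup V Ed (act ` G) \<and>
   two_arc_transitive Ed (act ` G) \<and> two_arc_PA_type False V Ed (act ` G)"
  using graph_Ed connected_Ed valency_Ed aut_Ed two_arc_trans_Ed PA_type_edge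
  by (auto simp: two_arc_PA_type_def Ed_def)

end

section \<open>Elementary abelian groups\<close>

lemma permutesI:
  assumes "\<And>x. x \<notin> S \<Longrightarrow> p x = x" "p \<circ> q = id" "q \<circ> p = id"
  shows "p permutes S"
proof -
  have "bij p" using assms(2,3) o_bij by blast
  then show ?thesis using assms(1) unfolding permutes_def by (metis bij_pointE)
qed

text \<open>The permutation is a product of \<open>card S div 2\<close> disjoint transpositions,
  stripped off one by one. Evenness of \<open>card S\<close> is carried along because only then does
  adding 2 toggle divisibility by 4.\<close>

lemma even_fixpoint_free_involution:
  assumes "finite S" "p permutes S" "p \<circ> p = id" "\<And>x. x \<in> S \<Longrightarrow> p x \<noteq> x"
  shows "even (card S) \<and> (evenperm p \<longleftrightarrow> 4 dvd card S)"
  using assms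
proof (induction "card S" arbitrary: S p rule: less_induct)
  case less
  show ?case
  proof (cases "S = {}")
    case True
    then show ?thesis using less by simp
  next
    case False
    then obtain x where x: "x \<in> S" by auto
    let ?y = "p x"
    have pp: "p (p z) = z" for z using less(4) by (metis comp_apply id_apply)
    have y: "?y \<in> S" "?y \<noteq> x" using x less permutes_in_image by fastforce+
    define S' where "S' = S - {x, ?y}"
    define q where "q = transpose x ?y \<circ> p"
    have q_eq: "q z = (if z \<in> S' then p z else z)" for z
    proof (cases "z = x \<or> z = ?y")
      case True
      then show ?thesis using pp by (auto simp: q_def S'_def)
    next
      case False
      then have "p z \<noteq> x" "p z \<noteq> ?y" using pp by metis+
      then have "q z = p z" by (simp add: q_def)
      moreover have "p z = z" if "z \<notin> S" using less(3) that permutes_not_in by metis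
      ultimately show ?thesis using False by (auto simp: S'_def)
    qed
    have pS': "p z \<in> S'" if "z \<in> S'" for z
      using that pp permutes_in_image[OF less(3)] by (auto simp: S'_def) metis
    have qq: "q \<circ> q = id" using pS' pp by (auto simp: fun_eq_iff q_eq)
    have q: "q permutes S'" by (rule permutesI[OF _ qq qq]) (simp add: q_eq)
    have card: "card S = card S' + 2"
    proof -
      have "card {x, ?y} = 2" using y by auto
      moreover have "card S' = card S - card {x, ?y}" unfolding S'_def using x y by (intro card_Diff_subset) auto
      moreover have "card {x, ?y} \<le> card S" using x y less(2) by (intro card_mono) auto
      ultimately show ?thesis by simp
    qed
    have IH: "even (card S') \<and> (evenperm q \<longleftrightarrow> 4 dvd card S')"
    proof (rule less(1)[OF _ _ q qq])
      show "q z \<noteq> z" if "z \<in> S'" for z using that less(5) by (auto simp: q_eq S'_def)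
    qed (use card less(2) in \<open>auto simp: S'_def\<close>)
    have perm: "permutation p" using permutes_imp_permutation less by blast
    have "evenperm q \<longleftrightarrow> \<not> evenperm p"
      using y perm by (auto simp: q_def evenperm_comp evenperm_swap permutation_swap_id)
    moreover have "even (card S) \<and> (4 dvd card S \<longleftrightarrow> \<not> 4 dvd card S')"
      using conjunct1[OF IH] card by presburger
    ultimately show ?thesis using IH by simp
  qed
qed

text \<open>\<open>p ^ (m - 1)\<close> is the number of cosets of a line. Its bound makes blocks
  have at least 5 points and excludes \<open>p = m = 2\<close>, where a translation could act on a
  block as a single transposition. The assumption \<open>aut_trans\<close> keeps coordinates out of
  the construction.\<close>

locale elementary_abelian = comm_group F for F (structure) +
  fixes p m :: nat
  assumes prime: "Factorial_Ring.prime p" and m2: "2 \<le> m" and card_F: "card (carrier F) = p ^ m"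
    and exponent: "\<And>x. x \<in> carrier F \<Longrightarrow> x [^] p = \<one>" and big: "3 \<le> p ^ (m - 1)"
    and aut_trans: "\<And>x y. x \<in> carrier F - {\<one>} \<Longrightarrow> y \<in> carrier F - {\<one>} \<Longrightarrow> \<exists>c\<in>iso F F. c x = y"
begin

section \<open>Lines, their cosets and the points\<close>

definition lines where "lines = {generate F {x} |x. x \<in> carrier F - {\<one>}}"

text \<open>The flag marks the second copy of a coset.\<close>

definition pts where "pts = {(l, K, b). l \<in> lines \<and> K \<in> rcosets l \<and> (b \<longrightarrow> K \<noteq> l)}"

definition \<tau> where "\<tau> e = (\<lambda>(l, K, b). if (l, K, b) \<in> pts \<and> \<not> b then (l, K #> e, b) else (l, K, b))"

definition \<gamma> where "\<gamma> c = (\<lambda>(l, K, b). if (l, K, b) \<in> pts then (c ` l, c ` K, b) else (l, K, b))"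

definition flip where "flip = (\<lambda>(l, K, b). if (l, K, b) \<in> pts \<and> K \<noteq> l then (l, K, \<not> b) else (l, K, b))"

lemma p_pos: "p > 1" using prime prime_gt_1_nat by blast

lemma fin_F: "finite (carrier F)"
  using card_F p_pos by (metis card.infinite power_eq_0_iff not_one_less_zero)

lemma line_subgroup: "l \<in> lines \<Longrightarrow> subgroup l F" and line_sub: "l \<in> lines \<Longrightarrow> l \<subseteq> carrier F"
proof -
  show "l \<in> lines \<Longrightarrow> subgroup l F" by (auto simp: lines_def intro!: generate_is_subgroup)
  then show "l \<in> lines \<Longrightarrow> l \<subseteq> carrier F" using subgroup.subset by auto
qed

lemma card_generate: "x \<in> carrier F - {\<one>} \<Longrightarrow> card (generate F {x}) = p"
proof -
  assume x: "x \<in> carrier F - {\<one>}"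
  have "ord x dvd p" using pow_eq_id[of x p] exponent x by auto
  moreover have "ord x \<noteq> 1" using ord_eq_1[of x] x by auto
  ultimately have "ord x = p" using prime by (auto simp: prime_nat_iff)
  then show ?thesis using generate_pow_card[of x] x by simp
qed

text \<open>By primality of the order any nontrivial element generates its line, so distinct lines
  meet trivially. This is what separates the blocks.\<close>

lemma line_eq:
  assumes "l \<in> lines" "e \<in> l" "e \<noteq> \<one>"
  shows "l = generate F {e}"
proof -
  have eF: "e \<in> carrier F - {\<one>}" using assms line_sub by auto
  have "card l = p" using assms card_generate by (auto simp: lines_def)
  moreover have "generate F {e} \<subseteq> l" using generate_subgroup_incl[OF _ line_subgroup[OF assms(1)], of "{e}"] assms by auto
  moreover have "finite l" using line_sub[OF assms(1)] fin_F finite_subset by auto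
  ultimately show ?thesis using card_subset_eq[of l "generate F {e}"] card_generate[OF eF] by simp
qed

lemma line_ex: "l \<in> lines \<Longrightarrow> \<exists>e\<in>l. e \<noteq> \<one>"
  by (auto simp: lines_def intro!: generate.incl bexI)

lemma line_card_rcosets:
  assumes "l \<in> lines" shows "card (rcosets l) = p ^ (m - 1)"
proof -
  have "card l = p" using assms card_generate by (auto simp: lines_def)
  moreover have "card (rcosets l) * card l = p ^ m"
    using lagrange[OF line_subgroup[OF assms]] card_F by (simp add: order_def mult.commute)
  moreover have "p ^ m = p ^ (m - 1) * p" using m2 by (cases m) auto
  ultimately show ?thesis using p_pos by simp
qed

lemma fin_lines: "finite lines"
  using fin_F line_sub by (intro finite_subset[of lines "Pow (carrier F)"]) auto

lemma rcos_sub: "l \<in> lines \<Longrightarrow> K \<in> rcosets l \<Longrightarrow> K \<subseteq> carrier F"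
  using rcosets_subset_PowG line_subgroup by auto

lemma self_rcos: "l \<in> lines \<Longrightarrow> l \<in> rcosets l"
  using subgroup.subgroup_in_rcosets[OF line_subgroup] is_group by auto

lemma rcosE:
  assumes "l \<in> lines" "K \<in> rcosets l" obtains a where "a \<in> carrier F" "K = l #> a"
  using assms by (auto simp: RCOSETS_def)

text \<open>By commutativity a translation fixes either all cosets of \<open>l\<close> or
  none.\<close>

lemma rcos_shift:
  assumes "l \<in> lines" "K \<in> rcosets l" "e \<in> carrier F"
  shows "K #> e \<in> rcosets l" "K #> e = K \<longleftrightarrow> e \<in> l"
proof -
  obtain a where a: "a \<in> carrier F" "K = l #> a" using rcosE assms by metis
  note ls = line_sub[OF assms(1)] and lg = line_subgroup[OF assms(1)]
  have Ke: "K #> e = l #> (a \<otimes> e)" using a assms ls coset_mult_assoc by simp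
  then show "K #> e \<in> rcosets l" using rcosetsI[OF ls] a assms by simp
  have "l #> (a \<otimes> e) = (l #> e) #> a" using a assms ls coset_mult_assoc[of l e a] m_comm[of a e] by simp
  moreover have "(l #> e) #> a = l #> a \<longleftrightarrow> l #> e = l"
  proof
    assume "l #> e #> a = l #> a"
    then have "l #> e #> a #> inv a = l #> a #> inv a" by simp
    then show "l #> e = l"
      using a assms ls r_coset_subset_G[OF ls] by (simp add: coset_mult_assoc m_assoc)
  qed simp
  moreover have "l #> e = l \<longleftrightarrow> e \<in> l" using coset_join1[OF _ assms(3) lg] coset_join2[OF assms(3) lg] by blast
  ultimately show "K #> e = K \<longleftrightarrow> e \<in> l" using Ke a by simp
qed

lemma rcos_shift_shift:
  assumes "l \<in> lines" "K \<in> rcosets l" "e \<in> carrier F" "e' \<in> carrier F"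
  shows "(K #> e) #> e' = K #> (e \<otimes> e')"
  using coset_mult_assoc rcos_sub assms by simp

section \<open>Translations, automorphisms and the flip as permutations of the points\<close>

lemma \<tau>_simps:
  "(l, K, False) \<in> pts \<Longrightarrow> \<tau> e (l, K, False) = (l, K #> e, False)"
  "\<tau> e (l, K, True) = (l, K, True)" "x \<notin> pts \<Longrightarrow> \<tau> e x = x"
  by (auto simp: \<tau>_def split: prod.splits)

lemma \<tau>_pts: "e \<in> carrier F \<Longrightarrow> x \<in> pts \<Longrightarrow> \<tau> e x \<in> pts"
  using rcos_shift(1) by (cases x) (simp add: \<tau>_def pts_def)

lemma \<tau>_comp:
  assumes "e \<in> carrier F" "e' \<in> carrier F" shows "\<tau> e \<circ> \<tau> e' = \<tau> (e \<otimes> e')"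
proof
  fix x :: "'a set \<times> 'a set \<times> bool"
  obtain l K b where x: "x = (l, K, b)" by (metis prod_cases3)
  show "(\<tau> e \<circ> \<tau> e') x = \<tau> (e \<otimes> e') x"
  proof (cases "x \<in> pts \<and> \<not> b")
    case True
    then have "(l, K, False) \<in> pts" using x by auto
    moreover from True have "\<tau> e' x = (l, K #> e', False)" "(l, K #> e', False) \<in> pts" "l \<in> lines" "K \<in> rcosets l"
      using \<tau>_pts[OF assms(2), of x] x by (auto simp: \<tau>_simps pts_def)
    ultimately show ?thesis
      using True x assms rcos_shift_shift[of l K e' e] m_comm[of e e'] by (simp add: \<tau>_simps)
  qed (use x in \<open>auto simp: \<tau>_def\<close>)
qed

lemma \<tau>_id: assumes "e \<in> carrier F" shows "\<tau> e = id \<longleftrightarrow> (\<forall>l\<in>lines. e \<in> l)"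
proof
  assume "\<tau> e = id"
  then have "\<tau> e (l, l, False) = (l, l, False)" for l by simp
  then have "l #> e = l" if "l \<in> lines" for l
    using that self_rcos \<tau>_simps(1)[of l l e] by (simp add: pts_def)
  then show "\<forall>l\<in>lines. e \<in> l" using coset_join1[OF _ assms line_subgroup] by auto
next
  assume "\<forall>l\<in>lines. e \<in> l"
  then show "\<tau> e = id" using rcos_shift(2)[OF _ _ assms] by (auto simp: fun_eq_iff \<tau>_def pts_def)
qed

text \<open>Both parts need a point off a given line, which exists because \<open>m \<ge> 2\<close>.
  The second part makes the translations act faithfully.\<close>

lemma two_lines: "2 \<le> card lines" and lines_cap: "e \<in> carrier F \<Longrightarrow> e \<noteq> \<one> \<Longrightarrow> \<exists>l\<in>lines. e \<notin> l"
proof -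
  have lt: "p < p ^ m" using p_pos m2 by (metis One_nat_def Suc_1 Suc_le_eq less_le_trans power_one_right power_strict_increasing_iff)
  have *: "\<exists>y\<in>carrier F - {\<one>}. y \<notin> generate F {x}" if x: "x \<in> carrier F - {\<one>}" for x
  proof -
    have "finite (generate F {x})" using generate_incl[of "{x}"] x fin_F finite_subset by auto
    then obtain y where "y \<in> carrier F" "y \<notin> generate F {x}"
      using exists_outside[of "generate F {x}" "carrier F"] card_generate[OF x] card_F lt by auto
    moreover have "\<one> \<in> generate F {x}" by (rule generate.one)
    ultimately show ?thesis by auto
  qed
  show cap: "\<exists>l\<in>lines. e \<notin> l" if e: "e \<in> carrier F" "e \<noteq> \<one>" for e
  proof -
    obtain y where y: "y \<in> carrier F - {\<one>}" "y \<notin> generate F {e}" using *[of e] e by blast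
    have l: "generate F {y} \<in> lines" using y by (auto simp: lines_def)
    have "e \<notin> generate F {y}"
    proof
      assume "e \<in> generate F {y}"
      then have "generate F {y} = generate F {e}" using line_eq[OF l] e by simp
      moreover have "y \<in> generate F {y}" by (rule generate.incl) simp
      ultimately show False using y by simp
    qed
    then show ?thesis using l by blast
  qed
  have "card {\<one>} < card (carrier F)" using lt p_pos card_F by simp
  then obtain x where x: "x \<in> carrier F" "x \<noteq> \<one>" using exists_outside[of "{\<one>}" "carrier F"] by auto
  obtain l where l: "l \<in> lines" "x \<notin> l" using cap[OF x] by blast
  have "generate F {x} \<in> lines" "x \<in> generate F {x}" using x by (auto simp: lines_def intro: generate.incl)
  then have "card {l, generate F {x}} \<le> card lines" "l \<noteq> generate F {x}" using l fin_lines by (auto intro!: card_mono)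
  then show "2 \<le> card lines" by simp
qed

lemma \<tau>_eq_id: "e \<in> carrier F \<Longrightarrow> \<tau> e = id \<longleftrightarrow> e = \<one>"
  using \<tau>_id lines_cap subgroup.one_closed[OF line_subgroup] by blast

lemma \<tau>_inverse: "e \<in> carrier F \<Longrightarrow> \<tau> e \<circ> \<tau> (inv e) = id" "e \<in> carrier F \<Longrightarrow> \<tau> (inv e) \<circ> \<tau> e = id"
  using \<tau>_comp \<tau>_eq_id by auto

lemma \<tau>_inj: "inj_on \<tau> (carrier F)"
proof (rule inj_onI)
  fix e e' assume e: "e \<in> carrier F" "e' \<in> carrier F" "\<tau> e = \<tau> e'"
  then have "\<tau> (e \<otimes> inv e') = id" using \<tau>_comp[of e "inv e'"] \<tau>_inverse[of e'] by simp
  then have "e \<otimes> inv e' = \<one>" using \<tau>_eq_id e by simp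
  then show "e = e'" using e by (metis inv_equality inv_inv inv_closed)
qed

lemma \<tau>_permutes: "e \<in> carrier F \<Longrightarrow> \<tau> e permutes pts"
  using \<tau>_inverse[of e] \<tau>_simps(3) by (intro permutesI)

lemma \<tau>_pinv: "e \<in> carrier F \<Longrightarrow> pinv (\<tau> e) = \<tau> (inv e)"
  using \<tau>_inverse by (intro inv_unique_comp)

lemma \<tau>_group: "perm_group pts (\<tau> ` carrier F)"
proof (rule perm_groupI)
  show "id \<in> \<tau> ` carrier F" using \<tau>_eq_id[of \<one>] by (metis imageI one_closed)
qed (auto simp: \<tau>_permutes \<tau>_comp \<tau>_pinv simp del: comp_apply)

lemma iso_D:
  assumes "c \<in> iso F F"
  shows "c \<in> hom F F" "bij_betw c (carrier F) (carrier F)" "inj_on c (carrier F)" "x \<in> carrier F \<Longrightarrow> c x \<in> carrier F"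
    "group_hom F F c" "c \<one> = \<one>" "x \<in> carrier F \<Longrightarrow> c x = \<one> \<longleftrightarrow> x = \<one>"
proof -
  show h: "c \<in> hom F F" "bij_betw c (carrier F) (carrier F)" using assms by (auto simp: iso_def)
  then show i: "inj_on c (carrier F)" "x \<in> carrier F \<Longrightarrow> c x \<in> carrier F" by (auto simp: bij_betw_def)
  show gh: "group_hom F F c" using h is_group by (auto simp: group_hom_def group_hom_axioms_def)
  then show o: "c \<one> = \<one>" using group_hom.hom_one by blast
  show "x \<in> carrier F \<Longrightarrow> c x = \<one> \<longleftrightarrow> x = \<one>" using i(1) o by (metis inj_onD one_closed)
qed

lemma iso_line:
  assumes "c \<in> iso F F" "x \<in> carrier F"
  shows "c ` generate F {x} = generate F {c x}"
  using group_hom.generate_img[OF iso_D(5)[OF assms(1)], of "{x}"] assms(2) by simp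

lemma iso_lines: "c \<in> iso F F \<Longrightarrow> l \<in> lines \<Longrightarrow> c ` l \<in> lines"
proof -
  assume c: "c \<in> iso F F" and "l \<in> lines"
  then obtain x where x: "x \<in> carrier F - {\<one>}" "l = generate F {x}" by (auto simp: lines_def)
  then have "c ` l = generate F {c x}" "c x \<in> carrier F - {\<one>}" using iso_line[OF c, of x] iso_D[OF c] by auto
  then show ?thesis by (auto simp: lines_def)
qed

lemma iso_shift:
  assumes "c \<in> iso F F" "K \<subseteq> carrier F" "e \<in> carrier F"
  shows "c ` (K #> e) = (c ` K) #> c e"
proof -
  have "c (k \<otimes> e) = c k \<otimes> c e" if "k \<in> K" for k
    using assms that hom_mult[OF iso_D(1)[OF assms(1)]] by blast
  then show ?thesis by (auto simp: r_coset_def image_UN)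
qed

lemma iso_rcos:
  assumes "c \<in> iso F F" "l \<in> lines" "K \<in> rcosets l"
  shows "c ` K \<in> rcosets (c ` l)"
proof -
  obtain a where a: "a \<in> carrier F" "K = l #> a" using rcosE assms by metis
  then show ?thesis
    using iso_shift[OF assms(1) line_sub[OF assms(2)] a(1)]
      rcosetsI[OF line_sub[OF iso_lines[OF assms(1,2)]]] iso_D(4)[OF assms(1) a(1)] by simp
qed

lemma iso_image_eq:
  assumes "c \<in> iso F F" "K \<subseteq> carrier F" "K' \<subseteq> carrier F"
  shows "c ` K = c ` K' \<longleftrightarrow> K = K'"
  using inj_on_image_eq_iff[OF iso_D(3)[OF assms(1)] assms(2,3)] .

lemma pts_sub: "(l, K, b) \<in> pts \<Longrightarrow> l \<subseteq> carrier F \<and> K \<subseteq> carrier F"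
  using line_sub rcos_sub by (auto simp: pts_def)

lemma \<gamma>_pts:
  assumes "c \<in> iso F F" "(l, K, b) \<in> pts"
  shows "(c ` l, c ` K, b) \<in> pts"
  using assms iso_lines iso_rcos iso_image_eq[OF assms(1)] pts_sub[OF assms(2)] by (auto simp: pts_def)

lemma \<gamma>_simps: "(l, K, b) \<in> pts \<Longrightarrow> \<gamma> c (l, K, b) = (c ` l, c ` K, b)" "x \<notin> pts \<Longrightarrow> \<gamma> c x = x"
  by (auto simp: \<gamma>_def split: prod.splits)

lemma \<gamma>_comp:
  assumes "c \<in> iso F F" "d \<in> iso F F" shows "\<gamma> c \<circ> \<gamma> d = \<gamma> (c \<circ> d)"
proof
  fix x :: "'a set \<times> 'a set \<times> bool"
  obtain l K b where x: "x = (l, K, b)" by (metis prod_cases3)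
  show "(\<gamma> c \<circ> \<gamma> d) x = \<gamma> (c \<circ> d) x"
    using x \<gamma>_pts[OF assms(2)] by (cases "x \<in> pts") (auto simp: \<gamma>_simps image_comp)
qed

lemma \<gamma>_id:
  assumes "\<And>x. x \<in> carrier F \<Longrightarrow> c x = x" shows "\<gamma> c = id"
proof
  fix x :: "'a set \<times> 'a set \<times> bool"
  obtain l K b where x: "x = (l, K, b)" by (metis prod_cases3)
  have "c ` K = K" if "K \<subseteq> carrier F" for K
  proof -
    have "c ` K = id ` K" using that assms by (intro image_cong) auto
    then show ?thesis by simp
  qed
  then show "\<gamma> c x = id x" using x pts_sub by (cases "x \<in> pts") (auto simp: \<gamma>_simps)
qed

lemma \<gamma>_inverse:
  assumes "c \<in> iso F F"
  obtains d where "d \<in> iso F F" "\<gamma> c \<circ> \<gamma> d = id" "\<gamma> d \<circ> \<gamma> c = id"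
proof -
  let ?d = "inv_into (carrier F) c"
  have d: "?d \<in> iso F F" by (rule iso_set_sym[OF assms])
  have "c (?d x) = x" "?d (c x) = x" if "x \<in> carrier F" for x
    using that iso_D(2)[OF assms] by (auto simp: bij_betw_def f_inv_into_f)
  then have "\<gamma> c \<circ> \<gamma> ?d = id" "\<gamma> ?d \<circ> \<gamma> c = id" using \<gamma>_comp assms d \<gamma>_id by auto
  then show ?thesis using that d by blast
qed

lemma \<gamma>_bij: assumes "c \<in> iso F F" shows "\<gamma> c permutes pts" "bij (\<gamma> c)"
proof -
  show "\<gamma> c permutes pts" using \<gamma>_inverse[OF assms] permutesI \<gamma>_simps(2) by metis
  then show "bij (\<gamma> c)" using permutes_bij by blast
qed

lemma \<gamma>_group: "perm_group pts (\<gamma> ` iso F F)"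
proof (rule perm_groupI)
  fix x assume "x \<in> \<gamma> ` iso F F"
  then obtain c where c: "c \<in> iso F F" "x = \<gamma> c" by auto
  then show "x permutes pts" using \<gamma>_bij by simp
  obtain d where d: "d \<in> iso F F" "\<gamma> c \<circ> \<gamma> d = id" "\<gamma> d \<circ> \<gamma> c = id" using \<gamma>_inverse[OF c(1)] .
  then have "pinv x = \<gamma> d" using c by (simp add: inv_unique_comp)
  then show "pinv x \<in> \<gamma> ` iso F F" using d by simp
  fix y assume "y \<in> \<gamma> ` iso F F"
  then obtain e where e: "e \<in> iso F F" "y = \<gamma> e" by auto
  have "c \<circ> e \<in> iso F F" using iso_set_trans[OF e(1) c(1)] by (simp add: compose_def comp_def iso_def hom_def bij_betw_def inj_on_def)
  then show "x \<circ> y \<in> \<gamma> ` iso F F" using \<gamma>_comp c e by simp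
next
  have "id \<in> iso F F" using iso_set_refl by (simp add: id_def)
  moreover have "\<gamma> id = id" by (rule \<gamma>_id) simp
  ultimately show "id \<in> \<gamma> ` iso F F" by (metis imageI)
qed

lemma \<gamma>_\<tau>:
  assumes "c \<in> iso F F" "e \<in> carrier F"
  shows "\<gamma> c \<circ> \<tau> e \<circ> pinv (\<gamma> c) = \<tau> (c e)"
proof -
  have "\<gamma> c \<circ> \<tau> e = \<tau> (c e) \<circ> \<gamma> c"
  proof
    fix x :: "'a set \<times> 'a set \<times> bool"
  obtain l K b where x: "x = (l, K, b)" by (metis prod_cases3)
    show "(\<gamma> c \<circ> \<tau> e) x = (\<tau> (c e) \<circ> \<gamma> c) x"
    proof (cases "x \<in> pts")
      case True
      then show ?thesis
        using x \<gamma>_pts[OF assms(1)] \<tau>_pts[OF assms(2) True] pts_sub iso_shift[OF assms(1) _ assms(2)]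
        by (cases b) (auto simp: \<gamma>_simps \<tau>_simps)
    qed (simp add: \<tau>_simps \<gamma>_simps)
  qed
  then show ?thesis using \<gamma>_bij[OF assms(1)] by (simp add: comp_assoc pinv_cancel)
qed

lemma flip_simps: "(l, K, b) \<in> pts \<Longrightarrow> K \<noteq> l \<Longrightarrow> flip (l, K, b) = (l, K, \<not> b)" "flip (l, l, b) = (l, l, b)" "x \<notin> pts \<Longrightarrow> flip x = x"
  by (auto simp: flip_def split: prod.splits)

lemma flip_flip: "flip \<circ> flip = id"
proof
  fix x :: "'a set \<times> 'a set \<times> bool"
  obtain l K b where x: "x = (l, K, b)" by (metis prod_cases3)
  show "(flip \<circ> flip) x = id x"
    using x by (auto simp: flip_def pts_def)
qed

lemma flip_permutes: "flip permutes pts"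
  by (rule permutesI[OF flip_simps(3) flip_flip flip_flip])

text \<open>An automorphism keeps the flag and maps the coset without a copy to the coset without a
  copy.\<close>

lemma flip_\<gamma>:
  assumes "c \<in> iso F F" shows "flip \<circ> \<gamma> c = \<gamma> c \<circ> flip"
proof
  fix x :: "'a set \<times> 'a set \<times> bool"
  obtain l K b where x: "x = (l, K, b)" by (metis prod_cases3)
  show "(flip \<circ> \<gamma> c) x = (\<gamma> c \<circ> flip) x"
  proof (cases "x \<in> pts \<and> K \<noteq> l")
    case True
    then have "(l, K, \<not> b) \<in> pts" "c ` K \<noteq> c ` l"
      using x pts_sub[of l K b] iso_image_eq[OF assms, of K l] by (auto simp: pts_def)
    then show ?thesis using True x \<gamma>_pts[OF assms, of l K b] by (simp add: \<gamma>_simps flip_simps)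
  next
    case False
    then show ?thesis using x by (cases "x \<in> pts") (auto simp: \<gamma>_simps flip_simps)
  qed
qed

section \<open>Size, parity and generation inside one block\<close>

lemma fst_pts: "fst ` pts = lines"
  using self_rcos by (force simp: pts_def)

abbreviation Bl where "Bl l \<equiv> {x \<in> pts. fst x = l}"

lemma fin_pts: "finite pts"
proof -
  have "pts \<subseteq> Pow (carrier F) \<times> Pow (carrier F) \<times> UNIV" using pts_sub by fast
  then show ?thesis by (rule finite_subset) (use fin_F in auto)
qed

lemma card_Bl:
  assumes "l \<in> lines" shows "5 \<le> card (Bl l)"
proof -
  let ?A = "(\<lambda>K. (l, K, False)) ` (rcosets l)" and ?D = "(\<lambda>K. (l, K, True)) ` (rcosets l - {l})"
  have "x \<in> Bl l \<longleftrightarrow> x \<in> ?A \<union> ?D" for x using assms by (cases x) (auto simp: pts_def)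
  then have "Bl l = ?A \<union> ?D" unfolding set_eq_iff by blast
  moreover have fin: "finite (rcosets l)" using line_card_rcosets[OF assms] big by (metis card.infinite not_numeral_le_zero)
  moreover have "card ?A = card (rcosets l)" by (intro card_image) (auto simp: inj_on_def)
  moreover have "card ?D = card (rcosets l - {l})" by (intro card_image) (auto simp: inj_on_def)
  moreover have "card (?A \<union> ?D) = card ?A + card ?D" using fin by (intro card_Un_disjoint) auto
  moreover have "card (rcosets l - {l}) = card (rcosets l) - 1" using self_rcos[OF assms] by simp
  \<comment> \<open>All cosets, and a copy of each except \<open>l\<close>.\<close>
  ultimately have "card (Bl l) = p ^ (m - 1) + (p ^ (m - 1) - 1)"
    using line_card_rcosets[OF assms] by presburger
  then show ?thesis using big by linarith
qed

lemma other_coset: "l \<in> lines \<Longrightarrow> \<exists>K\<in>rcosets l. K \<noteq> l"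
  by (rule exists_outside[of "{l}" "rcosets l"]) (use line_card_rcosets big in auto)

lemma \<tau>_Bl: "e \<in> carrier F \<Longrightarrow> fst (\<tau> e x) = fst x"
  by (auto simp: \<tau>_def split: prod.splits)

lemma \<tau>_image_Bl: assumes "e \<in> carrier F" shows "\<tau> e ` Bl l = Bl l"
proof -
  have "\<tau> e' ` Bl l \<subseteq> Bl l" if "e' \<in> carrier F" for e' using \<tau>_Bl \<tau>_pts that by auto
  from this[OF assms] this[of "inv e"] have "\<tau> e ` Bl l \<subseteq> Bl l" "\<tau> (inv e) ` Bl l \<subseteq> Bl l" using assms by auto
  moreover have "x = \<tau> e (\<tau> (inv e) x)" for x using \<tau>_inverse(1)[OF assms] by (metis comp_apply id_apply)
  ultimately show ?thesis by blast
qed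

lemma \<tau>_restrict_permutes: "e \<in> carrier F \<Longrightarrow> restrict_id (\<tau> e) (Bl l) permutes Bl l"
  using \<tau>_image_Bl[of e l] permutes_inj_on[OF \<tau>_permutes] by (intro permutes_restrict_id) (simp add: bij_betw_def)

lemma fin_Bl: "finite (Bl l)"
  using fin_pts by simp

text \<open>For odd \<open>p\<close> a translation is the square of another one. For
  \<open>p = 2\<close> and \<open>e\<close> outside \<open>l\<close> it fixes the copies and moves
  every coset of \<open>l\<close>, so its parity is read off from their number.\<close>

lemma \<tau>_even:
  assumes e: "e \<in> carrier F" and l: "l \<in> lines"
  shows "evenperm (restrict_id (\<tau> e) (Bl l))"
proof (cases "e \<in> l")
  case True
  then have "restrict_id (\<tau> e) (Bl l) = id"
    using rcos_shift(2)[OF l _ e] by (auto simp: fun_eq_iff restrict_id_def \<tau>_def pts_def)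
  then show ?thesis by (simp only: evenperm_id)
next
  case el: False
  show ?thesis
  proof (cases "p = 2")
    case False
    then have "odd p" using prime prime_odd_nat p_pos by (metis One_nat_def Suc_1 nat_less_le Suc_leI)
    then have pp: "(p + 1) div 2 + (p + 1) div 2 = p + 1" by presburger
    \<comment> \<open>Halving in odd order: the exponent doubles to \<open>p + 1\<close>, and the
      \<open>p\<close>-th power of \<open>e\<close> is trivial.\<close>
    define f where "f = e [^] ((p + 1) div 2)"
    have f: "f \<in> carrier F" using e by (simp add: f_def)
    have "f \<otimes> f = e [^] (p + 1)" using e pp by (simp add: f_def nat_pow_mult)
    then have ff: "f \<otimes> f = e" using e exponent by simp
    have "restrict_id (\<tau> e) (Bl l) = restrict_id (\<tau> f) (Bl l) \<circ> restrict_id (\<tau> f) (Bl l)"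
      using restrict_id_comp[of "\<tau> f" "Bl l" "\<tau> f"] \<tau>_image_Bl[OF f, of l] \<tau>_comp[OF f f] ff by simp
    moreover have "permutation (restrict_id (\<tau> f) (Bl l))"
      using permutes_imp_permutation[OF fin_Bl \<tau>_restrict_permutes[OF f]] .
    ultimately show ?thesis by (simp add: evenperm_comp)
  next
    case True
    let ?S = "(\<lambda>K. (l, K, False)) ` (rcosets l)" and ?q = "restrict_id (\<tau> e) (Bl l)"
    have ee: "e \<otimes> e = \<one>" using exponent[OF e] e True by (simp add: numeral_2_eq_2)
    \<comment> \<open>\<open>big\<close> fails for \<open>p = m = 2\<close>; from
      \<open>m = 3\<close> on, the number \<open>2 ^ (m - 1)\<close> of cosets is divisible by
      4.\<close>
    have "m \<noteq> 2" using big True by auto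
    then have "p ^ (m - 1) = 4 * 2 ^ (m - 3)" using m2 True by (cases m; cases "m - 1"; cases "m - 2") auto
    moreover have "card ?S = card (rcosets l)" by (intro card_image) (auto simp: inj_on_def)
    ultimately have dvd: "4 dvd card ?S" using line_card_rcosets[OF l] by simp
    have SB: "x \<in> Bl l \<longleftrightarrow> x \<in> ?S \<or> (\<exists>K. x = (l, K, True) \<and> x \<in> pts)" for x
      using l by (auto simp: pts_def)
    have fixed: "?q x = x" if "x \<notin> ?S" for x
      using that SB[of x] by (auto simp: restrict_id_def \<tau>_simps)
    have "?q \<circ> ?q = restrict_id (\<tau> e \<circ> \<tau> e) (Bl l)"
      using \<tau>_image_Bl[OF e, of l] by (intro restrict_id_comp[symmetric]) simp
    also have "\<tau> e \<circ> \<tau> e = id" using \<tau>_comp[OF e e] ee \<tau>_eq_id[of \<one>] by (simp only: one_closed)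
    also have "restrict_id id (Bl l) = id" by (auto simp: restrict_id_def fun_eq_iff)
    finally have qq: "?q \<circ> ?q = id" .
    have "?q x \<noteq> x" if "x \<in> ?S" for x
      using that el rcos_shift(2)[OF l _ e] l by (auto simp: restrict_id_def \<tau>_simps pts_def)
    moreover have "finite ?S" using line_card_rcosets[OF l] big by (metis card.infinite not_numeral_le_zero finite_imageI)
    ultimately show ?thesis
      using even_fixpoint_free_involution[OF _ permutesI[OF fixed qq qq] qq] dvd by blast
  qed
qed

text \<open>The coset \<open>l\<close> is the only point of the block moved both by translations and
  by their conjugates under \<open>flip\<close>. Commutators therefore give the three-cycles through
  \<open>l\<close>, one further coset and one copy.\<close>

lemma block_generation:
  assumes l: "l \<in> lines" and Y: "perm_group (Bl l) Y"
    and e1: "\<And>e. e \<in> carrier F \<Longrightarrow> restrict_id (\<tau> e) (Bl l) \<in> Y"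
    and e2: "\<And>e. e \<in> carrier F \<Longrightarrow> restrict_id (flip \<circ> \<tau> e \<circ> flip) (Bl l) \<in> Y"
  shows "alt (Bl l) \<subseteq> Y"
proof -
  let ?z = "(l, l, False)"
  have zp: "?z \<in> pts" using self_rcos l by (simp add: pts_def)
  note Y' = perm_groupD[OF Y]
  have mixed: "transpose ?z (l, K', True) \<circ> transpose ?z (l, K, False) \<in> Y"
    if K: "K \<in> rcosets l" "K \<noteq> l" "K' \<in> rcosets l" "K' \<noteq> l" for K K'
  proof -
    obtain e where e: "e \<in> carrier F" "K = l #> e" using rcosE[OF l K(1)] .
    obtain e' where e': "e' \<in> carrier F" "K' = l #> e'" using rcosE[OF l K(3)] .
    let ?u = "restrict_id (\<tau> e) (Bl l)" and ?w = "restrict_id (flip \<circ> \<tau> e' \<circ> flip) (Bl l)"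
    have K'p: "(l, K', False) \<in> pts" "(l, K', True) \<in> pts" using K l by (auto simp: pts_def)
    have uz: "?u ?z = (l, K, False)" using zp e by (simp add: restrict_id_def \<tau>_simps)
    have wz: "?w ?z = (l, K', True)" using zp e' K K'p by (simp add: restrict_id_def \<tau>_simps flip_simps)
    have uw: "?u \<in> Y" "?w \<in> Y" using e1[OF e(1)] e2[OF e'(1)] by blast+
    have supp: "?u x = x \<or> ?w x = x" if "x \<noteq> ?z" for x
    proof -
      obtain l' J b where x: "x = (l', J, b)" by (metis prod_cases3)
      show ?thesis
      proof (cases "x \<in> Bl l")
        case True
        then have "l' = l" "(l, J, b) \<in> pts" using x by auto
        show ?thesis
        proof (cases b)
          case True
          then show ?thesis using x by (simp add: restrict_id_def \<tau>_simps)
        next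
          case False
          then have "J \<noteq> l" using that x \<open>l' = l\<close> by auto
          moreover from this have "(l, J, True) \<in> pts" "(l, J, False) \<in> pts"
            using \<open>(l, J, b) \<in> pts\<close> by (auto simp: pts_def)
          ultimately have "(flip \<circ> \<tau> e' \<circ> flip) x = x"
            using x False \<open>l' = l\<close> by (simp add: flip_simps \<tau>_simps)
          then show ?thesis by (simp add: restrict_id_def)
        qed
      qed (auto simp: restrict_id_def)
    qed
    have "?u \<circ> ?w \<circ> pinv ?u \<circ> pinv ?w = transpose ?z (?w ?z) \<circ> transpose ?z (?u ?z)"
      using uz wz K by (intro commutator_eq_cyc3 Y'(5) uw supp) auto
    then have "?u \<circ> ?w \<circ> pinv ?u \<circ> pinv ?w = transpose ?z (l, K', True) \<circ> transpose ?z (l, K, False)"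
      unfolding uz wz .
    moreover have "?u \<circ> ?w \<circ> pinv ?u \<circ> pinv ?w \<in> Y"
      by (rule Y'(3)[OF Y'(3)[OF Y'(3)[OF uw] Y'(4)[OF uw(1)]] Y'(4)[OF uw(2)]])
    ultimately show ?thesis by metis
  qed
  have mixed': "transpose ?z (l, K, False) \<circ> transpose ?z (l, K', True) \<in> Y"
    if K: "K \<in> rcosets l" "K \<noteq> l" "K' \<in> rcosets l" "K' \<noteq> l" for K K'
  proof -
    have "pinv (transpose ?z (l, K', True) \<circ> transpose ?z (l, K, False)) \<in> Y" using mixed[OF K] Y'(4) by blast
    then show ?thesis by (simp add: pinv_comp)
  qed
  show ?thesis
  proof (rule alt_star_induct[OF fin_Bl _ Y'(2,3)])
    show "?z \<in> Bl l" using zp by simp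
    fix x y assume xy: "x \<in> Bl l - {?z}" "y \<in> Bl l - {?z}" "x \<noteq> y"
    obtain J b where x: "x = (l, J, b)" using xy(1) by (cases x) auto
    obtain K d where y: "y = (l, K, d)" using xy(2) by (cases y) auto
    have J: "J \<in> rcosets l" "J \<noteq> l" using xy(1) x by (auto simp: pts_def)
    have K: "K \<in> rcosets l" "K \<noteq> l" using xy(2) y by (auto simp: pts_def)
    \<comment> \<open>Two cosets, or two copies, are reached by inserting a point \<open>a\<close>
      of the other kind.\<close>
    have mid: "transpose ?z x \<circ> transpose ?z y = (transpose ?z x \<circ> transpose ?z a) \<circ> (transpose ?z a \<circ> transpose ?z y)" for a
      by (simp add: fun_eq_iff)
    show "transpose ?z x \<circ> transpose ?z y \<in> Y"
    proof (cases b; cases d)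
      assume "b" "d"
      then show ?thesis unfolding mid[of "(l, J, False)"] using x y mixed[OF J J] mixed'[OF J K] Y'(3) by simp
    next
      assume "\<not> b" "\<not> d"
      then show ?thesis unfolding mid[of "(l, J, True)"] using x y mixed'[OF J J] mixed[OF K J] Y'(3) by simp
    qed (use x y mixed[OF K J] mixed'[OF J K] in simp_all)
  qed
qed

text \<open>\<open>\<Delta>\<close> is the set of points that are not copies: translations and
  automorphisms keep the flag, and every block has points of both kinds.\<close>

lemma is_block_data: "block_data pts fst (\<tau> ` carrier F) (\<gamma> ` iso F F) flip {(l, K, b). \<not> b}"
proof (unfold_locales, unfold fst_pts)
  show "finite pts" by (rule fin_pts)
  show "5 \<le> card (Bl i)" if "i \<in> lines" for i using card_Bl that .
  show "2 \<le> card lines" by (rule two_lines)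
  show "perm_group pts (\<tau> ` carrier F)" by (rule \<tau>_group)
  show "perm_group pts (\<gamma> ` iso F F)" by (rule \<gamma>_group)
  show "c \<circ> e \<circ> pinv c \<in> \<tau> ` carrier F" if "c \<in> \<gamma> ` iso F F" "e \<in> \<tau> ` carrier F" for c e
    using that \<gamma>_\<tau> iso_D(4) by (auto simp del: comp_apply)
  show "fst (e x) = fst x" if "e \<in> \<tau> ` carrier F" for e x using that \<tau>_Bl by (metis imageE)
  show "evenperm (restrict_id e (Bl i))" if "e \<in> \<tau> ` carrier F" "i \<in> lines" for e i using that \<tau>_even by blast
  show "fst (c x) = fst (c y) \<longleftrightarrow> fst x = fst y" if c: "c \<in> \<gamma> ` iso F F" and xy: "x \<in> pts" "y \<in> pts" for c x y
  proof -
    obtain d where d: "d \<in> iso F F" "c = \<gamma> d" using c by auto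
    have "fst (c z) = d ` fst z \<and> fst z \<subseteq> carrier F" if "z \<in> pts" for z
      using that d pts_sub by (cases z) (auto simp: \<gamma>_simps)
    then show ?thesis using xy iso_image_eq[OF d(1)] by simp
  qed
  show "\<exists>c\<in>\<gamma> ` iso F F. fst (c x) = fst y" if xy: "x \<in> pts" "y \<in> pts" for x y
  proof -
    obtain l K b where x: "x = (l, K, b)" by (metis prod_cases3)
    have "l \<in> lines" "fst y \<in> lines" using xy x fst_pts by (auto simp: pts_def)
    then obtain a a' where a: "a \<in> carrier F - {\<one>}" "l = generate F {a}" "a' \<in> carrier F - {\<one>}" "fst y = generate F {a'}"
      by (auto simp: lines_def)
    obtain c where c: "c \<in> iso F F" "c a = a'" using aut_trans a by blast
    then have "fst (\<gamma> c x) = fst y" using iso_line[OF c(1), of a] a x xy by (simp add: \<gamma>_simps)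
    then show ?thesis using c by blast
  qed
  show "flip permutes pts" by (rule flip_permutes)
  show "flip \<circ> flip = id" by (rule flip_flip)
  show "fst (flip x) = fst x" for x by (auto simp: flip_def split: prod.splits)
  show "flip \<circ> c = c \<circ> flip" if "c \<in> \<gamma> ` iso F F" for c using that flip_\<gamma> by blast
  show "\<exists>c\<in>\<gamma> ` iso F F. c \<circ> e \<circ> pinv c = e'"
    if e: "e \<in> \<tau> ` carrier F" "e \<noteq> id" "e' \<in> \<tau> ` carrier F" "e' \<noteq> id" for e e'
  proof -
    obtain a a' where a: "a \<in> carrier F" "e = \<tau> a" "a' \<in> carrier F" "e' = \<tau> a'" using e by auto
    then have "a \<noteq> \<one>" "a' \<noteq> \<one>" using e \<tau>_eq_id by auto
    then obtain c where "c \<in> iso F F" "c a = a'" using aut_trans[of a a'] a by auto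
    then show ?thesis using \<gamma>_\<tau> a by blast
  qed
  show "q x \<in> {(l, K, b). \<not> b} \<longleftrightarrow> x \<in> {(l, K, b). \<not> b}" if "q \<in> \<tau> ` carrier F \<union> \<gamma> ` iso F F" for q x
    using that by (auto simp: \<tau>_def \<gamma>_def split: prod.splits if_splits)
  show "\<exists>x\<in>pts. \<exists>y\<in>pts. fst x = i \<and> fst y = i \<and> x \<in> {(l, K, b). \<not> b} \<and> y \<notin> {(l, K, b). \<not> b}" if i: "i \<in> lines" for i
  proof -
    obtain K where "K \<in> rcosets i" "K \<noteq> i" using other_coset[OF i] by blast
    then have "(i, i, False) \<in> pts" "(i, K, True) \<in> pts" using i self_rcos by (auto simp: pts_def)
    then show ?thesis by force
  qed
  show "\<exists>e\<in>\<tau> ` carrier F. restrict_id e (Bl j) = id \<and> restrict_id e (Bl i) \<noteq> id"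
    if ij: "i \<in> lines" "j \<in> lines" "i \<noteq> j" for i j
  proof -
    \<comment> \<open>A nontrivial element of the line \<open>j\<close> is trivial on its block; it
      lies on no other line, so it moves the coset \<open>i\<close> in the block of
      \<open>i\<close>.\<close>
    obtain e where e: "e \<in> j" "e \<noteq> \<one>" using line_ex[OF ij(2)] by blast
    have eF: "e \<in> carrier F" using e line_sub[OF ij(2)] by auto
    have ei: "e \<notin> i" using line_eq[OF ij(1)] line_eq[OF ij(2)] e ij(3) by metis
    have "restrict_id (\<tau> e) (Bl j) = id"
      using rcos_shift(2)[OF ij(2) _ eF] e by (auto simp: fun_eq_iff restrict_id_def \<tau>_def pts_def)
    moreover have "restrict_id (\<tau> e) (Bl i) (i, i, False) \<noteq> (i, i, False)"
      using ei rcos_shift(2)[OF ij(1) self_rcos[OF ij(1)] eF] self_rcos[OF ij(1)] ij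
      by (simp add: restrict_id_def \<tau>_simps pts_def)
    then have "restrict_id (\<tau> e) (Bl i) \<noteq> id" by (metis id_apply)
    ultimately show ?thesis using eF by blast
  qed
  show "alt (Bl i) \<subseteq> Y" if "i \<in> lines" "perm_group (Bl i) Y"
    "\<And>e. e \<in> \<tau> ` carrier F \<Longrightarrow> restrict_id e (Bl i) \<in> Y"
    "\<And>e. e \<in> \<tau> ` carrier F \<Longrightarrow> restrict_id (flip \<circ> e \<circ> flip) (Bl i) \<in> Y" for i Y
    using block_generation[OF that(1,2)] that(3,4) by blast
qed

end

section \<open>Coordinate vectors over the integers modulo a prime\<close>

abbreviation Zp_vec :: "nat \<Rightarrow> nat \<Rightarrow> (nat \<Rightarrow> int) monoid" where
  "Zp_vec p m \<equiv> product_group {..<m} (\<lambda>_. integer_mod_group p)"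

text \<open>Basis exchange: if \<open>v j\<close> is nonzero, then \<open>v\<close> and the unit
  vectors other than the \<open>j\<close>-th form a basis. The map \<open>c\<close> sends the unit
  vector at 0 to \<open>v\<close> and the remaining unit vectors to these.\<close>

lemma Zp_vec_aut:
  assumes p: "Factorial_Ring.prime p" and m: "0 < m"
    and v: "v \<in> carrier (Zp_vec p m)" "v \<noteq> \<one>\<^bsub>Zp_vec p m\<^esub>"
  shows "\<exists>c\<in>iso (Zp_vec p m) (Zp_vec p m). c (\<lambda>i\<in>{..<m}. if i = 0 then 1 else 0) = v"
proof -
  let ?F = "Zp_vec p m"
  have p1: "1 < p" using p prime_gt_1_nat by blast
  have carr: "x \<in> carrier ?F \<longleftrightarrow> x \<in> extensional {..<m} \<and> (\<forall>i<m. 0 \<le> x i \<and> x i < int p)" for x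
    using p1 by (auto simp: carrier_integer_mod_group PiE_def Pi_def)
  have "\<exists>j<m. v j \<noteq> 0"
  proof (rule ccontr)
    assume "\<not> ?thesis"
    then have "v = \<one>\<^bsub>?F\<^esub>" using v(1) unfolding carr by (auto simp: extensional_def fun_eq_iff)
    then show False using v by simp
  qed
  then obtain j where j: "j < m" "v j \<noteq> 0" by blast
  \<comment> \<open>Reindexing: a position \<open>i\<close> other than \<open>j\<close> receives
    coordinate \<open>s i\<close>, which is never coordinate 0, and each other coordinate is used
    exactly once.\<close>
  define s where "s = transpose 0 j"
  have s_lt: "s i < m" if "i < m" for i using that j m by (auto simp: s_def transpose_def)
  have s_s: "s (s i) = i" for i by (simp add: s_def)
  define c where "c x = (\<lambda>i\<in>{..<m}. (x 0 * v i + (if i = j then 0 else x (s i))) mod int p)" for x :: "nat \<Rightarrow> int"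
  have c_carr: "c x \<in> carrier ?F" for x unfolding carr using p1 by (auto simp: c_def)
  have hom: "c \<in> hom ?F ?F"
  proof (rule homI)
    fix x y assume "x \<in> carrier ?F" "y \<in> carrier ?F"
    show "c (x \<otimes>\<^bsub>?F\<^esub> y) = c x \<otimes>\<^bsub>?F\<^esub> c y"
    proof
      fix i
      show "c (x \<otimes>\<^bsub>?F\<^esub> y) i = (c x \<otimes>\<^bsub>?F\<^esub> c y) i"
      proof (cases "i < m")
        case True
        define dx where "dx = (if i = j then 0 else x (s i))"
        define dy where "dy = (if i = j then 0 else y (s i))"
        have "c (x \<otimes>\<^bsub>?F\<^esub> y) i = ((x 0 + y 0) mod int p * v i + (dx + dy) mod int p) mod int p"
          using True m s_lt[OF True] by (simp add: c_def dx_def dy_def)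
        also have "\<dots> = ((x 0 + y 0) * v i + (dx + dy)) mod int p"
          by (rule mod_add_cong[OF mod_mult_left_eq mod_mod_trivial])
        also have "(x 0 + y 0) * v i + (dx + dy) = (x 0 * v i + dx) + (y 0 * v i + dy)"
          by (simp add: distrib_right)
        also have "\<dots> mod int p = ((x 0 * v i + dx) mod int p + (y 0 * v i + dy) mod int p) mod int p"
          by (rule mod_add_eq[symmetric])
        also have "\<dots> = (c x \<otimes>\<^bsub>?F\<^esub> c y) i"
          using True by (simp add: c_def dx_def dy_def)
        finally show ?thesis .
      qed (simp add: c_def)
    qed
  qed (rule c_carr)
  have inj: "inj_on c (carrier ?F)"
  proof (rule inj_onI)
    fix x y assume xy: "x \<in> carrier ?F" "y \<in> carrier ?F" "c x = c y"
    have eq: "(x 0 * v i + (if i = j then 0 else x (s i))) mod int p = (y 0 * v i + (if i = j then 0 else y (s i))) mod int p"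
      if "i < m" for i using fun_cong[OF xy(3), of i] that by (simp add: c_def)
    have range: "\<bar>x i - y i\<bar> < int p" if "i < m" for i
      using xy that unfolding carr by (smt (verit))
    have zero: "a = b" if "int p dvd a - b" "\<bar>a - b\<bar> < int p" for a b :: int
      using that zdvd_not_zless[of "\<bar>a - b\<bar>" "int p"] by (cases "a = b") auto
    \<comment> \<open>Coordinate \<open>j\<close> of the image involves only \<open>x 0\<close>,
      multiplied by the unit \<open>v j\<close>. Once \<open>x 0\<close> is known, coordinate
      \<open>s k\<close> determines \<open>x k\<close>.\<close>
    have "int p dvd (x 0 - y 0) * v j"
      using eq[OF j(1)] by (simp add: mod_eq_dvd_iff left_diff_distrib)
    moreover have "\<not> int p dvd v j"
      using j v(1) unfolding carr by (metis zdvd_not_zless order_le_less)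
    ultimately have "int p dvd x 0 - y 0"
      using p by (simp add: prime_dvd_mult_iff)
    then have x0: "x 0 = y 0" using zero range[OF m] by blast
    have xk: "x k = y k" if k: "k < m" "k \<noteq> 0" for k
    proof -
      have "s k \<noteq> j" using k by (auto simp: s_def transpose_def split: if_splits)
      then have "int p dvd x k - y k"
        using eq[OF s_lt[OF k(1)]] x0 s_s[of k] by (simp add: mod_eq_dvd_iff)
      then show ?thesis using zero range[OF k(1)] by blast
    qed
    show "x = y"
    proof
      fix k show "x k = y k"
        using xy x0 xk unfolding carr by (cases "k < m"; cases "k = 0") (auto simp: extensional_def)
    qed
  qed
  have "finite (carrier ?F)" using p1 by (auto simp: carrier_integer_mod_group intro!: finite_PiE)
  then have "c ` carrier ?F = carrier ?F" using inj c_carr by (intro endo_inj_surj) auto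
  then have iso: "c \<in> iso ?F ?F" using hom inj by (simp add: iso_def bij_betw_def)
  have "c (\<lambda>i\<in>{..<m}. if i = 0 then 1 else 0) = v"
  proof
    fix i
    have "s i \<noteq> 0" if "i \<noteq> j" using that by (auto simp: s_def transpose_def split: if_splits)
    then show "c (\<lambda>i\<in>{..<m}. if i = 0 then 1 else 0) i = v i"
      using v(1) m s_lt[of i] unfolding carr by (cases "i < m") (auto simp: c_def extensional_def)
  qed
  then show ?thesis using iso by blast
qed

lemma elementary_abelian_Zp_vec:
  assumes p: "Factorial_Ring.prime p" and m: "2 \<le> m" and big: "3 \<le> p ^ (m - 1)"
  shows "elementary_abelian (Zp_vec p m) p m"
proof -
  let ?F = "Zp_vec p m"
  have p1: "1 < p" using p prime_gt_1_nat by blast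
  interpret F: group ?F by simp
  have "comm_group ?F" by (rule F.group_comm_groupI) (simp add: add.commute)
  then interpret F: comm_group ?F .
  have pow: "x [^]\<^bsub>?F\<^esub> k = (\<lambda>i\<in>{..<m}. (int k * x i) mod int p)" for x and k :: nat
    by (induction k) (auto simp: F.nat_pow_Suc fun_eq_iff mod_simps algebra_simps)
  show ?thesis
  proof
    show "card (carrier ?F) = p ^ m" using p1 by (simp add: carrier_integer_mod_group card_PiE)
    show "x [^]\<^bsub>?F\<^esub> p = \<one>\<^bsub>?F\<^esub>" for x by (auto simp: pow fun_eq_iff)
    fix x y assume "x \<in> carrier ?F - {\<one>\<^bsub>?F\<^esub>}" "y \<in> carrier ?F - {\<one>\<^bsub>?F\<^esub>}"
    then obtain c d where c: "c \<in> iso ?F ?F" "c (\<lambda>i\<in>{..<m}. if i = 0 then 1 else 0) = x"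
      and d: "d \<in> iso ?F ?F" "d (\<lambda>i\<in>{..<m}. if i = 0 then 1 else 0) = y"
      using Zp_vec_aut[OF p, of m x] Zp_vec_aut[OF p, of m y] m by auto
    have e: "(\<lambda>i\<in>{..<m}. if i = 0 then 1 else 0) \<in> carrier ?F"
      using p1 by (auto simp: carrier_integer_mod_group)
    \<comment> \<open>The two vectors are joined through the unit vector: back by the inverse of
      \<open>c\<close>, then on by \<open>d\<close>.\<close>
    let ?b = "inv_into (carrier ?F) c"
    have "?b \<in> iso ?F ?F" by (rule F.iso_set_sym[OF c(1)])
    then have "d \<circ> ?b \<in> iso ?F ?F" using d(1) by (auto simp: iso_def intro: hom_compose bij_betw_trans)
    moreover have "?b x = (\<lambda>i\<in>{..<m}. if i = 0 then 1 else 0)"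
      using c e by (metis (no_types, lifting) inv_into_f_f iso_iff)
    ultimately show "\<exists>c\<in>iso ?F ?F. c x = y" using d(2) by (metis comp_apply)
  qed (use assms in auto)
qed

theorem theorem1p2:
  fixes q :: nat
  assumes "prime_power q" and "q \<ge> 3"
    and "card (prime_factors (q + 1)) \<le> 2"
    and "even q \<or> q mod 4 = 3"
  shows "\<exists>(V :: nat set) E G. simple_graph V E \<and> connected_graph V E \<and>
           has_valency V E (q ^ 2) \<and> aut_subgroup V E G \<and>
           two_arc_transitive E G \<and> two_arc_PA_type False V E G"
proof -
  obtain p k where p: "Factorial_Ring.prime (p::nat)" and k: "k \<ge> 1" and q: "q = p ^ k"
    using assms(1) by (auto simp: prime_power_def)
  \<comment> \<open>The dimension \<open>2 * k\<close> makes the group have order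
    \<open>q ^ 2\<close>, the valency. A line then has \<open>p ^ (2 * k - 1)\<close> cosets, at
    least \<open>q\<close> because \<open>k \<ge> 1\<close>.\<close>
  have "p ^ k \<le> p ^ (2 * k - 1)" using k prime_gt_0_nat[OF p] by (intro power_increasing) auto
  then have "3 \<le> p ^ (2 * k - 1)" using assms(2) q by simp
  then interpret F: elementary_abelian "Zp_vec p (2 * k)" p "2 * k"
    using k by (intro elementary_abelian_Zp_vec[OF p]) auto
  interpret block_data F.pts fst "F.\<tau> ` carrier (Zp_vec p (2 * k))"
    "F.\<gamma> ` iso (Zp_vec p (2 * k)) (Zp_vec p (2 * k))" F.flip "{(l, K, b). \<not> b}"
    by (rule F.is_block_data)
  have "card (F.\<tau> ` carrier (Zp_vec p (2 * k))) = p ^ (2 * k)"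
    using card_image[OF F.\<tau>_inj] F.card_F by simp
  also have "\<dots> = q ^ 2" by (simp add: q power_mult[symmetric] mult.commute)
  finally show ?thesis using coset_graph by (intro exI[of _ V] exI[of _ Ed] exI[of _ "act ` G"]) simp
qed

end
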